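(* Let $K_{G_{\mathrm{Az}}}$ be the Kasteleyn matrix of the Aztec diamond of size $k\ell N$ with $k\times\ell$-periodic weights, and assume that $\phi=\Phi^{kN}$ and $\phi^{-1}$ are analytic in a neighbourhood of the unit circle and that $\phi$ admits a Wiener--Hopf factorization. Let $K_{\mathrm{path}}$ be the correlation kernel given by the double contour integral formula in the context. Then for all $\mathrm b_{\ell x+i,ky+j}\in\mathcal B_{\mathrm{Az}}$ and $\mathrm w_{\ell x'+i',ky'+j'}\in\mathcal W_{\mathrm{Az}}$ (with $i,i'\in\{0,\dots,\ell-1\}$, $j,j'\in\{0,\dots,k-1\}$, and integers $x,x',y,y'$), $$\left(K_{G_{\mathrm{Az}}}^{-1}\right)_{\mathrm b_{\ell x+i,ky+j}\,\mathrm w_{\ell x'+i',ky'+j'}}=K_{\mathrm{path}}(2\ell x+2i,\,ky+j;\,2\ell x'+2i'+1,\,ky'+j').$$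
   Context: Weights and matrices. Fix integers $k,\ell,N\ge1$ and reals $\alpha_{j,i},\beta_{j,i},\gamma_{j,i}>0$ ($1\le j\le k$, $1\le i\le\ell$), extended to $i,j\in\mathbb Z$ so as to be $k$-periodic in $j$ and $\ell$-periodic in $i$. For $\vec\alpha,\vec\gamma\in\mathbb C^k$, $\phi^b(z;\vec\alpha,\vec\gamma)$ is the $k\times k$ matrix with diagonal entries $\gamma_1,\dots,\gamma_k$, entries $\alpha_r$ at position $(r+1,r)$ for $1\le r\le k-1$, entry $\alpha_kz^{-1}$ at position $(1,k)$, and zeros elsewhere (for $k=1$ it is $\gamma_1+\alpha_1z^{-1}$). For $\vec\beta\in\mathbb C^k$ and $\beta=\prod_{m=1}^k\beta_m$, $\phi^g(z;\vec\beta)$ is $(1-\beta z^{-1})^{-1}$ times the $k\times k$ matrix whose $(r,s)$ entry is $\prod_{m=s}^{r-1}\beta_m$ for $r\ge s$ and $z^{-1}\prod_{m=s}^{k}\beta_m\prod_{m=1}^{r-1}\beta_m$ for $r<s$. Put $\phi_{2i-1}(z)=\phi^b(z;(\alpha_{j,i})_{j=1}^k,(\gamma_{j,i})_{j=1}^k)$, $\phi_{2i}(z)=\phi^g(z;(\beta_{j,i})_{j=1}^k)$ for $i\ge1$ (so $\phi_{m+2\ell}=\phi_m$), and $\Phi(z)=\phi_1(z)\phi_2(z)\cdots\phi_{2\ell}(z)$. Matrix products $\prod_{m=a+1}^{b}A_m$ mean $A_{a+1}\cdots A_b$ for $b>a$, and $I$ for $b=a$. Graph. Black vertices $\mathrm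 b_{a,c}=(2a,2c+1)$ and white vertices $\mathrm w_{a,c}=(2a+1,2c+2)$, $(a,c)\in\mathbb Z^2$; $\mathrm w_{a,c}$ is joined to $\mathrm b_{a,c}$ (west edge), $\mathrm b_{a,c+1}$ (south), $\mathrm b_{a+1,c+1}$ (east), $\mathrm b_{a+1,c}$ (north). The Aztec diamond of size $k\ell N$ is the induced subgraph $G_{\mathrm{Az}}$ on $\mathcal B_{\mathrm{Az}}=\{\mathrm b_{a,c}:0\le a\le k\ell N,\ 0\le c\le k\ell N-1\}$ and $\mathcal W_{\mathrm{Az}}=\{\mathrm w_{a,c}:0\le a\le k\ell N-1,\ -1\le c\le k\ell N-1\}$. The Kasteleyn matrix $K_{G_{\mathrm{Az}}}$ has rows indexed by $\mathcal W_{\mathrm{Az}}$ and columns by $\mathcal B_{\mathrm{Az}}$; in row $\mathrm w_{a,c}$ its entries are $\gamma_{c+1,a+1}$ at $\mathrm b_{a,c}$, $\alpha_{c+1,a+1}$ at $\mathrm b_{a,c+1}$, $\beta_{c+1,a+1}$ at $\mathrm b_{a+1,c+1}$, $-1$ at $\mathrm b_{a+1,c}$ (whenever these lie in $\mathcal B_{\mathrm{Az}}$) and $0$ otherwise. Wiener--Hopf factorization. $\phi=\Phi^{kN}$ admits a Wiener--Hopf factorization if on the unit circle $\phi=\phi_+\phi_-=\widetilde\phi_-\widetilde\phi_+$, where $\phi_+^{\pm1},\widetilde\phi_+^{\pm1}$ are analytic in the unit disc and $\phi_-^{\pm1},\widetilde\phi_-^{\pm1}$ are analytic outside the closed unit disc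 (all continuous up to the boundary), and $\phi_-,\widetilde\phi_-\sim z^{-\ell N}I$ as $z\to\infty$. Via $\widetilde\phi_-=\phi\widetilde\phi_+^{-1}$ and $\widetilde\phi_+=\widetilde\phi_-^{-1}\phi$, the factors $\widetilde\phi_\mp$ extend analytically to an annulus containing the unit circle. Kernel. $K_{\mathrm{path}}$ is defined in blocks (row index $j'$, column index $j$) by $$\big[K_{\mathrm{path}}(2\ell x+i,ky+j;2\ell x'+i',ky'+j')\big]_{j',j=0}^{k-1}=-\frac{\mathbf 1_{2\ell x+i>2\ell x'+i'}}{2\pi \mathrm i}\int_{\Gamma}\prod_{m=2\ell x'+i'+1}^{2\ell x+i}\phi_m(z)\,z^{y'-y}\frac{dz}{z}$$ $$+\frac1{(2\pi\mathrm i)^2}\int_{\Gamma_s}\int_{\Gamma_l}\Big(\prod_{m=1}^{i'}\phi_m(z_1)\Big)^{-1}\Phi(z_1)^{-x'}\widetilde\phi_-(z_1)\widetilde\phi_+(z_2)\Phi(z_2)^{x-kN}\prod_{m=1}^i\phi_m(z_2)\frac{z_1^{y'}}{z_2^{y}}\frac{dz_2\,dz_1}{z_2(z_2-z_1)}$$ for $0\le i,i'\le 2\ell-1$, where $z_1\in\Gamma_s=\{|z|=r_s\}$, $z_2\in\Gamma_l=\{|z|=r_l\}$, $\Gamma=\{|z|=1\}$, all positively oriented, $r_s<1<r_l$ such that $\phi^{\pm1}$ are analytic on $r_s\le|z|\le r_l$. (It is known that $K_{\mathrm{path}}$ is a correlation kernel of the non-intersecting paths process equivalent to the dimer model.) 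*)

theory Defs
  imports
    "HOL-Complex_Analysis.Complex_Analysis"
    "Jordan_Normal_Form.Gauss_Jordan_Elimination"
begin

section \<open>Matrix-valued functions\<close>

text \<open>
  Matrices are \<open>k \<times> k\<close> matrices of Jordan_Normal_Form, indexed from 0; the vectors of weights
  entering them are functions indexed from 1.
\<close>

text \<open>Unspecified on singular matrices; invertibility is stated separately wherever it matters.\<close>
definition minv :: "complex mat \<Rightarrow> complex mat" where
  "minv A = the (mat_inverse A)"

definition mat_powi :: "complex mat \<Rightarrow> int \<Rightarrow> complex mat" where
  "mat_powi A n = (if n \<ge> 0 then A ^\<^sub>m nat n else minv A ^\<^sub>m nat (- n))"

text \<open>The ordered product \<open>A (a+1) * \<dots> * A b\<close>, which is the identity for \<open>a = b\<close>.\<close>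
definition mat_prod :: "nat \<Rightarrow> (int \<Rightarrow> complex mat) \<Rightarrow> int \<Rightarrow> int \<Rightarrow> complex mat" where
  "mat_prod k A a b = foldr (\<lambda>m M. A m * M) [a + 1..b] (1\<^sub>m k)"

text \<open>\<open>F\<close> and its pointwise inverse are both analytic in a neighbourhood of \<open>S\<close>.\<close>
definition analytic_invertible_on ::
  "nat \<Rightarrow> (complex \<Rightarrow> complex mat) \<Rightarrow> complex set \<Rightarrow> bool" where
  "analytic_invertible_on k F S \<longleftrightarrow>
     (\<forall>z\<in>S. F z \<in> carrier_mat k k \<and> invertible_mat (F z)) \<and>
     (\<forall>r<k. \<forall>s<k. (\<lambda>z. F z $$ (r, s)) analytic_on S \<and>
                  (\<lambda>z. minv (F z) $$ (r, s)) analytic_on S)"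

text \<open>\<open>F\<close> and its pointwise inverse are analytic in the open set \<open>S\<close>, continuous up to the
  boundary.\<close>
definition holomorphic_invertible_closure ::
  "nat \<Rightarrow> (complex \<Rightarrow> complex mat) \<Rightarrow> complex set \<Rightarrow> bool" where
  "holomorphic_invertible_closure k F S \<longleftrightarrow>
     (\<forall>z\<in>closure S. F z \<in> carrier_mat k k \<and> invertible_mat (F z)) \<and>
     (\<forall>r<k. \<forall>s<k.
        (\<lambda>z. F z $$ (r, s)) holomorphic_on S \<and>
        continuous_on (closure S) (\<lambda>z. F z $$ (r, s)) \<and>
        (\<lambda>z. minv (F z) $$ (r, s)) holomorphic_on S \<and>
        continuous_on (closure S) (\<lambda>z. minv (F z) $$ (r, s)))"

text \<open>\<open>F \<sim> z\<^sup>-\<^sup>d I\<close> at infinity, i.e. \<open>z\<^sup>d F(z) \<rightarrow> I\<close> entrywise.\<close>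
definition asymp_scalar_at_infinity ::
  "nat \<Rightarrow> nat \<Rightarrow> (complex \<Rightarrow> complex mat) \<Rightarrow> bool" where
  "asymp_scalar_at_infinity k d F \<longleftrightarrow>
     (\<forall>r<k. \<forall>s<k. ((\<lambda>z. z ^ d * F z $$ (r, s)) \<longlongrightarrow> 1\<^sub>m k $$ (r, s)) at_infinity)"

text \<open>The factors are \<open>\<phi> = \<phi>\<^sub>+ \<phi>\<^sub>-\<close> (\<open>P\<close>, \<open>M\<close>) and the factorization
  \<open>tM * tP\<close> in the opposite order, whose factors carry a tilde on paper.\<close>
definition wiener_hopf ::
  "nat \<Rightarrow> nat \<Rightarrow> (complex \<Rightarrow> complex mat) \<Rightarrow> (complex \<Rightarrow> complex mat) \<Rightarrow>
   (complex \<Rightarrow> complex mat) \<Rightarrow> (complex \<Rightarrow> complex mat) \<Rightarrow> (complex \<Rightarrow> complex mat) \<Rightarrow> bool" where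
  "wiener_hopf k d \<phi> P M tM tP \<longleftrightarrow>
     (\<forall>z\<in>sphere 0 1. \<phi> z = P z * M z \<and> \<phi> z = tM z * tP z) \<and>
     holomorphic_invertible_closure k P (ball 0 1) \<and>
     holomorphic_invertible_closure k tP (ball 0 1) \<and>
     holomorphic_invertible_closure k M {z. norm z > 1} \<and>
     holomorphic_invertible_closure k tM {z. norm z > 1} \<and>
     asymp_scalar_at_infinity k d M \<and>
     asymp_scalar_at_infinity k d tM"

text \<open>The analytic extensions of \<open>tM\<close> into, and of \<open>tP\<close> out of, the unit disc.\<close>
definition extend_minus ::
  "(complex \<Rightarrow> complex mat) \<Rightarrow> (complex \<Rightarrow> complex mat) \<Rightarrow> (complex \<Rightarrow> complex mat) \<Rightarrow>
   complex \<Rightarrow> complex mat" where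
  "extend_minus \<phi> tM tP z = (if norm z \<ge> 1 then tM z else \<phi> z * minv (tP z))"

definition extend_plus ::
  "(complex \<Rightarrow> complex mat) \<Rightarrow> (complex \<Rightarrow> complex mat) \<Rightarrow> (complex \<Rightarrow> complex mat) \<Rightarrow>
   complex \<Rightarrow> complex mat" where
  "extend_plus \<phi> tM tP z = (if norm z \<le> 1 then tP z else minv (tM z) * \<phi> z)"

section \<open>Transition matrices\<close>

text \<open>The summands do not overlap except for \<open>k = 1\<close>, where they add up to
  \<open>\<gamma>\<^sub>1 + \<alpha>\<^sub>1 z\<^sup>-\<^sup>1\<close>.\<close>
definition phi_b ::
  "nat \<Rightarrow> (nat \<Rightarrow> complex) \<Rightarrow> (nat \<Rightarrow> complex) \<Rightarrow> complex \<Rightarrow> complex mat" where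
  "phi_b k \<alpha> \<gamma> z = mat k k (\<lambda>(r, s).
     (if r = s then \<gamma> (r + 1) else 0) +
     (if r = s + 1 then \<alpha> (s + 1) else 0) +
     (if r = 0 \<and> s = k - 1 then \<alpha> k * inverse z else 0))"

definition phi_g :: "nat \<Rightarrow> (nat \<Rightarrow> complex) \<Rightarrow> complex \<Rightarrow> complex mat" where
  "phi_g k \<beta> z =
     inverse (1 - (\<Prod>m=1..k. \<beta> m) * inverse z) \<cdot>\<^sub>m
     mat k k (\<lambda>(r, s).
       if r \<ge> s then (\<Prod>m=s+1..r. \<beta> m)
       else inverse z * (\<Prod>m=s+1..k. \<beta> m) * (\<Prod>m=1..r. \<beta> m))"

text \<open>For weights that are periodic in the second argument this is also periodic in \<open>m\<close>, so that
  any integer \<open>m\<close> may be allowed.\<close>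
definition phi_m ::
  "nat \<Rightarrow> (int \<Rightarrow> int \<Rightarrow> real) \<Rightarrow> (int \<Rightarrow> int \<Rightarrow> real) \<Rightarrow> (int \<Rightarrow> int \<Rightarrow> real) \<Rightarrow>
   complex \<Rightarrow> int \<Rightarrow> complex mat" where
  "phi_m k \<alpha> \<beta> \<gamma> z m =
     (if odd m
      then phi_b k (\<lambda>j. complex_of_real (\<alpha> (int j) ((m + 1) div 2)))
                   (\<lambda>j. complex_of_real (\<gamma> (int j) ((m + 1) div 2))) z
      else phi_g k (\<lambda>j. complex_of_real (\<beta> (int j) (m div 2))) z)"

definition Phi ::
  "nat \<Rightarrow> nat \<Rightarrow> (int \<Rightarrow> int \<Rightarrow> real) \<Rightarrow> (int \<Rightarrow> int \<Rightarrow> real) \<Rightarrow> (int \<Rightarrow> int \<Rightarrow> real) \<Rightarrow>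
   complex \<Rightarrow> complex mat" where
  "Phi k l \<alpha> \<beta> \<gamma> z = mat_prod k (phi_m k \<alpha> \<beta> \<gamma> z) 0 (2 * int l)"

definition path_symbol ::
  "nat \<Rightarrow> nat \<Rightarrow> nat \<Rightarrow> (int \<Rightarrow> int \<Rightarrow> real) \<Rightarrow> (int \<Rightarrow> int \<Rightarrow> real) \<Rightarrow> (int \<Rightarrow> int \<Rightarrow> real) \<Rightarrow>
   complex \<Rightarrow> complex mat" where
  "path_symbol k l N \<alpha> \<beta> \<gamma> z = Phi k l \<alpha> \<beta> \<gamma> z ^\<^sub>m (k * N)"

section \<open>The Kasteleyn matrix of the Aztec diamond\<close>

definition periodic_weights :: "nat \<Rightarrow> nat \<Rightarrow> (int \<Rightarrow> int \<Rightarrow> real) \<Rightarrow> bool" where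
  "periodic_weights k l w \<longleftrightarrow>
     (\<forall>j\<in>{1..int k}. \<forall>i\<in>{1..int l}. w j i > 0) \<and>
     (\<forall>j i. w (j + int k) i = w j i \<and> w j (i + int l) = w j i)"

definition black :: "int \<Rightarrow> int \<Rightarrow> int \<times> int" where
  "black a c = (2 * a, 2 * c + 1)"

definition white :: "int \<Rightarrow> int \<Rightarrow> int \<times> int" where
  "white a c = (2 * a + 1, 2 * c + 2)"

definition aztec_black :: "nat \<Rightarrow> (int \<times> int) set" where
  "aztec_black n = {black a c |a c. 0 \<le> a \<and> a \<le> int n \<and> 0 \<le> c \<and> c \<le> int n - 1}"

definition aztec_white :: "nat \<Rightarrow> (int \<times> int) set" where
  "aztec_white n = {white a c |a c. 0 \<le> a \<and> a \<le> int n - 1 \<and> -1 \<le> c \<and> c \<le> int n - 1}"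

text \<open>The entry in the row of the white vertex \<open>w\<close> and the column of the black vertex \<open>b\<close>; the
  coordinates \<open>a\<close>, \<open>c\<close> are those with \<open>w = white a c\<close>.\<close>
definition kasteleyn ::
  "(int \<Rightarrow> int \<Rightarrow> real) \<Rightarrow> (int \<Rightarrow> int \<Rightarrow> real) \<Rightarrow> (int \<Rightarrow> int \<Rightarrow> real) \<Rightarrow>
   int \<times> int \<Rightarrow> int \<times> int \<Rightarrow> complex" where
  "kasteleyn \<alpha> \<beta> \<gamma> w b =
     (let a = (fst w - 1) div 2; c = (snd w - 2) div 2 in
      if b = black a c then complex_of_real (\<gamma> (c + 1) (a + 1))
      else if b = black a (c + 1) then complex_of_real (\<alpha> (c + 1) (a + 1))
      else if b = black (a + 1) (c + 1) then complex_of_real (\<beta> (c + 1) (a + 1))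
      else if b = black (a + 1) c then -1
      else 0)"

text \<open>Two-sided inverses of a matrix \<open>K\<close> with rows indexed by the finite set \<open>W\<close> and columns by
  the finite set \<open>B\<close>. Such an inverse is unique on \<open>B \<times> W\<close> (its values elsewhere are irrelevant),
  so the choice in the second definition is immaterial there.\<close>
definition is_inverse_on ::
  "'w set \<Rightarrow> 'b set \<Rightarrow> ('w \<Rightarrow> 'b \<Rightarrow> complex) \<Rightarrow> ('b \<Rightarrow> 'w \<Rightarrow> complex) \<Rightarrow> bool" where
  "is_inverse_on W B K L \<longleftrightarrow>
     (\<forall>w\<in>W. \<forall>w'\<in>W. (\<Sum>b\<in>B. K w b * L b w') = (if w = w' then 1 else 0)) \<and>
     (\<forall>b\<in>B. \<forall>b'\<in>B. (\<Sum>w\<in>W. L b w * K w b') = (if b = b' then 1 else 0))"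

definition invertible_on :: "'w set \<Rightarrow> 'b set \<Rightarrow> ('w \<Rightarrow> 'b \<Rightarrow> complex) \<Rightarrow> bool" where
  "invertible_on W B K \<longleftrightarrow> (\<exists>L. is_inverse_on W B K L)"

definition inverse_on ::
  "'w set \<Rightarrow> 'b set \<Rightarrow> ('w \<Rightarrow> 'b \<Rightarrow> complex) \<Rightarrow> 'b \<Rightarrow> 'w \<Rightarrow> complex" where
  "inverse_on W B K = (SOME L. is_inverse_on W B K L)"

section \<open>The path kernel\<close>

text \<open>The four integer arguments are decomposed as \<open>u = 2lx + i\<close>, \<open>v = ky + j\<close>, and likewise for
  the primed ones. The row index of the blocks is \<open>j'\<close>, the column index is \<open>j\<close>.\<close>
definition K_path ::
  "nat \<Rightarrow> nat \<Rightarrow> nat \<Rightarrow> (int \<Rightarrow> int \<Rightarrow> real) \<Rightarrow> (int \<Rightarrow> int \<Rightarrow> real) \<Rightarrow> (int \<Rightarrow> int \<Rightarrow> real) \<Rightarrow>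
   (complex \<Rightarrow> complex mat) \<Rightarrow> (complex \<Rightarrow> complex mat) \<Rightarrow> real \<Rightarrow> real \<Rightarrow>
   int \<Rightarrow> int \<Rightarrow> int \<Rightarrow> int \<Rightarrow> complex" where
  "K_path k l N \<alpha> \<beta> \<gamma> tM tP r_s r_l u v u' v' =
     (let x = u div (2 * int l); i = u mod (2 * int l);
          x' = u' div (2 * int l); i' = u' mod (2 * int l);
          y = v div int k; j = nat (v mod int k);
          y' = v' div int k; j' = nat (v' mod int k);
          \<phi> = path_symbol k l N \<alpha> \<beta> \<gamma>
      in
      - (if u > u' then 1 else 0) / (2 * of_real pi * \<i>) *
          contour_integral (circlepath 0 1) (\<lambda>z.
            mat_prod k (phi_m k \<alpha> \<beta> \<gamma> z) u' u $$ (j', j) * z powi (y' - y) / z)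
      + 1 / (2 * of_real pi * \<i>)\<^sup>2 *
          contour_integral (circlepath 0 r_s) (\<lambda>z\<^sub>1.
            contour_integral (circlepath 0 r_l) (\<lambda>z\<^sub>2.
              (minv (mat_prod k (phi_m k \<alpha> \<beta> \<gamma> z\<^sub>1) 0 i') *
               mat_powi (Phi k l \<alpha> \<beta> \<gamma> z\<^sub>1) (- x') *
               extend_minus \<phi> tM tP z\<^sub>1 *
               extend_plus \<phi> tM tP z\<^sub>2 *
               mat_powi (Phi k l \<alpha> \<beta> \<gamma> z\<^sub>2) (x - int (k * N)) *
               mat_prod k (phi_m k \<alpha> \<beta> \<gamma> z\<^sub>2) 0 i) $$ (j', j) *
              (z\<^sub>1 powi y' / z\<^sub>2 powi y) / (z\<^sub>2 * (z\<^sub>2 - z\<^sub>1)))))"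

end

theory Submission
  imports Defs "Jordan_Normal_Form.Determinant"
begin

text \<open>
  As a function of the black vertex \<open>b\<^sub>a\<^sub>,\<^sub>c\<close> the kernel depends on \<open>a\<close> only through the product
  \<open>\<phi>\<^sub>1 \<dots> \<phi>\<^sub>2\<^sub>a\<close>. Since the inverse of \<open>\<phi>\<^sup>g\<close> is cyclically bidiagonal, the identity
  \<open>(\<phi>\<^sub>1 \<dots> \<phi>\<^sub>2\<^sub>a\<^sub>+\<^sub>2) \<phi>\<^sub>2\<^sub>a\<^sub>+\<^sub>2\<inverse> = (\<phi>\<^sub>1 \<dots> \<phi>\<^sub>2\<^sub>a) \<phi>\<^sub>2\<^sub>a\<^sub>+\<^sub>1\<close>, read entrywise, is the Kasteleyn recursion on the
  infinite lattice, and the jump of the indicator function in the single integral produces the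
  Kronecker delta. So the kernel is a right inverse of the finite Kasteleyn matrix as soon as it
  vanishes on the two rows \<open>c = -1\<close> and \<open>c = k l N\<close> of black vertices just outside the Aztec diamond;
  the matrix being square, a right inverse is the inverse.

  For \<open>c = k l N\<close> the contour of \<open>z\<^sub>2\<close> is pushed to infinity. For \<open>c = -1\<close> the integral over \<open>z\<^sub>2\<close> is the
  residue at \<open>z\<^sub>2 = z\<^sub>1\<close>, and the remaining integral either cancels the single integral or vanishes
  because its integrand is holomorphic in the disc. Both deformations require that \<open>\<phi>\<^sup>g\<close> has its
  poles inside and \<open>\<phi>\<^sup>b\<close> is singular only outside the unit circle, which is forced by the
  factorization through Liouville's theorem.
\<close>

text \<open>Three exact balances make the argument close. At infinity: since
  \<open>n = k l N\<close>, the column \<open>c = n\<close> carries the power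
  \<open>z^(-l N)\<close>, which is precisely the normalisation of \<open>tM\<close>, so the
  integrand in \<open>z\<^sub>2\<close> keeps the full decay of
  \<open>1/(z\<^sub>2 (z\<^sub>2 - z\<^sub>1))\<close>. At the origin: the inverse of
  \<open>phi_g\<close> has a simple pole, but the last row of the inverse of \<open>phi_b\<close>
  vanishes there, so the two have to be inverted together. Black vertices sit at even times, hence
  the factors after time \<open>2 a\<close> do form whole pairs. White vertices sit at odd times,
  which leaves one unpaired inverse of \<open>phi_b\<close>; its vanishing last row supplies the
  missing zero in the only case with a negative exponent of \<open>z\<^sub>1\<close>, the white row
  \<open>c' = -1\<close>. In the Liouville argument: \<open>det tM\<close> decays like
  \<open>z^(-n)\<close>, one factor \<open>1/z\<close> for each of the \<open>n\<close> pairs of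
  transition matrices, so a single misplaced zero or pole already forces the limit 0. A technical
  obstacle is that the factors are known only to be continuous on the unit circle itself. Their
  extensions are glued from two branches, and holomorphy across the seam needs an argument of Morera
  type.\<close>

hide_const (open) Determinants.det

section \<open>Contour integrals over circles\<close>

text \<open>Pulling back by \<open>exp\<close> turns the unit circle into the imaginary axis, where
  pasting across a line applies. The origin, which \<open>exp\<close> omits, lies in the open disc
  and is treated directly.\<close>

lemma holomorphic_on_paste_across_circle:
  assumes S: "open S" and contf: "continuous_on S f"
    and in1: "f holomorphic_on (S \<inter> {z. norm z < 1})"
    and out1: "f holomorphic_on (S \<inter> {z. norm z > 1})"
  shows "f holomorphic_on S"
proof -
  define U where "U = exp -` S"
  have U: "open U"
    unfolding U_def by (intro open_vimage S continuous_intros)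
  have exp_U: "exp ` U \<subseteq> S"
    by (auto simp: U_def)
  have "(f \<circ> exp) holomorphic_on U"
  proof (rule holomorphic_on_paste_across_line[OF U, of 1 _ 0])
    show "(f \<circ> exp) holomorphic_on U \<inter> {z. 1 \<bullet> z < 0}"
      by (rule holomorphic_on_compose_gen[OF _ in1]) (auto intro!: holomorphic_intros simp: U_def inner_complex_def)
    show "(f \<circ> exp) holomorphic_on U \<inter> {z. 0 < 1 \<bullet> z}"
      by (rule holomorphic_on_compose_gen[OF _ out1]) (auto intro!: holomorphic_intros simp: U_def inner_complex_def)
    show "continuous_on U (f \<circ> exp)"
      by (rule continuous_on_compose) (auto intro!: continuous_intros continuous_on_subset[OF contf exp_U])
  qed auto
  then have fexp: "(f \<circ> exp) field_differentiable at w" if "w \<in> U" for w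
    using U that by (metis holomorphic_on_imp_differentiable_at)
  have "f field_differentiable at p" if p: "p \<in> S" for p
  proof (cases "p = 0")
    case True
    have "open (S \<inter> {z. norm z < 1})" "p \<in> S \<inter> {z. norm z < 1}"
      using True p S by (auto intro!: open_Int open_Collect_less continuous_intros)
    then show ?thesis using in1 holomorphic_on_imp_differentiable_at by blast
  next
    case False
    \<comment> \<open>A branch of the logarithm near \<open>p\<close>: dividing by \<open>p\<close>
      keeps the argument of \<open>Ln\<close> close to 1 and so off the cut, wherever
      \<open>p\<close> lies.\<close>
    define g where "g = (\<lambda>z. Ln (z / p) + Ln p)"
    have exp_g: "exp (g z) = z" if "z \<noteq> 0" for z
      using that False by (simp add: g_def exp_add)
    have "g p \<in> U" using exp_g[OF False] p by (simp add: U_def)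
    moreover have "g field_differentiable at p"
      unfolding g_def using False
      by (intro field_differentiable_add field_differentiable_const
            field_differentiable_compose[of "\<lambda>z. z / p" p Ln, unfolded o_def] field_differentiable_at_Ln)
         (auto intro!: derivative_intros simp: field_differentiable_divide)
    ultimately have "((f \<circ> exp) \<circ> g) field_differentiable at p"
      using fexp field_differentiable_compose by blast
    moreover have "eventually (\<lambda>z. ((f \<circ> exp) \<circ> g) z = f z) (nhds p)"
      using t1_space_nhds[OF False] by eventually_elim (simp add: exp_g)
    ultimately show ?thesis
      unfolding field_differentiable_def using DERIV_cong_ev[OF refl _ refl] by blast
  qed
  then show ?thesis
    using holomorphic_on_def field_differentiable_at_within by blast
qed

text \<open>Corresponding points of the two circles lie on a common ray, so the linear homotopy
  stays in the annulus.\<close>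

lemma contour_integral_circlepath_annulus_eq:
  assumes "open S" "f holomorphic_on S" and r: "0 < r" "r \<le> R"
    and sub: "{z. r \<le> norm z \<and> norm z \<le> R} \<subseteq> S"
  shows "contour_integral (circlepath 0 r) f = contour_integral (circlepath 0 R) f"
proof (rule Cauchy_theorem_homotopic_loops[OF _ assms(1,2)])
  show "homotopic_loops S (circlepath 0 r) (circlepath 0 R)"
  proof (rule homotopic_loops_linear)
    fix t :: real
    show "closed_segment (circlepath 0 r t) (circlepath 0 R t) \<subseteq> S"
    proof
      fix w assume "w \<in> closed_segment (circlepath 0 r t) (circlepath 0 R t)"
      then obtain u where u: "0 \<le> u" "u \<le> 1"
        and w: "w = (1 - u) *\<^sub>R circlepath 0 r t + u *\<^sub>R circlepath 0 R t"
        by (auto simp: in_segment)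
      have "w = of_real ((1 - u) * r + u * R) * exp (2 * of_real pi * \<i> * of_real t)"
        by (simp add: w circlepath algebra_simps scaleR_conv_of_real)
      then have "norm w = \<bar>(1 - u) * r + u * R\<bar>"
        by (simp add: norm_mult del: of_real_add of_real_mult)
      moreover have "r \<le> (1 - u) * r + u * R"
        using u r mult_left_mono[of r R u] by (simp add: algebra_simps)
      moreover have "(1 - u) * r + u * R \<le> R"
        using u r mult_left_mono[of r R "1 - u"] by (simp add: algebra_simps)
      ultimately show "w \<in> S" using sub r by force
    qed
  qed auto
qed auto

text \<open>The integral does not depend on the radius, and on a large circle the length
  \<open>2 pi R\<close> meets an integrand that is \<open>o(1/R)\<close>.\<close>

lemma contour_integral_circlepath_exterior_eq_0:
  assumes hol: "f holomorphic_on {z. \<rho> < norm z}" and r: "0 < r" "\<rho> < r"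
    and lim: "((\<lambda>z. z * f z) \<longlongrightarrow> 0) at_infinity"
  shows "contour_integral (circlepath 0 r) f = 0"
proof -
  have op: "open {z::complex. \<rho> < norm z}"
    by (intro open_Collect_less continuous_intros)
  have cont: "continuous_on {z. \<rho> < norm z} f"
    by (rule holomorphic_on_imp_continuous_on[OF hol])
  have "norm (contour_integral (circlepath 0 r) f) \<le> e" if e: "e > 0" for e
  proof -
    have "eventually (\<lambda>z. norm (z * f z) < e / (2 * pi)) at_infinity"
      using tendstoD[OF lim, of "e / (2 * pi)"] e by simp
    then obtain B where B: "\<And>z. norm z \<ge> B \<Longrightarrow> norm (z * f z) < e / (2 * pi)"
      by (auto simp: eventually_at_infinity)
    define R where "R = max B r"
    have R: "0 < R" "r \<le> R" "B \<le> R" using r by (auto simp: R_def)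
    have eq: "contour_integral (circlepath 0 r) f = contour_integral (circlepath 0 R) f"
      using R r by (intro contour_integral_circlepath_annulus_eq[OF op hol]) auto
    have "f contour_integrable_on circlepath 0 R"
      using R r by (intro contour_integrable_continuous_circlepath continuous_on_subset[OF cont]) auto
    then have "(f has_contour_integral contour_integral (circlepath 0 R) f) (circlepath 0 R)"
      by (rule has_contour_integral_integral)
    then have "norm (contour_integral (circlepath 0 R) f) \<le> (e / (2 * pi * R)) * (2 * pi * R)"
    proof (rule has_contour_integral_bound_circlepath)
      fix x :: complex assume "norm (x - 0) = R"
      then have "R * norm (f x) < e / (2 * pi)" using B[of x] R by (simp add: norm_mult)
      then show "norm (f x) \<le> e / (2 * pi * R)" using R by (simp add: field_simps)
    qed (use e R in auto)
    then show ?thesis using eq R by simp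
  qed
  then show ?thesis using field_le_epsilon[of "norm _" 0] by (metis add_0 norm_le_zero_iff)
qed

section \<open>Double integrals against the Cauchy kernel\<close>

text \<open>The index \<open>t\<close> is the inner index of a matrix product: \<open>g\<close>
  holds the row depending on the first variable and \<open>h\<close> the column depending on the
  second. With the variables separated, linearity in \<open>h\<close> is available while
  \<open>g\<close> and the Cauchy kernel stay fixed.\<close>

definition double_integral ::
  "real \<Rightarrow> real \<Rightarrow> nat \<Rightarrow> (nat \<Rightarrow> complex \<Rightarrow> complex) \<Rightarrow> (nat \<Rightarrow> complex \<Rightarrow> complex) \<Rightarrow> complex" where
  "double_integral r R k g h =
     contour_integral (circlepath 0 r) (\<lambda>z. contour_integral (circlepath 0 R) (\<lambda>w.
       \<Sum>t<k. g t z * (h t w / (w - z))))"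

context
  fixes r R :: real
  assumes r: "0 < r" "r < R"
begin

lemma cauchy_kernel_integrable:
  assumes h: "continuous_on (sphere 0 R) h" and z: "norm z = r"
  shows "(\<lambda>w. h w / (w - z)) contour_integrable_on circlepath 0 R"
  using r z by (intro contour_integrable_continuous_circlepath) (auto intro!: continuous_intros h)

text \<open>A Cauchy integral of a continuous density is differentiable off the circle; continuity
  on the smaller circle makes the outer integrand integrable. The exponent 1 below only fits the
  shape of the derivative formula.\<close>

lemma cauchy_integral_continuous_on:
  assumes h: "continuous_on (sphere 0 R) h"
  shows "continuous_on (sphere 0 r) (\<lambda>z. contour_integral (circlepath 0 R) (\<lambda>w. h w / (w - z)))"
proof -
  let ?I = "\<lambda>z. contour_integral (circlepath 0 R) (\<lambda>w. h w / (w - z))"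
  have int: "((\<lambda>u. h u / (u - w) ^ 1) has_contour_integral ?I w) (circlepath 0 R)"
    if "w \<in> ball 0 R" for w
  proof -
    have "(\<lambda>u. h u / (u - w)) contour_integrable_on circlepath 0 R"
      using r that by (intro contour_integrable_continuous_circlepath) (auto intro!: continuous_intros h)
    then show ?thesis using has_contour_integral_integral by simp
  qed
  have "isCont ?I w" if "w \<in> ball 0 R" for w
    by (rule DERIV_isCont[OF Cauchy_next_derivative_circlepath(2)[OF _ int]])
       (use that h r in auto)
  then show ?thesis
    using r by (intro continuous_at_imp_continuous_on) auto
qed

lemma double_integral_inner:
  fixes k :: nat
  assumes h: "\<And>t. t < k \<Longrightarrow> continuous_on (sphere 0 R) (h t)" and z: "norm z = r"
  shows "contour_integral (circlepath 0 R) (\<lambda>w. \<Sum>t<k. g t z * (h t w / (w - z))) =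
    (\<Sum>t<k. g t z * contour_integral (circlepath 0 R) (\<lambda>w. h t w / (w - z)))"
proof -
  note int = cauchy_kernel_integrable[OF h z]
  show ?thesis
    by (subst contour_integral_sum)
      (auto intro!: sum.cong contour_integral_lmul contour_integrable_lmul int simp del: times_divide_eq_right)
qed

lemma double_integral_eq:
  assumes h: "\<And>t. t < k \<Longrightarrow> continuous_on (sphere 0 R) (h t)"
  shows "double_integral r R k g h = contour_integral (circlepath 0 r)
    (\<lambda>z. \<Sum>t<k. g t z * contour_integral (circlepath 0 R) (\<lambda>w. h t w / (w - z)))"
  unfolding double_integral_def
  by (rule contour_integral_eq) (rule double_integral_inner[OF h], use r in auto)

lemma double_integral_outer_integrable:
  assumes g: "\<And>t. t < k \<Longrightarrow> continuous_on (sphere 0 r) (g t)"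
    and h: "\<And>t. t < k \<Longrightarrow> continuous_on (sphere 0 R) (h t)"
  shows "(\<lambda>z. \<Sum>t<k. g t z * contour_integral (circlepath 0 R) (\<lambda>w. h t w / (w - z)))
    contour_integrable_on circlepath 0 r"
  using r by (intro contour_integrable_continuous_circlepath)
    (auto intro!: continuous_intros cauchy_integral_continuous_on g h)

lemma double_integral_add:
  assumes g: "\<And>t. t < k \<Longrightarrow> continuous_on (sphere 0 r) (g t)"
    and h: "\<And>t. t < k \<Longrightarrow> continuous_on (sphere 0 R) (h t)"
    and h': "\<And>t. t < k \<Longrightarrow> continuous_on (sphere 0 R) (h' t)"
  shows "double_integral r R k g (\<lambda>t w. h t w + h' t w) =
    double_integral r R k g h + double_integral r R k g h'"
proof -
  have "double_integral r R k g (\<lambda>t w. h t w + h' t w) = contour_integral (circlepath 0 r)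
    (\<lambda>z. \<Sum>t<k. g t z * contour_integral (circlepath 0 R) (\<lambda>w. (h t w + h' t w) / (w - z)))"
    by (intro double_integral_eq continuous_intros h h')
  also have "\<dots> = contour_integral (circlepath 0 r)
    (\<lambda>z. (\<Sum>t<k. g t z * contour_integral (circlepath 0 R) (\<lambda>w. h t w / (w - z))) +
         (\<Sum>t<k. g t z * contour_integral (circlepath 0 R) (\<lambda>w. h' t w / (w - z))))"
  proof (rule contour_integral_eq)
    fix z assume "z \<in> path_image (circlepath 0 r)"
    then have z: "norm z = r" using r by simp
    show "(\<Sum>t<k. g t z * contour_integral (circlepath 0 R) (\<lambda>w. (h t w + h' t w) / (w - z))) =
      (\<Sum>t<k. g t z * contour_integral (circlepath 0 R) (\<lambda>w. h t w / (w - z))) +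
      (\<Sum>t<k. g t z * contour_integral (circlepath 0 R) (\<lambda>w. h' t w / (w - z)))"
      unfolding sum.distrib[symmetric] add_divide_distrib
      by (intro sum.cong refl, subst contour_integral_add)
         (auto intro!: cauchy_kernel_integrable h h' z simp: distrib_left)
  qed
  finally have "double_integral r R k g (\<lambda>t w. h t w + h' t w) = \<dots>" .
  then show ?thesis
    by (simp add: contour_integral_add double_integral_outer_integrable g h h' double_integral_eq)
qed

lemma double_integral_cmult:
  assumes g: "\<And>t. t < k \<Longrightarrow> continuous_on (sphere 0 r) (g t)"
    and h: "\<And>t. t < k \<Longrightarrow> continuous_on (sphere 0 R) (h t)"
  shows "double_integral r R k g (\<lambda>t w. c * h t w) = c * double_integral r R k g h"
proof -
  have "double_integral r R k g (\<lambda>t w. c * h t w) = contour_integral (circlepath 0 r)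
    (\<lambda>z. \<Sum>t<k. g t z * contour_integral (circlepath 0 R) (\<lambda>w. c * h t w / (w - z)))"
    by (intro double_integral_eq continuous_intros h)
  also have "\<dots> = contour_integral (circlepath 0 r)
    (\<lambda>z. c * (\<Sum>t<k. g t z * contour_integral (circlepath 0 R) (\<lambda>w. h t w / (w - z))))"
  proof (rule contour_integral_eq)
    fix z assume "z \<in> path_image (circlepath 0 r)"
    then have z: "norm z = r" using r by simp
    show "(\<Sum>t<k. g t z * contour_integral (circlepath 0 R) (\<lambda>w. c * h t w / (w - z))) =
      c * (\<Sum>t<k. g t z * contour_integral (circlepath 0 R) (\<lambda>w. h t w / (w - z)))"
      unfolding sum_distrib_left times_divide_eq_right[symmetric]
      by (intro sum.cong refl, subst contour_integral_lmul)
         (auto intro!: cauchy_kernel_integrable h z)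
  qed
  finally have "double_integral r R k g (\<lambda>t w. c * h t w) = \<dots>" .
  then show ?thesis
    by (simp add: contour_integral_lmul double_integral_outer_integrable g h double_integral_eq)
qed

end

lemma double_integral_cong:
  assumes "0 < r" "0 < R" "\<And>t z. t < k \<Longrightarrow> norm z = R \<Longrightarrow> h t z = h' t z"
  shows "double_integral r R k g h = double_integral r R k g h'"
  unfolding double_integral_def
  using assms by (intro contour_integral_eq) auto

lemma tendsto_inverse_shift:
  fixes z :: complex
  shows "((\<lambda>w. inverse (w - z)) \<longlongrightarrow> 0) at_infinity"
  by (rule filterlim_compose[OF tendsto_inverse_0])
     (use tendsto_add_filterlim_at_infinity[OF tendsto_const[of "-z"] filterlim_ident] in simp)

text \<open>Orthogonality of Laurent monomials, the origin of the Kronecker delta in the rows.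
  Negative exponents are pushed to infinity, positive ones give a polynomial integrand.\<close>

lemma contour_integral_powi:
  "contour_integral (circlepath 0 1) (\<lambda>z. z powi m / z) = (if m = 0 then 2 * of_real pi * \<i> else 0)"
proof -
  consider "m = 0" | "m < 0" | "m > 0" by linarith
  then show ?thesis
  proof cases
    case 1
    then show ?thesis using contour_integral_circlepath[of 1 0] by simp
  next
    case 2
    define q where "q = nat (- m)"
    have q: "q > 0" "m = - int q" using 2 by (auto simp: q_def)
    have "contour_integral (circlepath 0 1) (\<lambda>z. z powi m / z) = 0"
    proof (rule contour_integral_circlepath_exterior_eq_0[where \<rho> = 0])
      show "(\<lambda>z::complex. z powi m / z) holomorphic_on {z. 0 < norm z}"
        by (auto intro!: holomorphic_intros)
      have "((\<lambda>z::complex. inverse z ^ q) \<longlongrightarrow> 0 ^ q) at_infinity"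
        by (intro tendsto_power tendsto_inverse_0)
      moreover have "eventually (\<lambda>z::complex. inverse z ^ q = z * (z powi m / z)) at_infinity"
        unfolding eventually_at_infinity
      proof (intro exI[of _ 1] allI impI)
        fix z :: complex assume "1 \<le> norm z"
        then have "z \<noteq> 0" by auto
        then show "inverse z ^ q = z * (z powi m / z)"
          by (simp add: q power_int_minus power_inverse)
      qed
      ultimately have "((\<lambda>z::complex. z * (z powi m / z)) \<longlongrightarrow> 0 ^ q) at_infinity"
        by (rule Lim_transform_eventually)
      then show "((\<lambda>z::complex. z * (z powi m / z)) \<longlongrightarrow> 0) at_infinity"
        using q(1) by (simp only: zero_power)
    qed auto
    then show ?thesis using 2 by simp
  next
    case 3
    define q where "q = nat (m - 1)"
    have q: "m = int (Suc q)" using 3 by (simp add: q_def)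
    have "contour_integral (circlepath 0 1) (\<lambda>z. z powi m / z) = contour_integral (circlepath 0 1) (\<lambda>z. z ^ q)"
    proof (rule contour_integral_eq)
      fix z :: complex assume "z \<in> path_image (circlepath 0 1)"
      then have "z \<noteq> 0" by auto
      then show "z powi m / z = z ^ q" unfolding q power_int_of_nat by simp
    qed
    also have "\<dots> = 0"
      by (intro contour_integral_unique Cauchy_theorem_convex_simple[of _ UNIV]) (auto intro!: holomorphic_intros)
    finally show ?thesis using 3 by simp
  qed
qed

section \<open>Matrices and matrix-valued functions\<close>

lemma index_mult_mat_sum:
  assumes "A \<in> carrier_mat k k" "B \<in> carrier_mat k k" "r < k" "s < k"
  shows "(A * B) $$ (r, s) = (\<Sum>t<k. A $$ (r, t) * B $$ (t, s))"
  using assms by (auto simp: scalar_prod_def atLeast0LessThan intro!: sum.cong)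

lemma invertible_mat_iff_det:
  fixes A :: "complex mat"
  assumes A: "A \<in> carrier_mat k k"
  shows "invertible_mat A \<longleftrightarrow> det A \<noteq> 0"
proof
  assume "invertible_mat A"
  then obtain B where B: "A * B = 1\<^sub>m (dim_row A)" "B * A = 1\<^sub>m (dim_row B)"
    by (auto simp: invertible_mat_def inverts_mat_def)
  have "dim_col B = k" using arg_cong[OF B(1), of dim_col] A by simp
  moreover have "dim_row B = k" using arg_cong[OF B(2), of dim_col] A by simp
  ultimately have "B \<in> carrier_mat k k" by auto
  then have "det A * det B = 1" using det_mult[OF A, of B] B(1) A by simp
  then show "det A \<noteq> 0" by auto
next
  assume d: "det A \<noteq> 0"
  let ?B = "(1 / det A) \<cdot>\<^sub>m adj_mat A"
  have "A * ?B = (1 / det A) \<cdot>\<^sub>m (A * adj_mat A)" "?B * A = (1 / det A) \<cdot>\<^sub>m (adj_mat A * A)"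
    by (rule mult_smult_distrib[OF A adj_mat(1)[OF A]], rule mult_smult_assoc_mat[OF adj_mat(1)[OF A] A])
  then have "A * ?B = 1\<^sub>m k" "?B * A = 1\<^sub>m k"
    using d unfolding adj_mat(2,3)[OF A] by auto
  then show "invertible_mat A"
    using A adj_mat(1)[OF A] by (auto simp: invertible_mat_def inverts_mat_def square_mat.simps)
qed

lemma minv:
  assumes A: "A \<in> carrier_mat k k" and "det A \<noteq> 0"
  shows "minv A \<in> carrier_mat k k" "A * minv A = 1\<^sub>m k" "minv A * A = 1\<^sub>m k"
proof -
  have "A \<in> Units (ring_mat TYPE(complex) k ())"
    using det_non_zero_imp_unit[OF A] assms(2) by simp
  then obtain B where B: "mat_inverse A = Some B"
    using mat_inverse(1)[OF A, where b = "()"] by (cases "mat_inverse A") auto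
  then show "minv A \<in> carrier_mat k k" "A * minv A = 1\<^sub>m k" "minv A * A = 1\<^sub>m k"
    using mat_inverse(2)[OF A B] by (auto simp: minv_def)
qed

lemma det_nonzero_of_right_inverse:
  assumes "(A :: complex mat) \<in> carrier_mat k k" "B \<in> carrier_mat k k" "A * B = 1\<^sub>m k"
  shows "det A \<noteq> 0"
  using det_mult[OF assms(1,2)] assms(3) by auto

lemma minv_eqI:
  assumes A: "A \<in> carrier_mat k k" and B: "B \<in> carrier_mat k k" and AB: "A * B = 1\<^sub>m k"
  shows "minv A = B"
proof -
  note m = minv[OF A det_nonzero_of_right_inverse[OF assms]]
  have "minv A = minv A * (A * B)" using m(1) by (simp add: AB)
  also have "\<dots> = (minv A * A) * B" using m(1) A B by (simp add: assoc_mult_mat)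
  finally show ?thesis using m(3) B by simp
qed

text \<open>Cramer's rule reduces limits and holomorphy of \<open>minv\<close> to those of
  determinants and minors.\<close>

lemma minv_eq_adj:
  assumes A: "A \<in> carrier_mat k k" "det A \<noteq> 0"
  shows "minv A = inverse (det A) \<cdot>\<^sub>m adj_mat A"
proof (rule minv_eqI[OF A(1)])
  show "inverse (det A) \<cdot>\<^sub>m adj_mat A \<in> carrier_mat k k"
    using adj_mat(1)[OF A(1)] by simp
  show "A * (inverse (det A) \<cdot>\<^sub>m adj_mat A) = 1\<^sub>m k"
    unfolding mult_smult_distrib[OF A(1) adj_mat(1)[OF A(1)]] adj_mat(2)[OF A(1)]
    using A(2) by auto
qed

section \<open>Ordered products\<close>

lemma mat_prod_carrier [simp]:
  assumes "\<And>m. A m \<in> carrier_mat k k"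
  shows "mat_prod k A a b \<in> carrier_mat k k"
proof -
  have "foldr (\<lambda>m M. A m * M) xs (1\<^sub>m k) \<in> carrier_mat k k" for xs
    by (induction xs) (auto intro!: mult_carrier_mat assms)
  then show ?thesis by (simp add: mat_prod_def)
qed

lemma mat_prod_empty [simp]: "mat_prod k A a a = 1\<^sub>m k"
  by (simp add: mat_prod_def)

lemma mat_prod_append:
  assumes A: "\<And>m. A m \<in> carrier_mat k k" and "a \<le> b" "b \<le> c"
  shows "mat_prod k A a c = mat_prod k A a b * mat_prod k A b c"
proof -
  let ?f = "\<lambda>xs. foldr (\<lambda>m M. A m * M) xs (1\<^sub>m k)"
  have car: "?f xs \<in> carrier_mat k k" for xs
    by (induction xs) (auto intro!: mult_carrier_mat A)
  have "?f (xs @ ys) = ?f xs * ?f ys" for xs ys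
  proof (induction xs)
    case Nil
    then show ?case using car[of ys] by simp
  next
    case (Cons x xs)
    then show ?case using assoc_mult_mat[OF A[of x] car[of xs] car[of ys]] by simp
  qed
  moreover have "[a + 1..c] = [a + 1..b] @ [b + 1..c]"
    using upto_split2[of "a + 1" b c] assms by (cases "a = b") auto
  ultimately show ?thesis by (simp add: mat_prod_def)
qed

lemma mat_prod_single:
  assumes A: "\<And>m. A m \<in> carrier_mat k k"
  shows "mat_prod k A a (a + 1) = A (a + 1)"
  using A[of "a + 1"] by (simp add: mat_prod_def)

lemma mat_prod_snoc:
  assumes "\<And>m. A m \<in> carrier_mat k k" "a \<le> b"
  shows "mat_prod k A a (b + 1) = mat_prod k A a b * A (b + 1)"
  using mat_prod_append[of A k a b "b + 1"] assms by (simp add: mat_prod_single)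

lemma mat_prod_shift:
  assumes "\<And>m. A (m + p) = A m"
  shows "mat_prod k A (a + p) (b + p) = mat_prod k A a b"
proof -
  have "[a + p + 1..b + p] = map (\<lambda>m. m + p) [a + 1..b]"
  proof (rule nth_equalityI)
    fix i assume "i < length [a + p + 1..b + p]"
    then show "[a + p + 1..b + p] ! i = map (\<lambda>m. m + p) [a + 1..b] ! i"
      by (simp add: nth_upto)
  qed simp
  then show ?thesis by (simp add: mat_prod_def foldr_map o_def assms)
qed

lemma mat_prod_pow:
  assumes A: "\<And>m. A m \<in> carrier_mat k k" and per: "\<And>m. A (m + p) = A m" and p: "p \<ge> 0"
  shows "mat_prod k A 0 (p * int x) = mat_prod k A 0 p ^\<^sub>m x"
proof (induction x)
  case 0
  then show ?case using carrier_matD(1)[OF mat_prod_carrier[of A k 0 p, OF A]] by simp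
next
  case (Suc x)
  have per': "A (m + p * int y) = A m" for m y
  proof (induction y)
    case (Suc y)
    have "m + p * int (Suc y) = (m + p * int y) + p" by (simp add: algebra_simps)
    then show ?case using per[of "m + p * int y"] Suc by (simp only:)
  qed simp
  have "mat_prod k A 0 (p * int (Suc x)) =
        mat_prod k A 0 (p * int x) * mat_prod k A (p * int x) (p * int x + p)"
    using mat_prod_append[of A k 0 "p * int x" "p * int x + p", OF A] p
    by (simp add: algebra_simps)
  also have "mat_prod k A (p * int x) (p * int x + p) = mat_prod k A 0 p"
    using mat_prod_shift[of A "p * int x" k 0 p, OF per'] by (simp add: add.commute)
  finally show ?case using Suc by simp
qed

lemma det_mat_prod:
  assumes A: "\<And>m. A m \<in> carrier_mat k k" and "a \<le> b"
  shows "det (mat_prod k A a b) = (\<Prod>m\<in>{a+1..b}. det (A m))"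
  using \<open>a \<le> b\<close>
proof (induction b rule: int_ge_induct)
  case (step b)
  have "{a+1..b+1} = insert (b+1) {a+1..b}" using step by auto
  then show ?case
    using step det_mult[OF mat_prod_carrier[OF A] A] by (simp add: mat_prod_snoc[OF A])
qed simp

section \<open>Entrywise limits, continuity and holomorphy\<close>

lemma det_tendsto:
  fixes F :: "'a \<Rightarrow> complex mat"
  assumes "\<And>x. F x \<in> carrier_mat n n" "L \<in> carrier_mat n n"
    and "\<And>r s. r < n \<Longrightarrow> s < n \<Longrightarrow> ((\<lambda>x. F x $$ (r, s)) \<longlongrightarrow> L $$ (r, s)) net"
  shows "((\<lambda>x. det (F x)) \<longlongrightarrow> det L) net"
  unfolding det_def'[OF assms(1)] det_def'[OF assms(2)]
  by (intro tendsto_sum tendsto_mult tendsto_const tendsto_prod assms(3))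
     (auto simp: permutes_in_image)

lemma det_holomorphic_on:
  assumes "\<And>z. z \<in> S \<Longrightarrow> F z \<in> carrier_mat n n"
    and "\<And>r s. r < n \<Longrightarrow> s < n \<Longrightarrow> (\<lambda>z. F z $$ (r, s)) holomorphic_on S"
  shows "(\<lambda>z. det (F z)) holomorphic_on S"
proof (rule holomorphic_transform)
  show "(\<lambda>z. \<Sum>p\<in>{p. p permutes {0..<n}}. signof p * (\<Prod>i=0..<n. F z $$ (i, p i))) holomorphic_on S"
    by (intro holomorphic_intros assms(2)) (auto simp: permutes_in_image)
qed (simp add: det_def'[OF assms(1)])

lemma det_continuous_on:
  fixes F :: "complex \<Rightarrow> complex mat"
  assumes "\<And>z. z \<in> S \<Longrightarrow> F z \<in> carrier_mat n n"
    and "\<And>r s. r < n \<Longrightarrow> s < n \<Longrightarrow> continuous_on S (\<lambda>z. F z $$ (r, s))"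
  shows "continuous_on S (\<lambda>z. det (F z))"
proof (rule continuous_on_eq)
  show "continuous_on S (\<lambda>z. \<Sum>p\<in>{p. p permutes {0..<n}}. signof p * (\<Prod>i=0..<n. F z $$ (i, p i)))"
    by (intro continuous_intros assms(2)) (auto simp: permutes_in_image)
qed (simp add: det_def'[OF assms(1)])

definition holomorphic_mat :: "nat \<Rightarrow> (complex \<Rightarrow> complex mat) \<Rightarrow> complex set \<Rightarrow> bool" where
  "holomorphic_mat k F S \<longleftrightarrow> (\<forall>z\<in>S. F z \<in> carrier_mat k k) \<and>
     (\<forall>r<k. \<forall>s<k. (\<lambda>z. F z $$ (r, s)) holomorphic_on S)"

definition continuous_mat :: "nat \<Rightarrow> (complex \<Rightarrow> complex mat) \<Rightarrow> complex set \<Rightarrow> bool" where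
  "continuous_mat k F S \<longleftrightarrow> (\<forall>z\<in>S. F z \<in> carrier_mat k k) \<and>
     (\<forall>r<k. \<forall>s<k. continuous_on S (\<lambda>z. F z $$ (r, s)))"

text \<open>Only the existence of the limits is recorded: the decay needed at infinity always comes
  from separate explicit scalar factors.\<close>

definition convergent_mat_at_infinity :: "nat \<Rightarrow> (complex \<Rightarrow> complex mat) \<Rightarrow> bool" where
  "convergent_mat_at_infinity k F \<longleftrightarrow> (\<forall>z. F z \<in> carrier_mat k k) \<and>
     (\<forall>r<k. \<forall>s<k. \<exists>L. ((\<lambda>z. F z $$ (r, s)) \<longlongrightarrow> L) at_infinity)"

lemma holomorphic_mat_mult:
  assumes "holomorphic_mat k F S" "holomorphic_mat k G S"
  shows "holomorphic_mat k (\<lambda>z. F z * G z) S"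
  unfolding holomorphic_mat_def
proof (intro conjI ballI allI impI)
  fix r s assume rs: "r < k" "s < k"
  have "(\<lambda>z. \<Sum>t<k. F z $$ (r, t) * G z $$ (t, s)) holomorphic_on S"
    using assms rs by (auto simp: holomorphic_mat_def intro!: holomorphic_intros)
  then show "(\<lambda>z. (F z * G z) $$ (r, s)) holomorphic_on S"
  proof (rule holomorphic_transform)
    fix z assume "z \<in> S"
    then show "(\<Sum>t<k. F z $$ (r, t) * G z $$ (t, s)) = (F z * G z) $$ (r, s)"
      using assms by (intro index_mult_mat_sum[symmetric] rs) (auto simp: holomorphic_mat_def)
  qed
qed (use assms in \<open>auto simp: holomorphic_mat_def\<close>)

lemma continuous_mat_mult:
  assumes "continuous_mat k F S" "continuous_mat k G S"
  shows "continuous_mat k (\<lambda>z. F z * G z) S"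
  unfolding continuous_mat_def
proof (intro conjI ballI allI impI)
  fix r s assume rs: "r < k" "s < k"
  have "continuous_on S (\<lambda>z. \<Sum>t<k. F z $$ (r, t) * G z $$ (t, s))"
    using assms rs by (intro continuous_on_sum continuous_on_mult) (auto simp: continuous_mat_def)
  then show "continuous_on S (\<lambda>z. (F z * G z) $$ (r, s))"
  proof (rule continuous_on_eq)
    fix z assume "z \<in> S"
    then show "(\<Sum>t<k. F z $$ (r, t) * G z $$ (t, s)) = (F z * G z) $$ (r, s)"
      using assms by (intro index_mult_mat_sum[symmetric] rs) (auto simp: continuous_mat_def)
  qed
qed (use assms in \<open>auto simp: continuous_mat_def\<close>)

lemma convergent_mat_at_infinity_carrier:
  "convergent_mat_at_infinity k F \<Longrightarrow> F z \<in> carrier_mat k k"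
  by (simp add: convergent_mat_at_infinity_def)

lemma convergent_mat_at_infinity_mult:
  assumes "convergent_mat_at_infinity k F" "convergent_mat_at_infinity k G"
  shows "convergent_mat_at_infinity k (\<lambda>z. F z * G z)"
  unfolding convergent_mat_at_infinity_def
proof (intro conjI allI impI)
  fix r s assume rs: "r < k" "s < k"
  have "\<forall>t\<in>{..<k}. \<exists>L. ((\<lambda>z. F z $$ (r, t)) \<longlongrightarrow> L) at_infinity"
    using assms(1) rs by (simp add: convergent_mat_at_infinity_def)
  then obtain LF where LF: "\<And>t. t < k \<Longrightarrow> ((\<lambda>z. F z $$ (r, t)) \<longlongrightarrow> LF t) at_infinity"
    unfolding bchoice_iff by auto
  have "\<forall>t\<in>{..<k}. \<exists>L. ((\<lambda>z. G z $$ (t, s)) \<longlongrightarrow> L) at_infinity"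
    using assms(2) rs by (simp add: convergent_mat_at_infinity_def)
  then obtain LG where LG: "\<And>t. t < k \<Longrightarrow> ((\<lambda>z. G z $$ (t, s)) \<longlongrightarrow> LG t) at_infinity"
    unfolding bchoice_iff by auto
  have "((\<lambda>z. \<Sum>t<k. F z $$ (r, t) * G z $$ (t, s)) \<longlongrightarrow> (\<Sum>t<k. LF t * LG t)) at_infinity"
    by (intro tendsto_sum tendsto_mult LF LG) auto
  then show "\<exists>L. ((\<lambda>z. (F z * G z) $$ (r, s)) \<longlongrightarrow> L) at_infinity"
    unfolding index_mult_mat_sum[OF convergent_mat_at_infinity_carrier[OF assms(1)]
      convergent_mat_at_infinity_carrier[OF assms(2)] rs] by (rule exI)
next
  fix z
  have "F z \<in> carrier_mat k k" "G z \<in> carrier_mat k k"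
    by (rule convergent_mat_at_infinity_carrier[OF assms(1)], rule convergent_mat_at_infinity_carrier[OF assms(2)])
  then show "F z * G z \<in> carrier_mat k k" by (rule mult_carrier_mat)
qed

lemma holomorphic_mat_imp_continuous_mat: "holomorphic_mat k F S \<Longrightarrow> continuous_mat k F S"
  by (auto simp: holomorphic_mat_def continuous_mat_def holomorphic_on_imp_continuous_on)

lemma holomorphic_mat_subset: "holomorphic_mat k F S \<Longrightarrow> T \<subseteq> S \<Longrightarrow> holomorphic_mat k F T"
  unfolding holomorphic_mat_def using holomorphic_on_subset by blast

lemma continuous_mat_subset: "continuous_mat k F S \<Longrightarrow> T \<subseteq> S \<Longrightarrow> continuous_mat k F T"
  unfolding continuous_mat_def using continuous_on_subset by blast

lemma holomorphic_mat_cong: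
  "(\<And>z. z \<in> S \<Longrightarrow> F z = G z) \<Longrightarrow> holomorphic_mat k F S \<longleftrightarrow> holomorphic_mat k G S"
  unfolding holomorphic_mat_def by (auto cong: holomorphic_cong)

lemma continuous_mat_cong:
  "(\<And>z. z \<in> S \<Longrightarrow> F z = G z) \<Longrightarrow> continuous_mat k F S \<longleftrightarrow> continuous_mat k G S"
  unfolding continuous_mat_def by (auto cong: continuous_on_cong)

lemma holomorphic_mat_one: "holomorphic_mat k (\<lambda>_. 1\<^sub>m k) S"
  by (auto simp: holomorphic_mat_def)

lemma holomorphic_mat_prod:
  assumes "\<And>m. m \<in> {a+1..b} \<Longrightarrow> holomorphic_mat k (\<lambda>z. A z m) S"
    and "\<And>m z. A z m \<in> carrier_mat k k" and "a \<le> b"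
  shows "holomorphic_mat k (\<lambda>z. mat_prod k (A z) a b) S"
  using \<open>a \<le> b\<close> assms(1)
proof (induction b rule: int_ge_induct)
  case base
  then show ?case by (simp add: holomorphic_mat_one)
next
  case (step b)
  show ?case
    unfolding mat_prod_snoc[OF assms(2) step(1)]
    using step by (intro holomorphic_mat_mult step.IH step.prems) auto
qed

lemma convergent_mat_at_infinity_prod:
  assumes "\<And>m. convergent_mat_at_infinity k (\<lambda>z. A z m)" and "a \<le> b"
  shows "convergent_mat_at_infinity k (\<lambda>z. mat_prod k (A z) a b)"
  using \<open>a \<le> b\<close>
proof (induction b rule: int_ge_induct)
  case base
  then show ?case by (auto simp: convergent_mat_at_infinity_def)
next
  case (step b)
  then show ?case
    unfolding mat_prod_snoc[OF convergent_mat_at_infinity_carrier[OF assms(1)] step(1)]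
    by (intro convergent_mat_at_infinity_mult assms(1))
qed

text \<open>The determinant tends to 1, hence is eventually nonzero, and Cramer's rule passes to the
  limit. The matrices need not be invertible for small arguments.\<close>

lemma minv_convergent_at_infinity:
  assumes car: "\<And>z. F z \<in> carrier_mat k k"
    and lim: "\<And>r s. r < k \<Longrightarrow> s < k \<Longrightarrow> ((\<lambda>z. F z $$ (r, s)) \<longlongrightarrow> 1\<^sub>m k $$ (r, s)) at_infinity"
    and r: "r < k" and s: "s < k"
  shows "\<exists>L. ((\<lambda>z. minv (F z) $$ (r, s)) \<longlongrightarrow> L) at_infinity"
proof -
  have det1: "((\<lambda>z. det (F z)) \<longlongrightarrow> 1) at_infinity"
    using det_tendsto[of F k "1\<^sub>m k" at_infinity] car lim by simp
  then have ev: "eventually (\<lambda>z. det (F z) \<noteq> 0) at_infinity"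
    by (rule tendsto_imp_eventually_ne) simp
  have dc: "((\<lambda>z. det (mat_delete (F z) s r)) \<longlongrightarrow> det (mat_delete (1\<^sub>m k) s r)) at_infinity"
  proof (rule det_tendsto[where n = "k - 1"])
    fix i j assume "i < k - 1" "j < k - 1"
    moreover have "dim_row (F z) = k" "dim_col (F z) = k" for z
      using car[of z] by auto
    ultimately show "((\<lambda>z. mat_delete (F z) s r $$ (i, j)) \<longlongrightarrow> mat_delete (1\<^sub>m k) s r $$ (i, j)) at_infinity"
      using r s by (auto simp del: index_one_mat(1) simp: mat_delete_def intro!: lim)
  next
    show "mat_delete (F z) s r \<in> carrier_mat (k - 1) (k - 1)" for z
      by (rule mat_delete_carrier[OF car])
    show "mat_delete (1\<^sub>m k :: complex mat) s r \<in> carrier_mat (k - 1) (k - 1)"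
      by (rule mat_delete_carrier[OF one_carrier_mat])
  qed
  have "((\<lambda>z. inverse (det (F z)) * cofactor (F z) s r) \<longlongrightarrow> inverse 1 * cofactor (1\<^sub>m k) s r) at_infinity"
    unfolding cofactor_def by (intro tendsto_intros det1 dc) auto
  moreover have "eventually (\<lambda>z. inverse (det (F z)) * cofactor (F z) s r = minv (F z) $$ (r, s)) at_infinity"
    using ev
  proof eventually_elim
    case (elim z)
    have "minv (F z) = inverse (det (F z)) \<cdot>\<^sub>m adj_mat (F z)"
      by (rule minv_eq_adj[OF car elim])
    then show ?case using car[of z] r s adj_mat(1)[OF car[of z]] by (auto simp: adj_mat_def)
  qed
  ultimately show ?thesis by (intro exI, rule Lim_transform_eventually)
qed

section \<open>Powers and inverses\<close>

lemma pow_mat_comm: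
  assumes A: "(A :: 'a :: semiring_1 mat) \<in> carrier_mat k k"
  shows "A ^\<^sub>m m * A = A * A ^\<^sub>m m"
proof (induction m)
  case 0
  then show ?case using A by simp
next
  case (Suc m)
  have "A ^\<^sub>m Suc m * A = (A * A ^\<^sub>m m) * A" using Suc by simp
  also have "\<dots> = A * (A ^\<^sub>m m * A)"
    by (rule assoc_mult_mat[OF A pow_carrier_mat[OF A] A])
  finally show ?case by simp
qed

lemma minv_mult:
  assumes A: "A \<in> carrier_mat k k" "det A \<noteq> 0" and B: "B \<in> carrier_mat k k" "det B \<noteq> 0"
  shows "minv (A * B) = minv B * minv A"
proof (rule minv_eqI)
  note a = minv[OF A] and b = minv[OF B]
  have "A * B * (minv B * minv A) = A * (B * minv B) * minv A"
    using A(1) B(1) a(1) b(1) by (simp add: assoc_mult_mat[of _ k k _ k _ k])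
  then show "A * B * (minv B * minv A) = 1\<^sub>m k" using A(1) a b by simp
qed (use A B minv(1)[OF A] minv(1)[OF B] in auto)

lemma det_pow_mat_nonzero:
  assumes "(A :: complex mat) \<in> carrier_mat k k" "det A \<noteq> 0"
  shows "det (A ^\<^sub>m m) \<noteq> 0"
  using assms by (induction m) (simp_all add: det_mult[OF pow_carrier_mat])

lemma minv_pow_mat:
  assumes A: "A \<in> carrier_mat k k" "det A \<noteq> 0"
  shows "minv A ^\<^sub>m m = minv (A ^\<^sub>m m)"
proof (induction m)
  case 0
  have "minv (1\<^sub>m k) = 1\<^sub>m k" by (rule minv_eqI) auto
  then show ?case using A minv(1)[OF A] by simp
next
  case (Suc m)
  have "minv (A ^\<^sub>m Suc m) = minv (A * A ^\<^sub>m m)" using pow_mat_comm[OF A(1)] by simp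
  also have "\<dots> = minv (A ^\<^sub>m m) * minv A"
    by (rule minv_mult[OF A pow_carrier_mat[OF A(1)] det_pow_mat_nonzero[OF A]])
  finally show ?case using Suc by simp
qed

lemma mat_powi_minus:
  assumes A: "A \<in> carrier_mat k k" "det A \<noteq> 0"
  shows "mat_powi A (- int m) = minv (A ^\<^sub>m m)"
\<comment> \<open>For \<open>m = 0\<close> the exponent falls into the nonnegative branch of
  \<open>mat_powi\<close>.\<close>
proof (cases m)
  case 0
  have "minv (1\<^sub>m k) = 1\<^sub>m k" by (rule minv_eqI) auto
  then show ?thesis using 0 A by (simp add: mat_powi_def)
next
  case (Suc m')
  then show ?thesis using minv_pow_mat[OF A] by (simp add: mat_powi_def del: of_nat_Suc pow_mat.simps)
qed

lemma pow_mat_add: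
  assumes A: "(A :: 'a :: semiring_1 mat) \<in> carrier_mat k k"
  shows "A ^\<^sub>m (m + m') = A ^\<^sub>m m * A ^\<^sub>m m'"
proof (induction m')
  case (Suc m')
  then show ?case
    using assoc_mult_mat[OF pow_carrier_mat[OF A] pow_carrier_mat[OF A] A] by simp
qed (use pow_carrier_mat[OF A] A in simp)

lemma minv_holomorphic:
  assumes F: "holomorphic_mat k F S" and det: "\<And>z. z \<in> S \<Longrightarrow> det (F z) \<noteq> 0"
  shows "holomorphic_mat k (\<lambda>z. minv (F z)) S"
  unfolding holomorphic_mat_def
proof (intro conjI ballI allI impI)
  have car: "F z \<in> carrier_mat k k" if "z \<in> S" for z
    using F that by (simp add: holomorphic_mat_def)
  show "minv (F z) \<in> carrier_mat k k" if "z \<in> S" for z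
    by (rule minv(1)[OF car[OF that] det[OF that]])
  fix r s assume rs: "r < k" "s < k"
  have "(\<lambda>z. det (mat_delete (F z) s r)) holomorphic_on S"
  proof (rule det_holomorphic_on)
    show "mat_delete (F z) s r \<in> carrier_mat (k - 1) (k - 1)" if "z \<in> S" for z
      by (rule mat_delete_carrier[OF car[OF that]])
    fix i j assume ij: "i < k - 1" "j < k - 1"
    have "(\<lambda>z. F z $$ (if i < s then i else Suc i, if j < r then j else Suc j)) holomorphic_on S"
      using F ij by (simp add: holomorphic_mat_def)
    then show "(\<lambda>z. mat_delete (F z) s r $$ (i, j)) holomorphic_on S"
    proof (rule holomorphic_transform)
      fix z assume "z \<in> S"
      from carrier_matD[OF car[OF this]] ij
      show "F z $$ (if i < s then i else Suc i, if j < r then j else Suc j) = mat_delete (F z) s r $$ (i, j)"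
        by (simp add: mat_delete_def)
    qed
  qed
  moreover have "(\<lambda>z. det (F z)) holomorphic_on S"
    using F by (intro det_holomorphic_on[where n = k]) (auto simp: holomorphic_mat_def)
  ultimately have "(\<lambda>z. inverse (det (F z)) * cofactor (F z) s r) holomorphic_on S"
    unfolding cofactor_def using det by (intro holomorphic_intros) auto
  then show "(\<lambda>z. minv (F z) $$ (r, s)) holomorphic_on S"
  proof (rule holomorphic_transform)
    fix z assume z: "z \<in> S"
    from carrier_matD[OF car[OF z]] rs
    show "inverse (det (F z)) * cofactor (F z) s r = minv (F z) $$ (r, s)"
      by (simp add: minv_eq_adj[OF car[OF z] det[OF z]] adj_mat_def)
  qed
qed

lemma minv_eqI_left:
  assumes "A \<in> carrier_mat k k" "B \<in> carrier_mat k k" "B * A = 1\<^sub>m k"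
  shows "minv A = B"
  by (rule minv_eqI[OF assms(1,2) mat_mult_left_right_inverse[OF assms(2,1,3)]])

section \<open>The transition matrices\<close>

lemma phi_b_carrier [simp]: "phi_b k \<alpha> \<gamma> z \<in> carrier_mat k k"
  by (simp add: phi_b_def)

lemma phi_g_carrier [simp]: "phi_g k \<beta> z \<in> carrier_mat k k"
  by (simp add: phi_g_def)

lemma index_phi_b_mult:
  assumes Y: "Y \<in> carrier_mat k k" and rs: "r < k" "s < k"
  shows "(phi_b k \<alpha> \<gamma> z * Y) $$ (r, s) = \<gamma> (r + 1) * Y $$ (r, s) +
    (if r = 0 then \<alpha> k * inverse z * Y $$ (k - 1, s) else \<alpha> r * Y $$ (r - 1, s))"
proof -
  \<comment> \<open>A sum of three indicators also covers \<open>k = 1\<close>, where they overlap.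
    At \<open>r = 0\<close> the truncated difference \<open>r - 1\<close> is again 0, so the inner
    conditional has to switch that term off.\<close>
  have entry: "phi_b k \<alpha> \<gamma> z $$ (r, t) = (if t = r then \<gamma> (r + 1) else 0) +
      (if t = r - 1 then (if r = 0 then 0 else \<alpha> r) else 0) +
      (if t = k - 1 then (if r = 0 then \<alpha> k * inverse z else 0) else 0)" if "t < k" for t
    using rs that by (cases r) (simp_all add: phi_b_def)
  have "(phi_b k \<alpha> \<gamma> z * Y) $$ (r, s) = (\<Sum>t<k. ((if t = r then \<gamma> (r + 1) else 0) +
      (if t = r - 1 then (if r = 0 then 0 else \<alpha> r) else 0) +
      (if t = k - 1 then (if r = 0 then \<alpha> k * inverse z else 0) else 0)) * Y $$ (t, s))"
    unfolding index_mult_mat_sum[OF phi_b_carrier Y rs]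
    by (intro sum.cong refl arg_cong2[where f = times] entry) simp
  also have "\<dots> = \<gamma> (r + 1) * Y $$ (r, s) + (if r = 0 then 0 else \<alpha> r) * Y $$ (r - 1, s) +
      (if r = 0 then \<alpha> k * inverse z else 0) * Y $$ (k - 1, s)"
    unfolding distrib_right sum.distrib mult_delta_left using rs by (simp only: sum.delta finite_lessThan lessThan_iff) simp
  finally show ?thesis by simp
qed

lemma index_mult_phi_b:
  assumes Y: "Y \<in> carrier_mat k k" and rs: "r < k" "s < k"
  shows "(Y * phi_b k \<alpha> \<gamma> z) $$ (r, s) = \<gamma> (s + 1) * Y $$ (r, s) +
    \<alpha> (s + 1) * (if s = k - 1 then inverse z * Y $$ (r, 0) else Y $$ (r, s + 1))"
proof -
  have entry: "phi_b k \<alpha> \<gamma> z $$ (t, s) = (if t = s then \<gamma> (s + 1) else 0) +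
      (if t = s + 1 then \<alpha> (s + 1) else 0) +
      (if t = 0 then (if s = k - 1 then \<alpha> k * inverse z else 0) else 0)" if "t < k" for t
    using rs that by (simp add: phi_b_def)
  have "(Y * phi_b k \<alpha> \<gamma> z) $$ (r, s) = (\<Sum>t<k. Y $$ (r, t) * ((if t = s then \<gamma> (s + 1) else 0) +
      (if t = s + 1 then \<alpha> (s + 1) else 0) +
      (if t = 0 then (if s = k - 1 then \<alpha> k * inverse z else 0) else 0)))"
    unfolding index_mult_mat_sum[OF Y phi_b_carrier rs]
    by (intro sum.cong refl arg_cong2[where f = times] entry) simp
  also have "\<dots> = Y $$ (r, s) * \<gamma> (s + 1) + (if s + 1 < k then Y $$ (r, s + 1) * \<alpha> (s + 1) else 0) +
      Y $$ (r, 0) * (if s = k - 1 then \<alpha> k * inverse z else 0)"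
    unfolding distrib_left sum.distrib mult_delta_right using rs by (simp only: sum.delta finite_lessThan lessThan_iff) simp
  finally show ?thesis using rs by (cases "s = k - 1") simp_all
qed

section \<open>Inverting cyclically bidiagonal matrices\<close>

text \<open>The weight of one full turn round the cycle: the pole of \<open>phi_g\<close>, and for
  the weights \<open>ratio\<close> below the zero of the determinant of
  \<open>phi_b\<close>.\<close>

definition cyc :: "nat \<Rightarrow> (nat \<Rightarrow> complex) \<Rightarrow> complex" where
  "cyc k \<beta> = (\<Prod>m=1..k. \<beta> m)"

text \<open>Coincides with \<^const>\<open>phi_g\<close> off the origin, where \<^const>\<open>phi_g\<close> takes a junk value; this
  form is holomorphic there.\<close>
definition geom_mat :: "nat \<Rightarrow> (nat \<Rightarrow> complex) \<Rightarrow> complex \<Rightarrow> complex mat" where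
  "geom_mat k \<beta> z = mat k k (\<lambda>(r, s).
     (if s \<le> r then z * (\<Prod>m=s+1..r. \<beta> m) else (\<Prod>m=s+1..k. \<beta> m) * (\<Prod>m=1..r. \<beta> m)) / (z - cyc k \<beta>))"

lemma geom_mat_carrier [simp]: "geom_mat k \<beta> z \<in> carrier_mat k k"
  by (simp add: geom_mat_def)

lemma phi_g_eq_geom_mat:
  assumes "z \<noteq> 0"
  shows "phi_g k \<beta> z = geom_mat k \<beta> z"
proof -
  have "inverse (1 - cyc k \<beta> * inverse z) = z / (z - cyc k \<beta>)"
  proof -
    have "1 - cyc k \<beta> * inverse z = (z - cyc k \<beta>) / z" using assms by (simp add: divide_simps)
    then show ?thesis by simp
  qed
  then show ?thesis
    using assms
    by (intro eq_matI) (auto simp: phi_g_def geom_mat_def cyc_def[symmetric] simp del: One_nat_def)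
qed

lemma prod_atLeastAtMost_last:
  fixes f :: "nat \<Rightarrow> 'a :: comm_monoid_mult"
  assumes "a \<le> b" "0 < b"
  shows "(\<Prod>m=a..b. f m) = f b * (\<Prod>m=a..b-1. f m)"
  using assms by (cases b) (auto simp: prod.nat_ivl_Suc' mult.commute)

lemma cyc_split: "r \<le> k \<Longrightarrow> (\<Prod>m=r+1..k. \<beta> m) * (\<Prod>m=1..r. \<beta> m) = cyc k \<beta>"
  unfolding cyc_def
  using prod.ub_add_nat[of 1 r \<beta> "k - r"] by (simp add: mult.commute)

text \<open>\<open>phi_g\<close> is the geometric series of a weighted cyclic shift: its entries
  count the ways from \<open>s\<close> to \<open>r\<close> round the cycle, each full turn costing
  \<open>cyc k \<beta> / z\<close>. Its inverse is thus the identity minus the shift, which is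
  itself a matrix \<open>phi_b\<close>, with weights \<open>- \<beta>\<close> and 1.\<close>

lemma phi_b_mult_geom_mat:
  assumes k: "k \<ge> 1" and z: "z \<noteq> 0" "z \<noteq> cyc k \<beta>"
  shows "phi_b k (\<lambda>j. - \<beta> j) (\<lambda>_. 1) z * geom_mat k \<beta> z = 1\<^sub>m k"
proof (rule eq_matI)
  fix r s assume "r < dim_row (1\<^sub>m k :: complex mat)" "s < dim_col (1\<^sub>m k :: complex mat)"
  then have rs: "r < k" "s < k" by auto
  define e where "e = (\<lambda>r s. if s \<le> r then z * (\<Prod>m=s+1..r. \<beta> m)
    else (\<Prod>m=s+1..k. \<beta> m) * (\<Prod>m=1..r. \<beta> m))"
  have g: "geom_mat k \<beta> z $$ (r', s) = e r' s / (z - cyc k \<beta>)" if "r' < k" for r'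
    using that rs by (simp add: geom_mat_def e_def)
  have E: "(phi_b k (\<lambda>j. - \<beta> j) (\<lambda>_. 1) z * geom_mat k \<beta> z) $$ (r, s) =
      (e r s - (if r = 0 then \<beta> k * inverse z * e (k - 1) s else \<beta> r * e (r - 1) s)) / (z - cyc k \<beta>)"
    using rs by (simp add: index_phi_b_mult g diff_divide_distrib)
  \<comment> \<open>Each row of column \<open>s\<close> arises from its cyclic predecessor by the
    factor \<beta>, except at \<open>r = s\<close>: there the entry starts afresh with
    \<open>z\<close>, while the turn just completed arrives with
    \<open>cyc k \<beta>\<close>.\<close>
  have "e r s - (if r = 0 then \<beta> k * inverse z * e (k - 1) s else \<beta> r * e (r - 1) s) =
      (if r = s then z - cyc k \<beta> else 0)"
  proof (cases "r = 0")
    case True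
    have c: "(\<Prod>m=s+1..k. \<beta> m) = \<beta> k * (\<Prod>m=s+1..k-1. \<beta> m)"
      using rs by (intro prod_atLeastAtMost_last) auto
    have "e (k - 1) s = z * (\<Prod>m=s+1..k-1. \<beta> m)" using rs by (simp add: e_def)
    then have "\<beta> k * inverse z * e (k - 1) s = (\<Prod>m=s+1..k. \<beta> m)"
      unfolding c using z by simp
    then show ?thesis using True by (auto simp: e_def cyc_def)
  next
    case False
    have P1: "(\<Prod>m=1..r. \<beta> m) = \<beta> r * (\<Prod>m=1..r-1. \<beta> m)"
      using False by (intro prod_atLeastAtMost_last) auto
    consider "s < r" | "s = r" | "r < s" by linarith
    then show ?thesis
    proof cases
      case 1
      then have "(\<Prod>m=s+1..r. \<beta> m) = \<beta> r * (\<Prod>m=s+1..r-1. \<beta> m)"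
        by (intro prod_atLeastAtMost_last) auto
      with 1 False show ?thesis by (simp add: e_def)
    next
      case 2
      have "\<beta> r * e (r - 1) s = cyc k \<beta>"
      proof -
        have "\<not> r \<le> r - 1" using False by simp
        then show ?thesis
          using 2 cyc_split[of r k \<beta>] rs unfolding e_def P1 by (simp add: mult.left_commute)
      qed
      moreover have "e r s = z" using 2 by (simp add: e_def)
      ultimately show ?thesis using 2 False by simp
    next
      case 3
      with False show ?thesis unfolding e_def P1 by auto
    qed
  qed
  with E z rs show "(phi_b k (\<lambda>j. - \<beta> j) (\<lambda>_. 1) z * geom_mat k \<beta> z) $$ (r, s) = 1\<^sub>m k $$ (r, s)"
    by auto
qed (auto simp: phi_b_def geom_mat_def)

definition ratio :: "(nat \<Rightarrow> complex) \<Rightarrow> (nat \<Rightarrow> complex) \<Rightarrow> nat \<Rightarrow> complex" where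
  "ratio \<alpha> \<gamma> j = - \<alpha> j / \<gamma> j"

text \<open>Pulling a diagonal matrix out on the right, \<open>phi_b\<close> is the identity minus
  the cyclic shift with weights \<open>ratio\<close>, times \<open>diag \<gamma>\<close>. Hence the
  inverse is \<open>geom_mat\<close> with row \<open>r\<close> divided by
  \<open>\<gamma> (r + 1)\<close>.\<close>

definition phi_b_inv ::
  "nat \<Rightarrow> (nat \<Rightarrow> complex) \<Rightarrow> (nat \<Rightarrow> complex) \<Rightarrow> complex \<Rightarrow> complex mat" where
  "phi_b_inv k \<alpha> \<gamma> z = mat k k (\<lambda>(r, s). geom_mat k (ratio \<alpha> \<gamma>) z $$ (r, s) / \<gamma> (r + 1))"

lemma phi_b_inv_carrier [simp]: "phi_b_inv k \<alpha> \<gamma> z \<in> carrier_mat k k"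
  by (simp add: phi_b_inv_def)

lemma phi_b_mult_inv:
  assumes k: "k \<ge> 1" and \<gamma>: "\<And>j. j \<in> {1..k} \<Longrightarrow> \<gamma> j \<noteq> 0" and z: "z \<noteq> 0" "z \<noteq> cyc k (ratio \<alpha> \<gamma>)"
  shows "phi_b k \<alpha> \<gamma> z * phi_b_inv k \<alpha> \<gamma> z = 1\<^sub>m k"
proof -
  have "phi_b k \<alpha> \<gamma> z * phi_b_inv k \<alpha> \<gamma> z =
    phi_b k (\<lambda>j. - ratio \<alpha> \<gamma> j) (\<lambda>_. 1) z * geom_mat k (ratio \<alpha> \<gamma>) z"
  proof (rule eq_matI)
    fix r s assume "r < dim_row (phi_b k (\<lambda>j. - ratio \<alpha> \<gamma> j) (\<lambda>_. 1) z * geom_mat k (ratio \<alpha> \<gamma>) z)"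
      "s < dim_col (phi_b k (\<lambda>j. - ratio \<alpha> \<gamma> j) (\<lambda>_. 1) z * geom_mat k (ratio \<alpha> \<gamma>) z)"
    then have rs: "r < k" "s < k" by (auto simp: phi_b_def geom_mat_def)
    show "(phi_b k \<alpha> \<gamma> z * phi_b_inv k \<alpha> \<gamma> z) $$ (r, s) =
      (phi_b k (\<lambda>j. - ratio \<alpha> \<gamma> j) (\<lambda>_. 1) z * geom_mat k (ratio \<alpha> \<gamma>) z) $$ (r, s)"
      using rs \<gamma>[of "r + 1"] k
      by (simp add: index_phi_b_mult del: index_mult_mat) (auto simp: phi_b_inv_def ratio_def)
  qed (auto simp: phi_b_def phi_b_inv_def geom_mat_def)
  then show ?thesis using phi_b_mult_geom_mat[OF k z] by simp
qed

text \<open>The inverse of \<open>phi_b\<close> times \<open>phi_g\<close>, in a form that is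
  meaningful at the origin: in row 0 the corner coefficient \<open>- \<beta> k / z\<close> meets the
  last row of \<open>phi_b_inv\<close>, and the factor \<open>z\<close> of that row has been
  cancelled in advance.\<close>

definition step_inv :: "nat \<Rightarrow> (nat \<Rightarrow> complex) \<Rightarrow> (nat \<Rightarrow> complex) \<Rightarrow> (nat \<Rightarrow> complex) \<Rightarrow>
    complex \<Rightarrow> complex mat" where
  "step_inv k \<alpha> \<beta> \<gamma> z = mat k k (\<lambda>(r, s). phi_b_inv k \<alpha> \<gamma> z $$ (r, s) -
     (if r = 0 then \<beta> k * ((\<Prod>m=s+1..k-1. ratio \<alpha> \<gamma> m) / (z - cyc k (ratio \<alpha> \<gamma>)) / \<gamma> k)
      else \<beta> r * phi_b_inv k \<alpha> \<gamma> z $$ (r - 1, s)))"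

lemma step_inv_carrier [simp]: "step_inv k \<alpha> \<beta> \<gamma> z \<in> carrier_mat k k"
  by (simp add: step_inv_def)

text \<open>No column index exceeds \<open>k - 1\<close>, so every entry of this row falls under the
  branch of \<open>geom_mat\<close> with a factor \<open>z\<close>. This zero at the origin is what
  the bottom boundary row depends on.\<close>

lemma index_phi_b_inv_last_row:
  assumes "k \<ge> 1" "s < k"
  shows "phi_b_inv k \<alpha> \<gamma> z $$ (k - 1, s) =
    z * ((\<Prod>m=s+1..k-1. ratio \<alpha> \<gamma> m) / (z - cyc k (ratio \<alpha> \<gamma>)) / \<gamma> k)"
  using assms by (auto simp: phi_b_inv_def geom_mat_def)

text \<open>The simple pole of the first factor at the origin is cancelled by the last row of the second.\<close>
lemma step_inv_eq:
  assumes k: "k \<ge> 1" and z: "z \<noteq> 0"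
  shows "step_inv k \<alpha> \<beta> \<gamma> z = phi_b k (\<lambda>j. - \<beta> j) (\<lambda>_. 1) z * phi_b_inv k \<alpha> \<gamma> z"
proof (rule eq_matI)
  fix r s assume "r < dim_row (phi_b k (\<lambda>j. - \<beta> j) (\<lambda>_. 1) z * phi_b_inv k \<alpha> \<gamma> z)"
    "s < dim_col (phi_b k (\<lambda>j. - \<beta> j) (\<lambda>_. 1) z * phi_b_inv k \<alpha> \<gamma> z)"
  then have rs: "r < k" "s < k" by (auto simp: phi_b_def phi_b_inv_def)
  show "step_inv k \<alpha> \<beta> \<gamma> z $$ (r, s) =
      (phi_b k (\<lambda>j. - \<beta> j) (\<lambda>_. 1) z * phi_b_inv k \<alpha> \<gamma> z) $$ (r, s)"
    using rs z index_phi_b_inv_last_row[OF k rs(2), of \<alpha> \<gamma> z]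
    by (simp add: index_phi_b_mult del: index_mult_mat) (simp add: step_inv_def)
qed (auto simp: phi_b_def phi_b_inv_def step_inv_def)

text \<open>The first row has just two nonzero entries in general, and their minors are triangular
  with diagonals \<gamma> and \<alpha>. For \<open>k = 1\<close> the two entries coincide and the
  expansion degenerates.\<close>

lemma det_phi_b:
  assumes k: "k \<ge> 1" and \<gamma>: "\<And>j. j \<in> {1..k} \<Longrightarrow> \<gamma> j \<noteq> 0"
  shows "det (phi_b k \<alpha> \<gamma> z) = (\<Prod>j=1..k. \<gamma> j) * (1 - cyc k (ratio \<alpha> \<gamma>) * inverse z)"
proof -
  have "cyc k (ratio \<alpha> \<gamma>) = (-1) ^ k * (\<Prod>j=1..k. \<alpha> j) / (\<Prod>j=1..k. \<gamma> j)"
    unfolding cyc_def ratio_def minus_divide_left[symmetric]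
    by (simp add: prod_uminus prod_dividef)
  moreover have "(\<Prod>j=1..k. \<gamma> j) \<noteq> 0" using \<gamma> by auto
  ultimately have rhs: "(\<Prod>j=1..k. \<gamma> j) * (1 - cyc k (ratio \<alpha> \<gamma>) * inverse z) =
      (\<Prod>j=1..k. \<gamma> j) - (-1) ^ k * (\<Prod>j=1..k. \<alpha> j) * inverse z"
    by (simp add: field_simps)
  show ?thesis
  proof (cases "k = 1")
    case True
    have "det (phi_b 1 \<alpha> \<gamma> z) = phi_b 1 \<alpha> \<gamma> z $$ (0, 0)"
      by (rule det_single) (simp add: phi_b_def)
    then show ?thesis using True rhs by (simp add: phi_b_def)
  next
    case False
    let ?A = "phi_b k \<alpha> \<gamma> z"
    have A: "?A \<in> carrier_mat k k" by simp
    have k2: "k \<ge> 2" using k False by simp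
    have "det ?A = (\<Sum>j<k. ?A $$ (0, j) * cofactor ?A 0 j)"
      using k by (intro laplace_expansion_row[OF A]) auto
    also have "\<dots> = (\<Sum>j<k. (if j = 0 then \<gamma> 1 * cofactor ?A 0 0 else 0) +
        (if j = k - 1 then \<alpha> k * inverse z * cofactor ?A 0 (k - 1) else 0))"
      using k2 by (intro sum.cong) (auto simp: phi_b_def)
    also have "\<dots> = \<gamma> 1 * cofactor ?A 0 0 + \<alpha> k * inverse z * cofactor ?A 0 (k - 1)"
      using k by (simp add: sum.distrib)
    also have "cofactor ?A 0 0 = (\<Prod>j=2..k. \<gamma> j)"
    proof -
      let ?D = "mat_delete ?A 0 0"
      have D: "?D \<in> carrier_mat (k - 1) (k - 1)" by (rule mat_delete_carrier[OF A])
      have "det ?D = prod_list (diag_mat ?D)"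
        by (rule det_lower_triangular[OF _ D]) (auto simp: mat_delete_def phi_b_def)
      also have "\<dots> = (\<Prod>i=0..<k-1. \<gamma> (i + 2))"
        using D by (auto simp: prod_list_diag_prod mat_delete_def phi_b_def intro!: prod.cong)
      also have "\<dots> = (\<Prod>j=2..k. \<gamma> j)"
        using k2 by (intro prod.reindex_bij_witness[of _ "\<lambda>j. j - 2" "\<lambda>i. i + 2"]) auto
      finally show ?thesis by (simp add: cofactor_def)
    qed
    also have "cofactor ?A 0 (k - 1) = (-1) ^ (k - 1) * (\<Prod>j=1..k-1. \<alpha> j)"
    proof -
      let ?D = "mat_delete ?A 0 (k - 1)"
      have D: "?D \<in> carrier_mat (k - 1) (k - 1)" by (rule mat_delete_carrier[OF A])
      have "det ?D = prod_list (diag_mat ?D)"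
        using D by (intro det_upper_triangular[OF _ D]) (auto simp: mat_delete_def phi_b_def)
      also have "\<dots> = (\<Prod>i=0..<k-1. \<alpha> (i + 1))"
        using D by (auto simp: prod_list_diag_prod mat_delete_def phi_b_def intro!: prod.cong)
      also have "\<dots> = (\<Prod>j=1..k-1. \<alpha> j)"
        using k2 by (intro prod.reindex_bij_witness[of _ "\<lambda>j. j - 1" "\<lambda>i. i + 1"]) auto
      finally show ?thesis by (simp add: cofactor_def)
    qed
    also have "\<gamma> 1 * (\<Prod>j=2..k. \<gamma> j) = (\<Prod>j=1..k. \<gamma> j)"
      using k by (simp add: prod.atLeast_Suc_atMost numeral_2_eq_2)
    also have "\<alpha> k * inverse z * ((-1) ^ (k - 1) * (\<Prod>j=1..k-1. \<alpha> j)) =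
        - ((-1) ^ k * (\<Prod>j=1..k. \<alpha> j) * inverse z)"
      using k prod_atLeastAtMost_last[of 1 k \<alpha>] by (cases k) auto
    finally show ?thesis unfolding rhs by simp
  qed
qed

lemma det_phi_g:
  assumes k: "k \<ge> 1" and z: "z \<noteq> 0"
  shows "det (phi_g k \<beta> z) = inverse (1 - cyc k \<beta> * inverse z)"
\<comment> \<open>At the pole \<open>inverse 0 = 0\<close> makes \<open>phi_g\<close> the zero
  matrix, and both sides vanish.\<close>
proof (cases "z = cyc k \<beta>")
  case True
  then show ?thesis using k z by (simp add: phi_g_def cyc_def[symmetric] del: One_nat_def)
next
  case False
  have "cyc k (ratio (\<lambda>j. - \<beta> j) (\<lambda>_. 1)) = cyc k \<beta>"
    by (simp add: cyc_def ratio_def)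
  then have "(1 - cyc k \<beta> * inverse z) * det (phi_g k \<beta> z) = 1"
    using det_mult[of "phi_b k (\<lambda>j. - \<beta> j) (\<lambda>_. 1) z" k "geom_mat k \<beta> z"]
      phi_b_mult_geom_mat[OF k z False] det_phi_b[of k "\<lambda>_. 1" "\<lambda>j. - \<beta> j" z] k
    by (simp add: phi_g_eq_geom_mat[OF z])
  then show ?thesis by (metis inverse_unique)
qed

section \<open>Regularity of the transition matrices\<close>

lemma geom_mat_holomorphic:
  assumes "cyc k \<beta> \<notin> S"
  shows "holomorphic_mat k (geom_mat k \<beta>) S"
  unfolding holomorphic_mat_def
proof (intro conjI ballI allI impI)
  fix r s assume "r < k" "s < k"
  then show "(\<lambda>z. geom_mat k \<beta> z $$ (r, s)) holomorphic_on S"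
    using assms by (cases "s \<le> r") (auto simp: geom_mat_def intro!: holomorphic_intros)
qed simp

lemma phi_b_inv_holomorphic:
  assumes "cyc k (ratio \<alpha> \<gamma>) \<notin> S"
  shows "holomorphic_mat k (phi_b_inv k \<alpha> \<gamma>) S"
  using geom_mat_holomorphic[OF assms]
  by (auto simp: holomorphic_mat_def phi_b_inv_def divide_inverse intro!: holomorphic_intros)

lemma step_inv_holomorphic:
  assumes "cyc k (ratio \<alpha> \<gamma>) \<notin> S"
  shows "holomorphic_mat k (step_inv k \<alpha> \<beta> \<gamma>) S"
  unfolding holomorphic_mat_def
proof (intro conjI ballI allI impI)
  fix r s assume rs: "r < k" "s < k"
  have inv: "(\<lambda>z. phi_b_inv k \<alpha> \<gamma> z $$ (i, s)) holomorphic_on S" if "i < k" for i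
    using phi_b_inv_holomorphic[OF assms] rs that by (simp add: holomorphic_mat_def)
  have q: "(\<lambda>z. \<beta> k * (c / (z - cyc k (ratio \<alpha> \<gamma>)) / \<gamma> k)) holomorphic_on S" for c
    using assms unfolding divide_inverse[of _ "\<gamma> k"]
    by (intro holomorphic_on_mult holomorphic_on_const holomorphic_on_divide holomorphic_on_diff
        holomorphic_on_ident) auto
  show "(\<lambda>z. step_inv k \<alpha> \<beta> \<gamma> z $$ (r, s)) holomorphic_on S"
  proof (cases "r = 0")
    case True
    then show ?thesis
      using rs holomorphic_on_diff[OF inv q, of r] by (simp add: step_inv_def)
  next
    case False
    then show ?thesis
      using rs holomorphic_on_diff[OF inv holomorphic_on_mult[OF holomorphic_on_const inv], of r "r - 1"]
      by (simp add: step_inv_def)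
  qed
qed simp

lemma phi_b_holomorphic:
  assumes "0 \<notin> S"
  shows "holomorphic_mat k (phi_b k \<alpha> \<gamma>) S"
  unfolding holomorphic_mat_def
proof (intro conjI ballI allI impI)
  fix r s assume "r < k" "s < k"
  then show "(\<lambda>z. phi_b k \<alpha> \<gamma> z $$ (r, s)) holomorphic_on S"
    using assms by (cases "r = 0 \<and> s = k - 1") (auto simp: phi_b_def intro!: holomorphic_intros)
qed simp

lemma phi_g_holomorphic:
  assumes "0 \<notin> S" "cyc k \<beta> \<notin> S"
  shows "holomorphic_mat k (phi_g k \<beta>) S"
  using geom_mat_holomorphic[OF assms(2)] assms(1)
  by (subst holomorphic_mat_cong[of _ _ "geom_mat k \<beta>"]) (auto intro!: phi_g_eq_geom_mat)

lemma phi_b_convergent: "convergent_mat_at_infinity k (phi_b k \<alpha> \<gamma>)"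
  unfolding convergent_mat_at_infinity_def
proof (intro conjI allI impI)
  fix r s assume rs: "r < k" "s < k"
  have lim: "((\<lambda>z. c + d * inverse z) \<longlongrightarrow> c + d * 0) at_infinity" for c d :: complex
    by (intro tendsto_intros tendsto_inverse_0)
  have "((\<lambda>z. phi_b k \<alpha> \<gamma> z $$ (r, s)) \<longlongrightarrow> (if r = s then \<gamma> (r + 1) else 0) +
     (if r = s + 1 then \<alpha> (s + 1) else 0) + (if r = 0 \<and> s = k - 1 then \<alpha> k else 0) * 0) at_infinity"
    by (rule Lim_transform_eventually[OF lim]) (use rs in \<open>auto simp: phi_b_def\<close>)
  then show "\<exists>L. ((\<lambda>z. phi_b k \<alpha> \<gamma> z $$ (r, s)) \<longlongrightarrow> L) at_infinity" by (rule exI)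
qed simp

lemma phi_g_convergent: "convergent_mat_at_infinity k (phi_g k \<beta>)"
  unfolding convergent_mat_at_infinity_def
proof (intro conjI allI impI)
  fix r s assume rs: "r < k" "s < k"
  have inv: "((\<lambda>z::complex. inverse z) \<longlongrightarrow> 0) at_infinity" by (rule tendsto_inverse_0)
  have "((\<lambda>z. inverse (1 - cyc k \<beta> * inverse z) *
      (if s \<le> r then (\<Prod>m=s+1..r. \<beta> m) else inverse z * (\<Prod>m=s+1..k. \<beta> m) * (\<Prod>m=1..r. \<beta> m))) \<longlongrightarrow>
      inverse (1 - cyc k \<beta> * 0) * (if s \<le> r then (\<Prod>m=s+1..r. \<beta> m) else 0 * (\<Prod>m=s+1..k. \<beta> m) * (\<Prod>m=1..r. \<beta> m))) at_infinity"
    by (cases "s \<le> r") (simp_all only: if_True if_False, (intro tendsto_intros inv, simp)+)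
  then show "\<exists>L. ((\<lambda>z. phi_g k \<beta> z $$ (r, s)) \<longlongrightarrow> L) at_infinity"
    using rs by (auto simp: phi_g_def cyc_def)
qed simp

section \<open>Unfolding columns to the integers\<close>

text \<open>The \<open>k\<close> columns are unfolded to columns indexed by all integers, a shift by
  \<open>k\<close> costing one factor \<open>1/z\<close>. For \<open>c = k y + j\<close> this is
  column \<open>j\<close> of the block together with the power \<open>z^(-y)\<close> of the
  kernel.\<close>

definition periodic_entry :: "nat \<Rightarrow> complex \<Rightarrow> complex mat \<Rightarrow> nat \<Rightarrow> int \<Rightarrow> complex" where
  "periodic_entry k z Y r c = Y $$ (r, nat (c mod int k)) * z powi (- (c div int k))"

lemma periodic_shift:
  fixes f :: "int \<Rightarrow> 'a"
  assumes "\<And>j. f (j + p) = f j"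
  shows "f (j + p * m) = f j"
proof (induction m rule: int_induct[where k = 0])
  case (step1 i)
  then show ?case using assms[of "j + p * i"] by (simp add: algebra_simps)
next
  case (step2 i)
  then show ?case using assms[of "j + p * (i - 1)"] by (simp add: algebra_simps)
qed simp

lemma periodic_mod:
  fixes f :: "int \<Rightarrow> 'a"
  assumes "\<And>j. f (j + p) = f j"
  shows "f (j mod p + d) = f (j + d)"
  using periodic_shift[of f p "j mod p + d" "j div p", OF assms] by (simp add: algebra_simps)

text \<open>After unfolding, the corner entry with \<open>1/z\<close> becomes an ordinary neighbour:
  passing from residue \<open>k - 1\<close> to 0 raises the quotient by one, which supplies exactly
  this factor. The cyclic matrix acts as a two-term recursion without exceptional columns.\<close>

lemma periodic_entry_mult_phi_b:
  fixes \<alpha> \<gamma> :: "int \<Rightarrow> complex"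
  assumes k: "k \<ge> 1" and Y: "Y \<in> carrier_mat k k" and r: "r < k" and z: "z \<noteq> 0"
    and per: "\<And>j. \<alpha> (j + int k) = \<alpha> j" "\<And>j. \<gamma> (j + int k) = \<gamma> j"
  shows "periodic_entry k z (Y * phi_b k (\<lambda>j. \<alpha> (int j)) (\<lambda>j. \<gamma> (int j)) z) r c =
    \<gamma> (c + 1) * periodic_entry k z Y r c + \<alpha> (c + 1) * periodic_entry k z Y r (c + 1)"
proof -
  define s where "s = nat (c mod int k)"
  have s: "s < k" "int s = c mod int k"
    using k by (auto simp: s_def nat_less_iff)
  have coef: "\<alpha> (int (s + 1)) = \<alpha> (c + 1)" "\<gamma> (int (s + 1)) = \<gamma> (c + 1)"
    using periodic_mod[of \<alpha> "int k" c 1] periodic_mod[of \<gamma> "int k" c 1] per s by (simp_all add: add.commute)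
  have next_col: "periodic_entry k z Y r (c + 1) =
    (if s = k - 1 then inverse z * Y $$ (r, 0) else Y $$ (r, s + 1)) * z powi (- (c div int k))"
  proof (cases "s = k - 1")
    case True
    then have "c mod int k = int k - 1" using s k by simp
    then have "c + 1 = int k * (c div int k + 1)"
      using mult_div_mod_eq[of "int k" c] by (simp add: distrib_left)
    then have "(c + 1) mod int k = 0" "(c + 1) div int k = c div int k + 1"
      using k int_mod_pos_eq[of "c + 1" "int k" "c div int k + 1" 0]
        int_div_pos_eq[of "c + 1" "int k" "c div int k + 1" 0] by auto
    moreover have "z powi (- (c div int k + 1)) = inverse z * z powi (- (c div int k))"
      using z power_int_add[of z "-1" "- (c div int k)"] by (simp add: add.commute)
    ultimately show ?thesis using True by (simp add: periodic_entry_def)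
  next
    case False
    then have "c mod int k + 1 < int k" using s by simp
    moreover have "c + 1 = int k * (c div int k) + (c mod int k + 1)"
      using mult_div_mod_eq[of "int k" c] by simp
    moreover have "0 \<le> c mod int k + 1" using s(2) by simp
    ultimately have "(c + 1) mod int k = c mod int k + 1" "(c + 1) div int k = c div int k"
      using int_mod_pos_eq[of "c + 1" "int k" "c div int k" "c mod int k + 1"]
        int_div_pos_eq[of "c + 1" "int k" "c div int k" "c mod int k + 1"] by blast+
    moreover have "nat (c mod int k + 1) = s + 1" using s by simp
    ultimately show ?thesis using False by (simp add: periodic_entry_def)
  qed
  have this_col: "periodic_entry k z Y r c = Y $$ (r, s) * z powi (- (c div int k))"
    by (simp add: periodic_entry_def s_def)
  have "periodic_entry k z (Y * phi_b k (\<lambda>j. \<alpha> (int j)) (\<lambda>j. \<gamma> (int j)) z) r c =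
    (Y * phi_b k (\<lambda>j. \<alpha> (int j)) (\<lambda>j. \<gamma> (int j)) z) $$ (r, s) * z powi (- (c div int k))"
    by (simp add: periodic_entry_def s_def)
  also have "\<dots> = \<gamma> (c + 1) * periodic_entry k z Y r c + \<alpha> (c + 1) * periodic_entry k z Y r (c + 1)"
    unfolding index_mult_phi_b[OF Y r s(1)] next_col this_col coef by (simp add: algebra_simps)
  finally show ?thesis .
qed

lemma continuous_on_periodic_entry:
  assumes "continuous_mat k F X" "0 \<notin> X" "r < k"
  shows "continuous_on X (\<lambda>z. periodic_entry k z (F z) r c)"
proof -
  have "nat (c mod int k) < k" using assms(3) by (simp add: nat_less_iff)
  then show ?thesis
    using assms unfolding periodic_entry_def continuous_mat_def
    by (intro continuous_intros) auto
qed

lemma periodic_entry_add: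
  assumes "X \<in> carrier_mat k k" "Y \<in> carrier_mat k k" "r < k"
  shows "periodic_entry k z (X + Y) r c = periodic_entry k z X r c + periodic_entry k z Y r c"
proof -
  have "nat (c mod int k) < k" using assms(3) by (simp add: nat_less_iff)
  then show ?thesis using assms by (auto simp: periodic_entry_def algebra_simps)
qed

text \<open>As -1 has quotient -1 and residue \<open>k - 1\<close>, a factor \<open>z\<close>
  appears; it cancels the \<open>1/z\<close> of the measure \<open>dz/z\<close> in the row
  \<open>c = -1\<close>.\<close>

lemma periodic_entry_minus_1:
  assumes "k \<ge> 1"
  shows "periodic_entry k z Y r (-1) = Y $$ (r, k - 1) * z"
proof -
  have "(-1) mod int k = int k - 1" "(-1) div int k = -1"
    using assms int_mod_pos_eq[of "-1" "int k" "-1" "int k - 1"]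
      int_div_pos_eq[of "-1" "int k" "-1" "int k - 1"] by auto
  moreover have "nat (int k - 1) = k - 1" using assms by simp
  ultimately show ?thesis by (simp add: periodic_entry_def)
qed

text \<open>Applied with \<open>m = l * N\<close>, this is the row \<open>c = n\<close>.\<close>

lemma periodic_entry_multiple:
  assumes "k \<ge> 1"
  shows "periodic_entry k z Y r (int k * m) = Y $$ (r, 0) * z powi (- m)"
  using assms by (simp add: periodic_entry_def)

section \<open>Finite Kasteleyn matrices\<close>

text \<open>Enumerating both index sets by the same initial segment gives a square matrix over a
  field, where one-sided inverses are two-sided.\<close>

lemma is_inverse_onI_right:
  assumes fin: "finite W" "finite B" and card: "card W = card B"
    and right: "\<And>w w'. w \<in> W \<Longrightarrow> w' \<in> W \<Longrightarrow> (\<Sum>b\<in>B. K w b * L b w') = (if w = w' then 1 else 0)"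
  shows "is_inverse_on W B K L"
proof -
  define m where "m = card W"
  obtain f where f: "bij_betw f {0..<m} W" using ex_bij_betw_nat_finite[OF fin(1)] by (auto simp: m_def)
  obtain g where g: "bij_betw g {0..<m} B" using ex_bij_betw_nat_finite[OF fin(2)] by (auto simp: m_def card)
  define A where "A = mat m m (\<lambda>(i, j). K (f i) (g j))"
  define C where "C = mat m m (\<lambda>(i, j). L (g i) (f j))"
  have car: "A \<in> carrier_mat m m" "C \<in> carrier_mat m m" by (simp_all add: A_def C_def)
  have "A * C = 1\<^sub>m m"
  proof (rule eq_matI)
    fix i j assume "i < dim_row (1\<^sub>m m :: complex mat)" "j < dim_col (1\<^sub>m m :: complex mat)"
    then have ij: "i < m" "j < m" by auto
    have "(A * C) $$ (i, j) = (\<Sum>t\<in>{0..<m}. K (f i) (g t) * L (g t) (f j))"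
      unfolding index_mult_mat_sum[OF car ij] using ij by (intro sum.cong) (auto simp: A_def C_def)
    also have "\<dots> = (\<Sum>b\<in>B. K (f i) b * L b (f j))"
      by (rule sum.reindex_bij_betw[OF g])
    also have "\<dots> = (if f i = f j then 1 else 0)"
      using bij_betwE[OF f] ij by (intro right) auto
    also have "\<dots> = 1\<^sub>m m $$ (i, j)"
      using inj_on_eq_iff[OF bij_betw_imp_inj_on[OF f], of i j] ij by simp
    finally show "(A * C) $$ (i, j) = 1\<^sub>m m $$ (i, j)" .
  qed (auto simp: A_def C_def)
  then have CA: "C * A = 1\<^sub>m m" by (rule mat_mult_left_right_inverse[OF car])
  have "(\<Sum>w\<in>W. L b w * K w b') = (if b = b' then 1 else 0)" if b: "b \<in> B" "b' \<in> B" for b b'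
  proof -
    obtain i j where ij: "i < m" "j < m" "b = g i" "b' = g j"
      using b bij_betw_imp_surj_on[OF g] by (metis atLeastLessThan_iff imageE)
    have "(\<Sum>w\<in>W. L b w * K w b') = (\<Sum>t\<in>{0..<m}. L b (f t) * K (f t) b')"
      by (rule sum.reindex_bij_betw[OF f, symmetric])
    also have "\<dots> = (C * A) $$ (i, j)"
      unfolding index_mult_mat_sum[OF car(2,1) ij(1,2)] using ij by (intro sum.cong) (auto simp: A_def C_def)
    also have "\<dots> = (if b = b' then 1 else 0)"
      using ij inj_on_eq_iff[OF bij_betw_imp_inj_on[OF g], of i j] by (simp add: CA)
    finally show ?thesis .
  qed
  then show ?thesis using right by (simp add: is_inverse_on_def)
qed

lemma is_inverse_on_unique:
  assumes fin: "finite W" "finite B" and L: "is_inverse_on W B K L" and L': "is_inverse_on W B K L'"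
    and b: "b \<in> B" and w: "w \<in> W"
  shows "L b w = L' b w"
proof -
  have "L b w = (\<Sum>w'\<in>W. L b w' * (if w' = w then 1 else 0))"
    using fin w by (simp add: mult_delta_right)
  also have "\<dots> = (\<Sum>w'\<in>W. L b w' * (\<Sum>b'\<in>B. K w' b' * L' b' w))"
    using L' w by (intro sum.cong) (auto simp: is_inverse_on_def)
  also have "\<dots> = (\<Sum>b'\<in>B. (\<Sum>w'\<in>W. L b w' * K w' b') * L' b' w)"
    unfolding sum_distrib_left sum_distrib_right by (subst sum.swap) (simp add: mult.assoc)
  also have "\<dots> = (\<Sum>b'\<in>B. (if b = b' then 1 else 0) * L' b' w)"
    using L b by (intro sum.cong) (auto simp: is_inverse_on_def)
  also have "\<dots> = L' b w" using fin b by (simp add: mult_delta_left)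
  finally show ?thesis .
qed

text \<open>By uniqueness on \<open>B\<close> times \<open>W\<close> the arbitrary choice in
  \<open>inverse_on\<close> agrees there with any inverse at hand.\<close>

lemma inverse_on_eq:
  assumes "finite W" "finite B" "is_inverse_on W B K L" "b \<in> B" "w \<in> W"
  shows "inverse_on W B K b w = L b w"
  unfolding inverse_on_def
  by (rule is_inverse_on_unique[OF assms(1,2) someI[of "is_inverse_on W B K", OF assms(3)] assms(3-5)])

section \<open>The vertices of the Aztec diamond\<close>

lemma black_inject [simp]: "black a c = black a' c' \<longleftrightarrow> a = a' \<and> c = c'"
  by (auto simp: black_def)

lemma white_inject [simp]: "white a c = white a' c' \<longleftrightarrow> a = a' \<and> c = c'"
  by (auto simp: white_def)

lemma aztec_black_eq: "aztec_black n = (\<lambda>(a, c). black a c) ` ({0..int n} \<times> {0..int n - 1})"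
  by (auto simp: aztec_black_def image_iff)

lemma aztec_white_eq: "aztec_white n = (\<lambda>(a, c). white a c) ` ({0..int n - 1} \<times> {-1..int n - 1})"
  by (auto simp: aztec_white_def image_iff)

lemma finite_aztec: "finite (aztec_black n)" "finite (aztec_white n)"
  by (simp_all add: aztec_black_eq aztec_white_eq)

lemma card_aztec: "card (aztec_white n) = card (aztec_black n)"
proof -
  have "card (aztec_black n) = card ({0..int n} \<times> {0..int n - 1})"
    unfolding aztec_black_eq by (rule card_image) (auto simp: inj_on_def)
  moreover have "card (aztec_white n) = card ({0..int n - 1} \<times> {-1..int n - 1})"
    unfolding aztec_white_eq by (rule card_image) (auto simp: inj_on_def)
  ultimately show ?thesis by (simp add: card_cartesian_product mult.commute)
qed

lemma kasteleyn_white: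
  "kasteleyn \<alpha> \<beta> \<gamma> (white a c) b =
    (if b = black a c then complex_of_real (\<gamma> (c + 1) (a + 1))
     else if b = black a (c + 1) then complex_of_real (\<alpha> (c + 1) (a + 1))
     else if b = black (a + 1) (c + 1) then complex_of_real (\<beta> (c + 1) (a + 1))
     else if b = black (a + 1) c then -1 else 0)"
  by (simp add: kasteleyn_def white_def Let_def)

section \<open>Zeros and poles of the symbol\<close>

lemma prod_pairs:
  fixes f :: "int \<Rightarrow> 'a :: comm_monoid_mult"
  shows "(\<Prod>m\<in>{1..2 * int n}. f m) = (\<Prod>i=1..n. f (2 * int i - 1) * f (2 * int i))"
proof (induction n)
  case (Suc n)
  have "{1..2 * int (Suc n)} = insert (2 * int n + 1) (insert (2 * int n + 2) {1..2 * int n})"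
    by auto
  then show ?case using Suc by (simp add: mult_ac add_ac)
qed simp

lemma closure_exterior: "closure {z::complex. 1 < norm z} = {z. 1 \<le> norm z}"
proof -
  have "{z::complex. 1 < norm z} = - cball 0 1" by auto
  then show ?thesis by (auto simp: closure_complement)
qed

lemma mod_shift_range:
  assumes "p \<ge> 1"
  shows "(j - 1) mod int p + 1 \<in> {1..int p}"
  using pos_mod_bound[of "int p" "j - 1"] pos_mod_sign[of "int p" "j - 1"] assms
  unfolding atLeastAtMost_iff by linarith

section \<open>The symbol under the standing assumptions\<close>

locale aztec_wiener_hopf =
  fixes k l N :: nat
    and \<alpha> \<beta> \<gamma> :: "int \<Rightarrow> int \<Rightarrow> real"
    and P M tM tP :: "complex \<Rightarrow> complex mat"
    and r_s r_l :: real
  assumes k: "k \<ge> 1" and l: "l \<ge> 1" and N: "N \<ge> 1"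
    and per_\<alpha>: "periodic_weights k l \<alpha>" and per_\<beta>: "periodic_weights k l \<beta>"
    and per_\<gamma>: "periodic_weights k l \<gamma>"
    and wh: "wiener_hopf k (l * N) (path_symbol k l N \<alpha> \<beta> \<gamma>) P M tM tP"
    and r_s: "0 < r_s" "r_s < 1" and r_l: "1 < r_l"
    and annulus: "analytic_invertible_on k (path_symbol k l N \<alpha> \<beta> \<gamma>) {z. r_s \<le> norm z \<and> norm z \<le> r_l}"
begin

abbreviation \<phi> :: "complex \<Rightarrow> int \<Rightarrow> complex mat" where
  "\<phi> \<equiv> phi_m k \<alpha> \<beta> \<gamma>"

abbreviation T :: "int \<Rightarrow> complex \<Rightarrow> complex mat" where
  "T u z \<equiv> mat_prod k (\<phi> z) 0 u"

abbreviation S :: "complex \<Rightarrow> complex mat" where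
  "S \<equiv> path_symbol k l N \<alpha> \<beta> \<gamma>"

definition "n = k * l * N"

definition "av i = (\<lambda>j::nat. complex_of_real (\<alpha> (int j) i))"
definition "bv i = (\<lambda>j::nat. complex_of_real (\<beta> (int j) i))"
definition "gv i = (\<lambda>j::nat. complex_of_real (\<gamma> (int j) i))"
text \<open>Off the origin, \<open>zero_b i\<close> is the only zero of the determinant of the
  \<open>i\<close>-th \<open>phi_b\<close>, and \<open>pole_g i\<close> the only pole of the
  \<open>i\<close>-th \<open>phi_g\<close>.\<close>

definition "zero_b i = cyc k (ratio (av i) (gv i))"
definition "pole_g i = cyc k (bv i)"
definition "gprod i = (\<Prod>j=1..k. gv i j)"

lemma weight_periodic:
  "\<alpha> (j + int k) i = \<alpha> j i" "\<beta> (j + int k) i = \<beta> j i" "\<gamma> (j + int k) i = \<gamma> j i"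
  "\<alpha> j (i + int l) = \<alpha> j i" "\<beta> j (i + int l) = \<beta> j i" "\<gamma> j (i + int l) = \<gamma> j i"
  using per_\<alpha> per_\<beta> per_\<gamma> by (auto simp: periodic_weights_def)

lemma \<gamma>_pos: "\<gamma> j i > 0"
proof -
  have "\<gamma> ((j - 1) mod int k + 1) ((i - 1) mod int l + 1) = \<gamma> j i"
    using periodic_mod[of "\<lambda>j. \<gamma> j ((i - 1) mod int l + 1)" "int k" "j - 1" 1]
      periodic_mod[of "\<gamma> j" "int l" "i - 1" 1] weight_periodic by simp
  moreover have "(j - 1) mod int k + 1 \<in> {1..int k}" "(i - 1) mod int l + 1 \<in> {1..int l}"
    by (rule mod_shift_range[OF k], rule mod_shift_range[OF l])
  ultimately show ?thesis using per_\<gamma> by (metis periodic_weights_def)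
qed

lemma gv_nonzero: "gv i j \<noteq> 0"
  using \<gamma>_pos[of "int j" i] by (simp add: gv_def)

lemma g_nonzero: "gprod i \<noteq> 0"
  by (simp add: gprod_def gv_nonzero)

lemma \<phi>_odd: "\<phi> z (2 * i - 1) = phi_b k (av i) (gv i) z"
  by (simp add: phi_m_def av_def gv_def)

lemma \<phi>_odd': "\<phi> z (2 * i + 1) = phi_b k (av (i + 1)) (gv (i + 1)) z"
  using \<phi>_odd[of z "i + 1"] by (simp add: algebra_simps)

lemma \<phi>_even: "\<phi> z (2 * i) = phi_g k (bv i) z"
  by (simp add: phi_m_def bv_def)

lemma \<phi>_cases:
  fixes m :: int
  obtains i where "m = 2 * i - 1" | i where "m = 2 * i"
proof (cases "even m")
  case True
  then show ?thesis using that(2) by (auto elim: evenE)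
next
  case False
  then obtain i where "m = 2 * i + 1" by (auto elim: oddE)
  then show ?thesis using that(1)[of "i + 1"] by simp
qed

lemma \<phi>_carrier [simp]: "\<phi> z m \<in> carrier_mat k k"
  by (simp add: phi_m_def)

lemma \<phi>_periodic: "\<phi> z (m + 2 * int l) = \<phi> z m"
proof -
  have "(m + 2 * int l) div 2 = m div 2 + int l" "(m + 2 * int l + 1) div 2 = (m + 1) div 2 + int l"
    using div_mult_self2[of 2 m "int l"] div_mult_self2[of 2 "m + 1" "int l"] by (simp_all add: algebra_simps)
  then show ?thesis by (simp add: phi_m_def weight_periodic)
qed

lemma T_carrier [simp]: "T u z \<in> carrier_mat k k"
  by simp

lemma Phi_carrier [simp]: "Phi k l \<alpha> \<beta> \<gamma> z \<in> carrier_mat k k"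
  by (simp add: Phi_def)

lemma S_carrier [simp]: "S z \<in> carrier_mat k k"
  by (simp add: path_symbol_def)

lemma T_pow: "T (2 * int l * int x) z = Phi k l \<alpha> \<beta> \<gamma> z ^\<^sub>m x"
  unfolding Phi_def by (rule mat_prod_pow) (simp_all add: \<phi>_periodic)

lemma S_eq: "S z = T (2 * int n) z"
  using T_pow[where x = "k * N" and z = z] by (simp add: path_symbol_def n_def mult_ac)

lemma det_odd: "det (\<phi> z (2 * i - 1)) = gprod i * (1 - zero_b i * inverse z)"
  unfolding \<phi>_odd gprod_def zero_b_def by (rule det_phi_b[OF k gv_nonzero])

lemma det_even: "z \<noteq> 0 \<Longrightarrow> det (\<phi> z (2 * i)) = inverse (1 - pole_g i * inverse z)"
  unfolding \<phi>_even pole_g_def by (rule det_phi_g[OF k])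

lemma det_S:
  assumes "z \<noteq> 0"
  shows "det (S z) = (\<Prod>i=1..n. gprod (int i) * (z - zero_b (int i)) * inverse (z - pole_g (int i)))"
proof -
  have "gprod i * (1 - zero_b i * inverse z) * inverse (1 - pole_g i * inverse z) = gprod i * (z - zero_b i) * inverse (z - pole_g i)" for i
  proof -
    have "1 - zero_b i * inverse z = (z - zero_b i) / z" "1 - pole_g i * inverse z = (z - pole_g i) / z"
      using assms by (simp_all add: divide_simps)
    then show ?thesis using assms by (simp add: divide_inverse)
  qed
  moreover have "det (S z) = (\<Prod>m\<in>{1..2 * int n}. det (\<phi> z m))"
    unfolding S_eq using det_mat_prod[of "\<phi> z" k 0 "2 * int n"] by simp
  ultimately show ?thesis
    using assms by (simp only: prod_pairs det_odd det_even not_False_eq_True)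
qed

abbreviation Ann :: "complex set" where
  "Ann \<equiv> {z. r_s \<le> norm z \<and> norm z \<le> r_l}"

lemma Ann_nonzero: "z \<in> Ann \<Longrightarrow> z \<noteq> 0"
  using r_s by auto

lemma det_S_nonzero: "z \<in> Ann \<Longrightarrow> det (S z) \<noteq> 0"
  using annulus invertible_mat_iff_det[OF S_carrier] by (auto simp: analytic_invertible_on_def)

lemma l_le_n: "l \<le> n"
  unfolding n_def using k N mult_le_mono[of 1 "k * N" l l] by (simp add: mult_ac Suc_leI)

text \<open>The determinant of \<open>S\<close> is the product of the determinants of the first
  \<open>2 n\<close> transition matrices, which include a full period because
  \<open>l \<le> n\<close>. Where it is nonzero, no transition matrix is singular.\<close>

lemma det_\<phi>_nonzero:
  assumes z: "z \<in> Ann"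
  shows "det (\<phi> z m) \<noteq> 0"
proof -
  have l_le: "2 * int l \<le> 2 * int n"
    using l_le_n by simp
  have "\<phi> z ((m - 1) mod (2 * int l) + 1) = \<phi> z m"
    using periodic_mod[of "\<phi> z" "2 * int l" "m - 1" 1] \<phi>_periodic by simp
  moreover have "(m - 1) mod (2 * int l) + 1 \<in> {0+1..2 * int n}"
    using mod_shift_range[of "2 * l" m] l l_le by auto
  moreover have "(\<Prod>m\<in>{0+1..2 * int n}. det (\<phi> z m)) \<noteq> 0"
    using det_S_nonzero[OF z] det_mat_prod[of "\<phi> z" k 0 "2 * int n"] by (simp add: S_eq)
  ultimately show ?thesis by (metis finite_atLeastAtMost_int prod_zero_iff)
qed

text \<open>At \<open>zero_b i\<close> the determinant of \<open>phi_b\<close> vanishes. At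
  \<open>pole_g i\<close> the matrix \<open>phi_g\<close> is zero by the convention for division by
  zero, so the same nonvanishing of determinants rules out poles as well.\<close>

lemma poles_not_in_Ann: "zero_b i \<notin> Ann" "pole_g i \<notin> Ann"
proof -
  show "zero_b i \<notin> Ann"
  proof
    assume "zero_b i \<in> Ann"
    from det_\<phi>_nonzero[OF this, of "2 * i - 1"] Ann_nonzero[OF this] show False
      by (simp add: det_odd)
  qed
  show "pole_g i \<notin> Ann"
  proof
    assume "pole_g i \<in> Ann"
    from det_\<phi>_nonzero[OF this, of "2 * i"] Ann_nonzero[OF this] show False
      by (simp add: det_even)
  qed
qed

lemma norm_poles_ne_1: "norm (zero_b i) \<noteq> 1" "norm (pole_g i) \<noteq> 1"
  using poles_not_in_Ann[of i] r_s r_l by auto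

section \<open>The Wiener-Hopf factors\<close>

lemma tP:
  "\<And>z. norm z \<le> 1 \<Longrightarrow> tP z \<in> carrier_mat k k" "\<And>z. norm z \<le> 1 \<Longrightarrow> det (tP z) \<noteq> 0"
  "holomorphic_mat k tP (ball 0 1)" "continuous_mat k tP (cball 0 1)"
proof -
  have H: "holomorphic_invertible_closure k tP (ball 0 1)"
    using wh by (simp add: wiener_hopf_def)
  show car: "\<And>z. norm z \<le> 1 \<Longrightarrow> tP z \<in> carrier_mat k k"
    using H by (simp add: holomorphic_invertible_closure_def)
  show "\<And>z. norm z \<le> 1 \<Longrightarrow> det (tP z) \<noteq> 0"
    using H invertible_mat_iff_det[OF car] by (auto simp: holomorphic_invertible_closure_def)
  show "holomorphic_mat k tP (ball 0 1)" "continuous_mat k tP (cball 0 1)"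
    using H car by (auto simp: holomorphic_invertible_closure_def holomorphic_mat_def continuous_mat_def)
qed

lemma tM:
  "\<And>z. norm z \<ge> 1 \<Longrightarrow> tM z \<in> carrier_mat k k" "\<And>z. norm z \<ge> 1 \<Longrightarrow> det (tM z) \<noteq> 0"
  "holomorphic_mat k tM {z. norm z > 1}" "continuous_mat k tM {z. norm z \<ge> 1}"
  "holomorphic_mat k (\<lambda>z. minv (tM z)) {z. norm z > 1}" "continuous_mat k (\<lambda>z. minv (tM z)) {z. norm z \<ge> 1}"
proof -
  have H: "holomorphic_invertible_closure k tM {z. norm z > 1}"
    using wh by (simp add: wiener_hopf_def)
  show car: "\<And>z. norm z \<ge> 1 \<Longrightarrow> tM z \<in> carrier_mat k k"
    using H by (simp add: holomorphic_invertible_closure_def closure_exterior)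
  show det: "\<And>z. norm z \<ge> 1 \<Longrightarrow> det (tM z) \<noteq> 0"
    using H car invertible_mat_iff_det by (auto simp: holomorphic_invertible_closure_def closure_exterior)
  show "holomorphic_mat k tM {z. norm z > 1}" "continuous_mat k tM {z. norm z \<ge> 1}"
    using H car by (auto simp: holomorphic_invertible_closure_def closure_exterior holomorphic_mat_def continuous_mat_def)
  show "holomorphic_mat k (\<lambda>z. minv (tM z)) {z. norm z > 1}"
    "continuous_mat k (\<lambda>z. minv (tM z)) {z. norm z \<ge> 1}"
    using H minv(1)[OF car det]
    by (auto simp: holomorphic_invertible_closure_def closure_exterior holomorphic_mat_def continuous_mat_def)
qed

lemma factorization: "norm z = 1 \<Longrightarrow> S z = tM z * tP z"
  using wh unfolding wiener_hopf_def by (metis mem_sphere_0)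

text \<open>The normalised factor tending to the identity. The value inside the disc is immaterial;
  it makes dimension and invertibility hold for every \<open>z\<close>, as the lemmas on limits at
  infinity expect.\<close>

definition scaled_minus :: "complex \<Rightarrow> complex mat" where
  "scaled_minus z = (if norm z \<ge> 1 then z ^ (l * N) \<cdot>\<^sub>m tM z else 1\<^sub>m k)"

lemma scaled_minus_carrier [simp]: "scaled_minus z \<in> carrier_mat k k"
  using tM(1) by (simp add: scaled_minus_def)

lemma eventually_exterior: "eventually (\<lambda>z::complex. norm z > 1) at_infinity"
  unfolding eventually_at_infinity by (rule exI[of _ 2]) auto

lemma scaled_minus_tendsto:
  assumes rs: "r < k" "s < k"
  shows "((\<lambda>z. scaled_minus z $$ (r, s)) \<longlongrightarrow> 1\<^sub>m k $$ (r, s)) at_infinity"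
proof (rule Lim_transform_eventually)
  show "((\<lambda>z. z ^ (l * N) * tM z $$ (r, s)) \<longlongrightarrow> 1\<^sub>m k $$ (r, s)) at_infinity"
    using wh rs by (simp add: wiener_hopf_def asymp_scalar_at_infinity_def del: index_one_mat)
  show "eventually (\<lambda>z. z ^ (l * N) * tM z $$ (r, s) = scaled_minus z $$ (r, s)) at_infinity"
    using eventually_exterior
  proof eventually_elim
    case (elim z)
    then show ?case using tM(1)[of z] rs by (auto simp: scaled_minus_def)
  qed
qed

text \<open>By Liouville's theorem: moving the zeros and poles of \<open>det \<Phi>\<close> that lie on the wrong side
  from one factor of \<open>det tM * det tP\<close> to the other yields a nowhere vanishing entire function,
  which tends to 0 at infinity unless there are none.\<close>
lemma poles_separated:
  assumes i: "i \<in> {1..n}"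
  shows "norm (zero_b (int i)) > 1 \<and> norm (pole_g (int i)) < 1"
proof (rule ccontr)
  assume bad: "\<not> (norm (zero_b (int i)) > 1 \<and> norm (pole_g (int i)) < 1)"
  \<comment> \<open>\<open>x\<close> collects the factors of \<open>det S\<close> whose zero or pole
    lies outside the unit circle, so it is holomorphic and nonvanishing in the disc;
    \<open>y\<close> inverts all the other factors and is holomorphic outside. Thus
    \<open>det S\<close> times the product of \<open>y\<close> is the product of \<open>x\<close>,
    and the two branches of \<open>F\<close> agree on the circle.\<close>
  define x where "x = (\<lambda>z i. (if norm (zero_b (int i)) > 1 then z - zero_b (int i) else 1) *
    (if norm (pole_g (int i)) > 1 then inverse (z - pole_g (int i)) else 1))"
  define y where "y = (\<lambda>z i. inverse (gprod (int i)) *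
    (if norm (zero_b (int i)) > 1 then 1 else inverse (z - zero_b (int i))) *
    (if norm (pole_g (int i)) > 1 then 1 else z - pole_g (int i)))"
  define F where "F = (\<lambda>z. if norm z \<le> 1 then (\<Prod>i=1..n. x z i) / det (tP z)
    else det (tM z) * (\<Prod>i=1..n. y z i))"
  have x_hol: "(\<lambda>z. \<Prod>i=1..n. x z i) holomorphic_on ball 0 1"
  proof -
    have "(\<lambda>z. x z i) holomorphic_on ball 0 1" for i
      by (cases "norm (zero_b (int i)) > 1"; cases "norm (pole_g (int i)) > 1")
         (auto simp: x_def intro!: holomorphic_intros)
    then show ?thesis by (intro holomorphic_on_prod)
  qed
  have x_cont: "continuous_on (cball 0 1) (\<lambda>z. \<Prod>i=1..n. x z i)"
  proof -
    have "continuous_on (cball 0 1) (\<lambda>z. x z i)" for i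
      by (cases "norm (zero_b (int i)) > 1"; cases "norm (pole_g (int i)) > 1")
         (auto simp: x_def intro!: continuous_intros)
    then show ?thesis by (intro continuous_on_prod)
  qed
  have y_hol: "(\<lambda>z. \<Prod>i=1..n. y z i) holomorphic_on {z. norm z > 1}"
  proof -
    have "(\<lambda>z. y z i) holomorphic_on {z. norm z > 1}" for i
      by (cases "norm (zero_b (int i)) > 1"; cases "norm (pole_g (int i)) > 1")
         (auto simp: y_def intro!: holomorphic_intros)
    then show ?thesis by (intro holomorphic_on_prod)
  qed
  have ne: "z \<noteq> zero_b i \<and> z \<noteq> pole_g i" if "norm z = 1" for z i
    using norm_poles_ne_1 that by metis
  have y_cont: "continuous_on {z. norm z \<ge> 1} (\<lambda>z. \<Prod>i=1..n. y z i)"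
  proof -
    have "continuous_on {z. norm z \<ge> 1} (\<lambda>z. y z i)" for i
      using norm_poles_ne_1[of "int i"]
      by (cases "norm (zero_b (int i)) > 1"; cases "norm (pole_g (int i)) > 1")
         (auto simp: y_def intro!: continuous_intros)
    then show ?thesis by (intro continuous_on_prod)
  qed
  have glue: "(\<Prod>i=1..n. x z i) / det (tP z) = det (tM z) * (\<Prod>i=1..n. y z i)" if z: "norm z = 1" for z
  proof -
    have "det (tM z) * det (tP z) = det (S z)"
      using factorization[OF z] det_mult[of "tM z" k "tP z"] tM(1)[of z] tP(1)[of z] z by simp
    also have "\<dots> = (\<Prod>i=1..n. gprod (int i) * (z - zero_b (int i)) * inverse (z - pole_g (int i)))"
      using z by (intro det_S) auto
    finally have "det (tM z) * det (tP z) * (\<Prod>i=1..n. y z i) =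
      (\<Prod>i=1..n. gprod (int i) * (z - zero_b (int i)) * inverse (z - pole_g (int i)) * y z i)"
      by (simp add: prod.distrib)
    also have "\<dots> = (\<Prod>i=1..n. x z i)"
    proof (rule prod.cong[OF refl])
      fix i
      have "c * p * inverse q * (inverse c * (if A then 1 else inverse p) * (if B then 1 else q)) =
          (if A then p else 1) * (if B then inverse q else 1)" if "p \<noteq> 0" "q \<noteq> 0" "c \<noteq> 0" for p q c :: complex and A B
        using that by (cases A; cases B) (simp_all add: field_simps)
      then show "gprod (int i) * (z - zero_b (int i)) * inverse (z - pole_g (int i)) * y z i = x z i"
        using ne[OF z, of "int i"] g_nonzero[of "int i"] by (simp add: x_def y_def)
    qed
    finally show ?thesis using tP(2)[of z] z by (simp add: field_simps)
  qed
  have in_hol: "(\<lambda>z. (\<Prod>i=1..n. x z i) / det (tP z)) holomorphic_on ball 0 1"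
    using tP by (intro holomorphic_on_divide x_hol det_holomorphic_on[where n = k]) (auto simp: holomorphic_mat_def)
  have out_hol: "(\<lambda>z. det (tM z) * (\<Prod>i=1..n. y z i)) holomorphic_on {z. norm z > 1}"
    using tM by (intro holomorphic_on_mult y_hol det_holomorphic_on[where n = k]) (auto simp: holomorphic_mat_def)
  have "F holomorphic_on UNIV"
  proof (rule holomorphic_on_paste_across_circle)
    show "continuous_on UNIV F"
      unfolding F_def
    proof (rule continuous_on_cases_le)
      show "continuous_on {z \<in> UNIV. norm z \<le> 1} (\<lambda>z. (\<Prod>i=1..n. x z i) / det (tP z))"
        using tP x_cont by (intro continuous_on_divide det_continuous_on[where n = k]) (auto simp: continuous_mat_def cball_def)
      show "continuous_on {z \<in> UNIV. 1 \<le> norm z} (\<lambda>z. det (tM z) * (\<Prod>i=1..n. y z i))"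
        using tM y_cont by (intro continuous_on_mult det_continuous_on[where n = k]) (auto simp: continuous_mat_def)
      show "(\<Prod>i=1..n. x z i) / det (tP z) = det (tM z) * (\<Prod>i=1..n. y z i)"
        if "z \<in> UNIV" "norm z = 1" for z
        by (rule glue[OF that(2)])
    qed (intro continuous_on_norm continuous_on_id)
    show "F holomorphic_on UNIV \<inter> {z. norm z < 1}"
      by (rule holomorphic_transform[OF holomorphic_on_subset[OF in_hol]]) (auto simp: F_def)
    show "F holomorphic_on UNIV \<inter> {z. 1 < norm z}"
      by (rule holomorphic_transform[OF holomorphic_on_subset[OF out_hol]]) (auto simp: F_def)
  qed auto
  moreover have "(F \<longlongrightarrow> 0) at_infinity"
  proof -
    have inv: "((\<lambda>z. inverse z) \<longlongrightarrow> (0::complex)) at_infinity" by (rule tendsto_inverse_0)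
    have lin: "((\<lambda>z. inverse z * (z - c)) \<longlongrightarrow> 1) at_infinity" for c :: complex
    proof (rule Lim_transform_eventually)
      have "((\<lambda>z. 1 - inverse z * c) \<longlongrightarrow> 1 - 0 * c) at_infinity" by (intro tendsto_intros inv)
      then show "((\<lambda>z. 1 - inverse z * c) \<longlongrightarrow> 1) at_infinity" by simp
      show "eventually (\<lambda>z. 1 - inverse z * c = inverse z * (z - c)) at_infinity"
        using eventually_exterior
      proof eventually_elim
        case (elim z)
        then have "z \<noteq> 0" by auto
        then show ?case by (simp add: right_diff_distrib)
      qed
    qed
    \<comment> \<open>\<open>det tM\<close> behaves like \<open>z^(-n)\<close>, and one factor
      \<open>1/z\<close> is given to each \<open>y\<close>. The limit \<open>L i\<close> is nonzero
      only if \<open>zero_b\<close> lies outside and \<open>pole_g\<close> inside: a zero inside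
      contributes a decaying inverse, and a pole outside leaves the factor \<open>1/z\<close>
      unbalanced.\<close>
    define L where "L = (\<lambda>i. inverse (gprod (int i)) * (if norm (zero_b (int i)) > 1 then 1 else 0) *
      (if norm (pole_g (int i)) > 1 then 0 else 1))"
    have y_lim: "((\<lambda>z. inverse z * y z i) \<longlongrightarrow> L i) at_infinity" for i
    proof -
      have A: "((\<lambda>z. if norm (zero_b (int i)) > 1 then 1 else inverse (z - zero_b (int i))) \<longlongrightarrow>
          (if norm (zero_b (int i)) > 1 then 1 else 0)) at_infinity"
        using tendsto_inverse_shift by simp
      have B: "((\<lambda>z. inverse z * (if norm (pole_g (int i)) > 1 then 1 else z - pole_g (int i))) \<longlongrightarrow>
          (if norm (pole_g (int i)) > 1 then 0 else 1)) at_infinity"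
        using inv lin by simp
      show ?thesis
        using tendsto_mult[OF tendsto_mult[OF tendsto_const[of "inverse (gprod (int i))"] A] B]
        by (simp only: L_def y_def ac_simps)
    qed
    have "L i = 0" using bad norm_poles_ne_1[of "int i"] by (auto simp: L_def)
    then have prod_L: "(\<Prod>i=1..n. L i) = 0" using i by (intro prod_zero) auto
    have "((\<lambda>z. det (scaled_minus z)) \<longlongrightarrow> det (1\<^sub>m k)) at_infinity"
      by (rule det_tendsto[where n = k]) (auto intro!: scaled_minus_tendsto simp del: index_one_mat)
    from tendsto_mult[OF this tendsto_prod[OF y_lim], of "\<lambda>i. i" "{1..n}"]
    have "((\<lambda>z. det (scaled_minus z) * (\<Prod>i=1..n. inverse z * y z i)) \<longlongrightarrow> 0) at_infinity"
      unfolding prod_L by simp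
    then show ?thesis
    proof (rule Lim_transform_eventually)
      show "eventually (\<lambda>z. det (scaled_minus z) * (\<Prod>i=1..n. inverse z * y z i) = F z) at_infinity"
        using eventually_exterior
      proof eventually_elim
        case (elim z)
        then have "z \<noteq> 0" by auto
        have "dim_col (tM z) = k" using tM(1)[of z] elim by auto
        then have "det (scaled_minus z) = z ^ n * det (tM z)"
          using elim by (simp add: scaled_minus_def n_def power_mult[symmetric] mult_ac)
        moreover have "(\<Prod>i=1..n. inverse z * y z i) = inverse z ^ n * (\<Prod>i=1..n. y z i)"
          by (simp add: prod.distrib)
        ultimately show ?case
          using elim \<open>z \<noteq> 0\<close> by (simp add: F_def power_inverse field_simps)
      qed
    qed
  qed
  ultimately have "F 0 = 0" by (rule Liouville_weak_0)
  \<comment> \<open>The points retained in \<open>x\<close> have modulus greater than 1, so none of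
    its factors vanishes at 0.\<close>
  moreover have "F 0 \<noteq> 0"
    using tP(2)[of 0] by (auto simp: F_def x_def)
  ultimately show False by simp
qed

text \<open>Periodicity carries \<open>poles_separated\<close> from one period to all indices; since
  the whole annulus is free of zeros and poles, the bound 1 improves to the radii of the
  contours.\<close>

lemma poles: "norm (pole_g i) < r_s" "r_l < norm (zero_b i)"
proof -
  have per: "av (i + int l) = av i" "bv (i + int l) = bv i" "gv (i + int l) = gv i" for i
    by (auto simp: av_def bv_def gv_def weight_periodic)
  define m where "m = nat ((i - 1) mod int l + 1)"
  have m: "int m = (i - 1) mod int l + 1" "m \<in> {1..l}"
    using mod_shift_range[OF l, of i] by (auto simp: m_def nat_le_iff le_nat_iff)
  have "zero_b (int m) = zero_b i" "pole_g (int m) = pole_g i"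
    using periodic_mod[of zero_b "int l" "i - 1" 1] periodic_mod[of pole_g "int l" "i - 1" 1]
    by (simp_all add: m(1) zero_b_def pole_g_def per)
  moreover have "m \<in> {1..n}" using m(2) l_le_n by auto
  ultimately have "norm (zero_b i) > 1" "norm (pole_g i) < 1" using poles_separated by metis+
  then show "norm (pole_g i) < r_s" "r_l < norm (zero_b i)"
    using poles_not_in_Ann[of i] r_s r_l by auto
qed

section \<open>The kernel as a right inverse on the lattice\<close>

lemma det_mat_prod_nonzero:
  assumes "z \<in> Ann" "u' \<le> u"
  shows "det (mat_prod k (\<phi> z) u' u) \<noteq> 0"
  using assms by (simp add: det_mat_prod det_\<phi>_nonzero del: mem_Collect_eq)

lemma det_Phi_nonzero:
  assumes "z \<in> Ann"
  shows "det (Phi k l \<alpha> \<beta> \<gamma> z) \<noteq> 0"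
  unfolding Phi_def by (rule det_mat_prod_nonzero[OF assms]) simp

lemma T_split:
  assumes "u \<ge> 0"
  shows "T u z = Phi k l \<alpha> \<beta> \<gamma> z ^\<^sub>m nat (u div (2 * int l)) * T (u mod (2 * int l)) z"
proof -
  define x where "x = nat (u div (2 * int l))"
  define i where "i = u mod (2 * int l)"
  have u: "u = 2 * int l * int x + i"
    using assms l by (simp add: x_def i_def pos_imp_zdiv_nonneg_iff)
  have i: "0 \<le> i" using l by (simp add: i_def)
  have "\<phi> z (m + 2 * int l * int x) = \<phi> z m" for m
    using periodic_shift[of "\<phi> z" "2 * int l" m "int x"] by (simp add: \<phi>_periodic)
  from mat_prod_shift[of "\<phi> z" "2 * int l * int x" k 0 i, OF this]
  have "mat_prod k (\<phi> z) (2 * int l * int x) (2 * int l * int x + i) = T i z"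
    by (simp add: add.commute)
  then have "T (2 * int l * int x + i) z = T (2 * int l * int x) z * T i z"
    using mat_prod_append[of "\<phi> z" k 0 "2 * int l * int x" "2 * int l * int x + i"] i by simp
  then show ?thesis
    unfolding T_pow using u unfolding x_def i_def by metis
qed

text \<open>Periodicity reassembles quotient and remainder of \<open>u\<close> into one partial
  product, so the kernel depends on its times only through \<open>T\<close>.\<close>

lemma minv_T:
  assumes z: "z \<in> Ann" and u: "u \<ge> 0"
  shows "minv (T (u mod (2 * int l)) z) * mat_powi (Phi k l \<alpha> \<beta> \<gamma> z) (- (u div (2 * int l))) = minv (T u z)"
proof -
  have "u div (2 * int l) = int (nat (u div (2 * int l)))"
    using u l by (simp add: pos_imp_zdiv_nonneg_iff)
  then have "mat_powi (Phi k l \<alpha> \<beta> \<gamma> z) (- (u div (2 * int l))) = minv (Phi k l \<alpha> \<beta> \<gamma> z ^\<^sub>m nat (u div (2 * int l)))"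
    using mat_powi_minus[OF Phi_carrier det_Phi_nonzero[OF z]] by metis
  moreover have "0 \<le> u mod (2 * int l)" using l by simp
  ultimately show ?thesis
    unfolding T_split[OF u]
    by (simp add: minv_mult[OF pow_carrier_mat[OF Phi_carrier] det_pow_mat_nonzero[OF Phi_carrier det_Phi_nonzero[OF z]]
          T_carrier det_mat_prod_nonzero[OF z]])
qed

text \<open>On \<open>Ann\<close> and for \<open>0 \<le> u \<le> 2 * int n\<close> this is the
  inverse of the remaining product of the factors \<open>u + 1\<close> to \<open>2 n\<close>.
  Written through \<open>T u\<close>, it inherits the recursion in \<open>u\<close> from the right
  end of the product.\<close>

definition V :: "int \<Rightarrow> complex \<Rightarrow> complex mat" where
  "V u z = minv (S z) * T u z"

lemma minv_S_carrier: "z \<in> Ann \<Longrightarrow> minv (S z) \<in> carrier_mat k k"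
  by (rule minv(1)[OF S_carrier det_S_nonzero])

lemma V_carrier: "z \<in> Ann \<Longrightarrow> V u z \<in> carrier_mat k k"
  unfolding V_def by (rule mult_carrier_mat[OF minv_S_carrier T_carrier])

text \<open>The exponent of \<Phi> is never positive in this range, so it stands for the inverse of
  the missing power \<open>y\<close>, and \<open>S\<close> splits as the product of the powers
  \<open>x\<close> and \<open>y\<close>.\<close>

lemma V_eq:
  assumes z: "z \<in> Ann" and u: "0 \<le> u" "u \<le> 2 * int n"
  shows "mat_powi (Phi k l \<alpha> \<beta> \<gamma> z) (u div (2 * int l) - int (k * N)) * T (u mod (2 * int l)) z = V u z"
proof -
  let ?\<Phi> = "Phi k l \<alpha> \<beta> \<gamma> z"
  define x where "x = nat (u div (2 * int l))"
  have x: "u div (2 * int l) = int x" using u l by (simp add: x_def pos_imp_zdiv_nonneg_iff)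
  have "u div (2 * int l) \<le> (2 * int n) div (2 * int l)" using u l by (intro zdiv_mono1) auto
  also have "\<dots> = int (k * N)" using l by (simp add: n_def)
  finally have xle: "x \<le> k * N" using x by linarith
  define y where "y = k * N - x"
  have xy: "k * N = x + y" using xle by (simp add: y_def)
  note dP = det_pow_mat_nonzero[OF Phi_carrier det_Phi_nonzero[OF z]]
  note cP = pow_carrier_mat[OF Phi_carrier[of z]]
  note mP = minv[OF cP dP]
  have "S z = ?\<Phi> ^\<^sub>m x * ?\<Phi> ^\<^sub>m y"
    unfolding path_symbol_def xy by (rule pow_mat_add[OF Phi_carrier])
  then have mS: "minv (S z) = minv (?\<Phi> ^\<^sub>m y) * minv (?\<Phi> ^\<^sub>m x)"
    using minv_mult[OF cP dP cP dP] by simp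
  have "V u z = minv (?\<Phi> ^\<^sub>m y) * minv (?\<Phi> ^\<^sub>m x) * (?\<Phi> ^\<^sub>m x * T (u mod (2 * int l)) z)"
    unfolding V_def mS T_split[OF u(1)] x_def ..
  also have "\<dots> = minv (?\<Phi> ^\<^sub>m y) * ((minv (?\<Phi> ^\<^sub>m x) * ?\<Phi> ^\<^sub>m x) * T (u mod (2 * int l)) z)"
    unfolding assoc_mult_mat[OF mP(1) cP T_carrier]
    by (rule assoc_mult_mat[OF mP(1) mP(1) mult_carrier_mat[OF cP T_carrier]])
  also have "\<dots> = minv (?\<Phi> ^\<^sub>m y) * T (u mod (2 * int l)) z"
    unfolding mP(3) left_mult_one_mat[OF T_carrier] ..
  also have "minv (?\<Phi> ^\<^sub>m y) = mat_powi ?\<Phi> (u div (2 * int l) - int (k * N))"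
    using mat_powi_minus[OF Phi_carrier det_Phi_nonzero[OF z], of y] x xy by simp
  finally show ?thesis ..
qed

abbreviation "Em \<equiv> extend_minus S tM tP"
abbreviation "Ep \<equiv> extend_plus S tM tP"

lemma Em_carrier: "Em z \<in> carrier_mat k k"
  using tM(1)[of z] minv(1)[OF tP(1)[of z] tP(2)[of z]]
  by (auto simp: extend_minus_def intro!: mult_carrier_mat[OF S_carrier])

lemma Ep_carrier: "Ep z \<in> carrier_mat k k"
  using tP(1)[of z] minv(1)[OF tM(1)[of z] tM(2)[of z]]
  by (auto simp: extend_plus_def intro!: mult_carrier_mat[OF _ S_carrier])

definition A :: "int \<Rightarrow> complex \<Rightarrow> complex mat" where
  "A u z = minv (T u z) * Em z"

lemma A_carrier: "z \<in> Ann \<Longrightarrow> u \<ge> 0 \<Longrightarrow> A u z \<in> carrier_mat k k"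
  unfolding A_def by (rule mult_carrier_mat[OF minv(1)[OF T_carrier det_mat_prod_nonzero] Em_carrier])

definition outer_fun :: "int \<Rightarrow> int \<Rightarrow> nat \<Rightarrow> complex \<Rightarrow> complex" where
  "outer_fun a' c' t z = A (2 * a' + 1) z $$ (nat (c' mod int k), t) * z powi (c' div int k)"

definition inner_fun :: "int \<Rightarrow> int \<Rightarrow> nat \<Rightarrow> complex \<Rightarrow> complex" where
  "inner_fun a c t w = periodic_entry k w (Ep w * V (2 * a) w) t c / w"

text \<open>For integers, the kernel's condition \<open>2 a > 2 a' + 1\<close> is
  \<open>a > a'\<close>.\<close>

definition single :: "int \<Rightarrow> int \<Rightarrow> complex \<Rightarrow> complex mat" where
  "single a' a z = (if a > a' then mat_prod k (\<phi> z) (2 * a' + 1) (2 * a) else 0\<^sub>m k k)"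

definition single_integral :: "int \<Rightarrow> int \<Rightarrow> int \<Rightarrow> int \<Rightarrow> complex" where
  "single_integral a c a' c' = contour_integral (circlepath 0 1) (\<lambda>z.
     periodic_entry k z (single a' a z) (nat (c' mod int k)) c * z powi (c' div int k) / z)"

abbreviation "double a c a' c' \<equiv> double_integral r_s r_l k (outer_fun a' c') (inner_fun a c)"

text \<open>The integrand separates: \<open>A\<close> contains all of \<open>z\<^sub>1\<close> and
  \<open>Ep * V\<close> all of \<open>z\<^sub>2\<close>, apart from the Cauchy kernel. The black
  vertex then enters the double integral through \<open>inner_fun\<close> alone.\<close>

lemma K_path_eq:
  assumes a: "0 \<le> a" "a \<le> int n" and a': "0 \<le> a'"
  shows "K_path k l N \<alpha> \<beta> \<gamma> tM tP r_s r_l (2 * a) c (2 * a' + 1) c' =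
    - single_integral a c a' c' / (2 * of_real pi * \<i>) + double a c a' c' / (2 * of_real pi * \<i>)\<^sup>2"
proof -
  define u where "u = 2 * a"
  define u' where "u' = 2 * a' + 1"
  define x y j x' y' j' i i' where defs: "x = u div (2 * int l)" "y = c div int k" "j = nat (c mod int k)"
    "x' = u' div (2 * int l)" "y' = c' div int k" "j' = nat (c' mod int k)"
    "i = u mod (2 * int l)" "i' = u' mod (2 * int l)"
  have j: "j < k" "j' < k" using k by (auto simp: defs nat_less_iff)
  have u: "0 \<le> u" "u \<le> 2 * int n" "0 \<le> u'" using a a' by (auto simp: u_def u'_def)
  let ?X1 = "\<lambda>z. mat_prod k (\<phi> z) u' u $$ (j', j) * z powi (y' - y) / z"
  let ?X2 = "\<lambda>z\<^sub>1 z\<^sub>2. (minv (T i' z\<^sub>1) * mat_powi (Phi k l \<alpha> \<beta> \<gamma> z\<^sub>1) (- x') * Em z\<^sub>1 * Ep z\<^sub>2 *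
      mat_powi (Phi k l \<alpha> \<beta> \<gamma> z\<^sub>2) (x - int (k * N)) * T i z\<^sub>2) $$ (j', j) *
      (z\<^sub>1 powi y' / z\<^sub>2 powi y) / (z\<^sub>2 * (z\<^sub>2 - z\<^sub>1))"
  have "(if u > u' then 1 else 0) * contour_integral (circlepath 0 1) ?X1 = single_integral a c a' c'"
  proof (cases "a > a'")
    case True
    have "contour_integral (circlepath 0 1) ?X1 = single_integral a c a' c'"
      unfolding single_integral_def
    proof (rule contour_integral_eq)
      fix z :: complex assume "z \<in> path_image (circlepath 0 1)"
      then have "z \<noteq> 0" by auto
      then show "?X1 z = periodic_entry k z (single a' a z) (nat (c' mod int k)) c * z powi (c' div int k) / z"
        using True power_int_add[of z "- y" y']
        by (simp add: periodic_entry_def single_def u_def u'_def defs)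
    qed
    then show ?thesis using True by (simp add: u_def u'_def)
  next
    case False
    have "single_integral a c a' c' = contour_integral (circlepath 0 1) (\<lambda>_. 0)"
      unfolding single_integral_def using False j
      by (intro contour_integral_eq) (simp add: periodic_entry_def single_def defs)
    then show ?thesis using False by (simp add: u_def u'_def)
  qed
  moreover have "contour_integral (circlepath 0 r_s) (\<lambda>z\<^sub>1. contour_integral (circlepath 0 r_l) (?X2 z\<^sub>1)) = double a c a' c'"
    unfolding double_integral_def
  proof (intro contour_integral_eq)
    fix z w assume "z \<in> path_image (circlepath 0 r_s)" "w \<in> path_image (circlepath 0 r_l)"
    then have zw: "z \<in> Ann" "w \<in> Ann" using r_s r_l by auto
    have w0: "w \<noteq> 0" by (rule Ann_nonzero[OF zw(2)])
    have cA: "A u' z \<in> carrier_mat k k" by (rule A_carrier[OF zw(1) u(3)])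
    have cV: "V u w \<in> carrier_mat k k" by (rule V_carrier[OF zw(2)])
    have cE: "Ep w * V u w \<in> carrier_mat k k" by (rule mult_carrier_mat[OF Ep_carrier cV])
    have cT: "T i w \<in> carrier_mat k k" by simp
    have cm: "mat_powi (Phi k l \<alpha> \<beta> \<gamma> w) (x - int (k * N)) \<in> carrier_mat k k"
      using minv(1)[OF Phi_carrier det_Phi_nonzero[OF zw(2)]] by (simp add: mat_powi_def)
    have "minv (T i' z) * mat_powi (Phi k l \<alpha> \<beta> \<gamma> z) (- x') * Em z = A u' z"
      using minv_T[OF zw(1) u(3)] by (simp add: A_def defs)
    then have "minv (T i' z) * mat_powi (Phi k l \<alpha> \<beta> \<gamma> z) (- x') * Em z * Ep w *
        mat_powi (Phi k l \<alpha> \<beta> \<gamma> w) (x - int (k * N)) * T i w =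
        A u' z * (Ep w * (mat_powi (Phi k l \<alpha> \<beta> \<gamma> w) (x - int (k * N)) * T i w))"
      using cA Ep_carrier[of w] cm cT by (simp add: assoc_mult_mat[of _ k k _ k _ k])
    also have "mat_powi (Phi k l \<alpha> \<beta> \<gamma> w) (x - int (k * N)) * T i w = V u w"
      using V_eq[OF zw(2) u(1,2)] by (simp add: defs)
    finally have X2: "?X2 z w = (\<Sum>t<k. A u' z $$ (j', t) * (Ep w * V u w) $$ (t, j)) *
        (z powi y' / w powi y) / (w * (w - z))"
      using index_mult_mat_sum[OF cA cE j(2,1)] by simp
    show "?X2 z w = (\<Sum>t<k. outer_fun a' c' t z * (inner_fun a c t w / (w - z)))"
      unfolding X2 outer_fun_def inner_fun_def periodic_entry_def sum_distrib_right sum_divide_distrib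
      using w0 by (intro sum.cong refl) (simp add: u_def u'_def defs power_int_minus field_simps)
  qed
  ultimately show ?thesis
    unfolding K_path_def Let_def u_def[symmetric] u'_def[symmetric] defs[symmetric]
    by (simp add: field_simps)
qed

section \<open>The recursion in matrix form\<close>

text \<open>The inverse of the \<open>i\<close>-th \<open>phi_g\<close>, see
  \<open>phi_b_mult_geom_mat\<close>. Its bidiagonal form produces the edges with weights \<beta>
  and -1.\<close>

definition Bm :: "int \<Rightarrow> complex \<Rightarrow> complex mat" where
  "Bm i z = phi_b k (\<lambda>j. - bv i j) (\<lambda>_. 1) z"

lemma Bm_carrier [simp]: "Bm i z \<in> carrier_mat k k"
  by (simp add: Bm_def)

lemma Ann_not_poles: "z \<in> Ann \<Longrightarrow> z \<noteq> zero_b i" "z \<in> Ann \<Longrightarrow> z \<noteq> pole_g i"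
  using poles_not_in_Ann by metis+

lemma \<phi>_even_Bm:
  assumes z: "z \<in> Ann"
  shows "Bm i z * \<phi> z (2 * i) = 1\<^sub>m k" "\<phi> z (2 * i) * Bm i z = 1\<^sub>m k"
proof -
  have "Bm i z * geom_mat k (bv i) z = 1\<^sub>m k"
    unfolding Bm_def using phi_b_mult_geom_mat[OF k Ann_nonzero[OF z]] Ann_not_poles(2)[OF z]
    by (simp add: pole_g_def)
  then show "Bm i z * \<phi> z (2 * i) = 1\<^sub>m k"
    unfolding \<phi>_even phi_g_eq_geom_mat[OF Ann_nonzero[OF z]] .
  then show "\<phi> z (2 * i) * Bm i z = 1\<^sub>m k"
    by (rule mat_mult_left_right_inverse[OF Bm_carrier \<phi>_carrier])
qed

definition \<phi>_inv :: "int \<Rightarrow> complex \<Rightarrow> complex mat" where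
  "\<phi>_inv i z = phi_b_inv k (av i) (gv i) z"

lemma \<phi>_inv_carrier [simp]: "\<phi>_inv i z \<in> carrier_mat k k"
  by (simp add: \<phi>_inv_def)

lemma \<phi>_odd_inv:
  assumes z: "z \<in> Ann"
  shows "\<phi>_inv i z * \<phi> z (2 * i - 1) = 1\<^sub>m k"
proof (rule mat_mult_left_right_inverse[OF \<phi>_carrier \<phi>_inv_carrier])
  show "\<phi> z (2 * i - 1) * \<phi>_inv i z = 1\<^sub>m k"
    unfolding \<phi>_odd \<phi>_inv_def using Ann_not_poles(1)[OF z, of i]
    by (intro phi_b_mult_inv k gv_nonzero Ann_nonzero[OF z]) (simp add: zero_b_def)
qed

lemma zero_b_not_in_cball: "zero_b i \<notin> cball 0 r_l"
  using poles(2)[of i] by simp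

text \<open>Inverting \<open>phi_b\<close> and \<open>phi_g\<close> pairwise leaves no singularity
  at the origin, and by \<open>poles\<close> the points \<open>zero_b\<close> lie beyond
  \<open>r_l\<close>. The product identity is claimed on the annulus only, where the transition
  matrices are regular; \<open>F\<close> is the continuation of the inverse into the disc.\<close>

lemma block_inverse:
  assumes "a \<le> c"
  shows "\<exists>F. holomorphic_mat k F (cball 0 r_l) \<and>
    (\<forall>z\<in>Ann. F z * mat_prod k (\<phi> z) (2 * a) (2 * c) = 1\<^sub>m k)"
  using assms
proof (induction c rule: int_ge_induct)
  case base
  then show ?case by (intro exI[of _ "\<lambda>_. 1\<^sub>m k"]) (simp add: holomorphic_mat_one)
next
  case (step c)
  then obtain F where F: "holomorphic_mat k F (cball 0 r_l)"
    "\<And>z. z \<in> Ann \<Longrightarrow> F z * mat_prod k (\<phi> z) (2 * a) (2 * c) = 1\<^sub>m k" by metis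
  define R where "R = step_inv k (av (c + 1)) (bv (c + 1)) (gv (c + 1))"
  have R: "holomorphic_mat k R (cball 0 r_l)"
    unfolding R_def using zero_b_not_in_cball[of "c + 1"] unfolding zero_b_def by (rule step_inv_holomorphic)
  have "(R z * F z) * mat_prod k (\<phi> z) (2 * a) (2 * (c + 1)) = 1\<^sub>m k" if z: "z \<in> Ann" for z
  proof -
    let ?M = "mat_prod k (\<phi> z) (2 * a) (2 * c)"
    let ?o = "\<phi> z (2 * (c + 1) - 1)" and ?e = "\<phi> z (2 * (c + 1))"
    have cF: "F z \<in> carrier_mat k k" and cR: "R z \<in> carrier_mat k k"
      using F(1) R z by (auto simp: holomorphic_mat_def)
    have cM: "?M \<in> carrier_mat k k" by simp
    have "mat_prod k (\<phi> z) (2 * a) (2 * c + 1 + 1) = ?M * ?o * ?e"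
      using mat_prod_snoc[of "\<phi> z" k "2 * a" "2 * c"] mat_prod_snoc[of "\<phi> z" k "2 * a" "2 * c + 1"] step
      by (simp add: algebra_simps)
    then have "(R z * F z) * mat_prod k (\<phi> z) (2 * a) (2 * (c + 1)) = (R z * F z) * (?M * ?o * ?e)"
      by (simp add: algebra_simps)
    also have "\<dots> = R z * ((F z * ?M) * (?o * ?e))"
      using cF cR cM \<phi>_carrier[of z "2 * (c + 1) - 1"] \<phi>_carrier[of z "2 * (c + 1)"]
      by (simp only: assoc_mult_mat[of _ k k _ k _ k] mult_carrier_mat[of _ k k _ k])
    also have "\<dots> = R z * (?o * ?e)"
      unfolding F(2)[OF z] by (simp add: left_mult_one_mat[OF mult_carrier_mat[OF \<phi>_carrier \<phi>_carrier]])
    also have "\<dots> = Bm (c + 1) z * \<phi>_inv (c + 1) z * (?o * ?e)"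
      unfolding R_def Bm_def \<phi>_inv_def step_inv_eq[OF k Ann_nonzero[OF z]] ..
    also have "Bm (c + 1) z * \<phi>_inv (c + 1) z * (?o * ?e) = Bm (c + 1) z * ((\<phi>_inv (c + 1) z * ?o) * ?e)"
      using Bm_carrier[of "c + 1" z] \<phi>_inv_carrier[of "c + 1" z] \<phi>_carrier[of z "2 * (c + 1) - 1"] \<phi>_carrier[of z "2 * (c + 1)"]
      by (simp only: assoc_mult_mat[of _ k k _ k _ k] mult_carrier_mat[of _ k k _ k])
    also have "\<dots> = 1\<^sub>m k"
      unfolding \<phi>_odd_inv[OF z] left_mult_one_mat[OF \<phi>_carrier] by (rule \<phi>_even_Bm(1)[OF z])
    finally show ?thesis .
  qed
  then show ?case
    by (intro exI[of _ "\<lambda>z. R z * F z"] conjI ballI holomorphic_mat_mult[OF R F(1)])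
qed

text \<open>The starting point is kept general: \<open>u = 0\<close> serves the double integral,
  \<open>u = 2 a' + 1\<close> the single one.\<close>

lemma mat_prod_step:
  assumes z: "z \<in> Ann" and "u \<le> 2 * a"
  shows "mat_prod k (\<phi> z) u (2 * (a + 1)) * Bm (a + 1) z =
    mat_prod k (\<phi> z) u (2 * a) * phi_b k (av (a + 1)) (gv (a + 1)) z"
proof -
  let ?M = "mat_prod k (\<phi> z) u (2 * a)"
  let ?o = "\<phi> z (2 * a + 1)" and ?e = "\<phi> z (2 * (a + 1))"
  have cM: "?M \<in> carrier_mat k k" by simp
  have cMo: "?M * ?o \<in> carrier_mat k k" by (rule mult_carrier_mat[OF cM \<phi>_carrier])
  have "mat_prod k (\<phi> z) u (2 * a + 1 + 1) = ?M * ?o * ?e"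
    using mat_prod_snoc[of "\<phi> z" k u "2 * a"] mat_prod_snoc[of "\<phi> z" k u "2 * a + 1"] assms
    by (simp add: algebra_simps)
  then have "mat_prod k (\<phi> z) u (2 * (a + 1)) * Bm (a + 1) z = ?M * ?o * ?e * Bm (a + 1) z"
    by (simp add: algebra_simps)
  also have "\<dots> = ?M * ?o"
    unfolding assoc_mult_mat[OF cMo \<phi>_carrier Bm_carrier] \<phi>_even_Bm(2)[OF z] by (rule right_mult_one_mat[OF cMo])
  finally show ?thesis by (simp add: \<phi>_odd')
qed

lemma V_step:
  assumes z: "z \<in> Ann" and "0 \<le> a"
  shows "V (2 * (a + 1)) z * Bm (a + 1) z = V (2 * a) z * phi_b k (av (a + 1)) (gv (a + 1)) z"
  unfolding V_def assoc_mult_mat[OF minv_S_carrier[OF z] T_carrier Bm_carrier]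
    assoc_mult_mat[OF minv_S_carrier[OF z] T_carrier phi_b_carrier]
  using mat_prod_step[OF z, of 0 a] assms by simp

lemma periodic_entry_Bm:
  assumes "Y \<in> carrier_mat k k" "r < k" "z \<noteq> 0"
  shows "periodic_entry k z (Y * Bm i z) r c =
    periodic_entry k z Y r c - complex_of_real (\<beta> (c + 1) i) * periodic_entry k z Y r (c + 1)"
  unfolding Bm_def bv_def
  using periodic_entry_mult_phi_b[OF k assms, of "\<lambda>j. - complex_of_real (\<beta> j i)" "\<lambda>_. 1"]
  by (simp add: weight_periodic)

lemma periodic_entry_phi_b:
  assumes "Y \<in> carrier_mat k k" "r < k" "z \<noteq> 0"
  shows "periodic_entry k z (Y * phi_b k (av i) (gv i) z) r c =
    complex_of_real (\<gamma> (c + 1) i) * periodic_entry k z Y r c +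
    complex_of_real (\<alpha> (c + 1) i) * periodic_entry k z Y r (c + 1)"
  unfolding av_def gv_def
  by (rule periodic_entry_mult_phi_b[OF k assms]) (simp_all add: weight_periodic)

section \<open>Regularity of the integrands\<close>

lemma mat_prod_holomorphic:
  assumes u: "0 \<le> u'" "u' \<le> u" and X: "0 \<notin> X" "\<And>i. i \<in> {0..u} \<Longrightarrow> pole_g i \<notin> X"
  shows "holomorphic_mat k (\<lambda>z. mat_prod k (\<phi> z) u' u) X"
proof (rule holomorphic_mat_prod[OF _ \<phi>_carrier u(2)])
  fix m assume m: "m \<in> {u' + 1..u}"
  show "holomorphic_mat k (\<lambda>z. \<phi> z m) X"
  proof (rule \<phi>_cases[of m])
    fix i assume "m = 2 * i - 1"
    then show ?thesis by (simp only: \<phi>_odd phi_b_holomorphic[OF X(1)])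
  next
    fix i assume mi: "m = 2 * i"
    then have "pole_g i \<notin> X" using m u by (intro X) auto
    then show ?thesis unfolding mi \<phi>_even pole_g_def by (rule phi_g_holomorphic[OF X(1)])
  qed
qed

lemma mat_prod_holomorphic_Ann:
  "0 \<le> u' \<Longrightarrow> u' \<le> u \<Longrightarrow> holomorphic_mat k (\<lambda>z. mat_prod k (\<phi> z) u' u) Ann"
  by (rule mat_prod_holomorphic) (use poles_not_in_Ann Ann_nonzero in blast)+

lemma mat_prod_holomorphic_exterior:
  "0 \<le> u' \<Longrightarrow> u' \<le> u \<Longrightarrow> holomorphic_mat k (\<lambda>z. mat_prod k (\<phi> z) u' u) {z. r_s < norm z}"
  using poles(1) r_s by (intro mat_prod_holomorphic) (auto simp: not_less less_imp_le)

lemma S_holomorphic: "holomorphic_mat k S {z. r_s < norm z}" "holomorphic_mat k S Ann"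
  unfolding S_eq by (rule mat_prod_holomorphic_exterior mat_prod_holomorphic_Ann; simp)+

lemma minv_T_holomorphic: "0 \<le> u \<Longrightarrow> holomorphic_mat k (\<lambda>z. minv (T u z)) Ann"
  by (rule minv_holomorphic[OF mat_prod_holomorphic_Ann det_mat_prod_nonzero]) auto

lemma V_holomorphic: "0 \<le> u \<Longrightarrow> holomorphic_mat k (V u) Ann"
  unfolding V_def
  by (rule holomorphic_mat_mult[OF minv_holomorphic[OF S_holomorphic(2) det_S_nonzero] mat_prod_holomorphic_Ann]) auto

lemma spheres_subset: "sphere 0 r_s \<subseteq> Ann" "sphere 0 r_l \<subseteq> Ann" "sphere 0 1 \<subseteq> Ann"
  using r_s r_l by auto

text \<open>On the small circle only the branch \<open>S * minv tP\<close> of \<open>Em\<close>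
  occurs; likewise \<open>inner_fun\<close> meets only the branch \<open>minv tM * S\<close> of
  \<open>Ep\<close> on the large one.\<close>

lemma outer_fun_continuous:
  assumes "t < k" "0 \<le> a'"
  shows "continuous_on (sphere 0 r_s) (outer_fun a' c' t)"
proof -
  have "holomorphic_mat k (\<lambda>z. minv (tP z)) (ball 0 1)"
    by (rule minv_holomorphic[OF tP(3)]) (use tP(2) in auto)
  then have mP: "continuous_mat k (\<lambda>z. minv (tP z)) (sphere 0 r_s)"
    using r_s by (intro continuous_mat_subset[OF holomorphic_mat_imp_continuous_mat]) auto
  have "continuous_mat k (\<lambda>z. S z * minv (tP z)) (sphere 0 r_s)"
    by (rule continuous_mat_mult[OF continuous_mat_subset[OF holomorphic_mat_imp_continuous_mat[OF S_holomorphic(2)] spheres_subset(1)] mP])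
  then have Em: "continuous_mat k Em (sphere 0 r_s)"
    by (rule continuous_mat_cong[THEN iffD1, rotated]) (use r_s in \<open>simp add: extend_minus_def\<close>)
  have mT: "continuous_mat k (\<lambda>z. minv (T (2 * a' + 1) z)) (sphere 0 r_s)"
    using minv_T_holomorphic[of "2 * a' + 1"] assms
    by (intro continuous_mat_subset[OF holomorphic_mat_imp_continuous_mat spheres_subset(1)]) simp
  have "continuous_mat k (A (2 * a' + 1)) (sphere 0 r_s)"
    unfolding A_def by (rule continuous_mat_mult[OF mT Em])
  moreover have "nat (c' mod int k) < k" using k by (simp add: nat_less_iff)
  ultimately show ?thesis
    using assms r_s unfolding outer_fun_def continuous_mat_def
    by (intro continuous_intros) auto
qed

lemma inner_fun_continuous:
  assumes "t < k" "0 \<le> a"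
  shows "continuous_on (sphere 0 r_l) (inner_fun a c t)"
proof -
  have mM: "continuous_mat k (\<lambda>z. minv (tM z)) (sphere 0 r_l)"
    using r_l by (intro continuous_mat_subset[OF tM(6)]) auto
  have "continuous_mat k (\<lambda>z. minv (tM z) * S z) (sphere 0 r_l)"
    by (rule continuous_mat_mult[OF mM continuous_mat_subset[OF holomorphic_mat_imp_continuous_mat[OF S_holomorphic(2)] spheres_subset(2)]])
  then have Ep: "continuous_mat k Ep (sphere 0 r_l)"
    by (rule continuous_mat_cong[THEN iffD1, rotated]) (use r_l in \<open>simp add: extend_plus_def\<close>)
  have V: "continuous_mat k (V (2 * a)) (sphere 0 r_l)"
    using V_holomorphic[of "2 * a"] assms
    by (intro continuous_mat_subset[OF holomorphic_mat_imp_continuous_mat spheres_subset(2)]) simp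
  have "0 \<notin> sphere (0::complex) r_l" using r_l by simp
  from continuous_on_periodic_entry[OF continuous_mat_mult[OF Ep V] this assms(1), of c]
  show ?thesis
    unfolding inner_fun_def using r_l by (intro continuous_intros) auto
qed

section \<open>The four-term recursion for the integrals\<close>

lemma inner_fun_rec:
  assumes "t < k" "0 \<le> a" "norm w = r_l"
  shows "inner_fun (a + 1) c t w - complex_of_real (\<beta> (c + 1) (a + 1)) * inner_fun (a + 1) (c + 1) t w =
    complex_of_real (\<gamma> (c + 1) (a + 1)) * inner_fun a c t w +
    complex_of_real (\<alpha> (c + 1) (a + 1)) * inner_fun a (c + 1) t w"
proof -
  have w: "w \<in> Ann" using assms r_s r_l by simp
  note cV = V_carrier[OF w] and cE = Ep_carrier
  have eq: "(Ep w * V (2 * (a + 1)) w) * Bm (a + 1) w = (Ep w * V (2 * a) w) * phi_b k (av (a + 1)) (gv (a + 1)) w"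
    unfolding assoc_mult_mat[OF cE cV Bm_carrier] assoc_mult_mat[OF cE cV phi_b_carrier] V_step[OF w assms(2)] ..
  have "periodic_entry k w (Ep w * V (2 * (a + 1)) w) t c
      - complex_of_real (\<beta> (c + 1) (a + 1)) * periodic_entry k w (Ep w * V (2 * (a + 1)) w) t (c + 1) =
    complex_of_real (\<gamma> (c + 1) (a + 1)) * periodic_entry k w (Ep w * V (2 * a) w) t c +
    complex_of_real (\<alpha> (c + 1) (a + 1)) * periodic_entry k w (Ep w * V (2 * a) w) t (c + 1)"
    using arg_cong[OF eq, of "\<lambda>Y. periodic_entry k w Y t c"]
    unfolding periodic_entry_Bm[OF mult_carrier_mat[OF cE cV] assms(1) Ann_nonzero[OF w]]
      periodic_entry_phi_b[OF mult_carrier_mat[OF cE cV] assms(1) Ann_nonzero[OF w]] .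
  then show ?thesis
    unfolding inner_fun_def times_divide_eq_right add_divide_distrib[symmetric] diff_divide_distrib[symmetric]
    by simp
qed

text \<open>Neither the outer function nor the Cauchy kernel involves \<open>a\<close> or
  \<open>c\<close>, so the pointwise relation passes through both integrals by linearity, without a
  source term.\<close>

lemma double_rec:
  assumes a: "0 \<le> a" and a': "0 \<le> a'"
  shows "double (a + 1) c a' c' - complex_of_real (\<beta> (c + 1) (a + 1)) * double (a + 1) (c + 1) a' c' =
    complex_of_real (\<gamma> (c + 1) (a + 1)) * double a c a' c' +
    complex_of_real (\<alpha> (c + 1) (a + 1)) * double a (c + 1) a' c'"
proof -
  have rr: "r_s < r_l" using r_s r_l by simp
  note cont = outer_fun_continuous[OF _ a'] inner_fun_continuous
  have lin: "double_integral r_s r_l k (outer_fun a' c') (\<lambda>t w. p * inner_fun x c\<^sub>1 t w + q * inner_fun x c\<^sub>2 t w) =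
    p * double x c\<^sub>1 a' c' + q * double x c\<^sub>2 a' c'" if "0 \<le> x" for p q x c\<^sub>1 c\<^sub>2
  proof -
    have "double_integral r_s r_l k (outer_fun a' c') (\<lambda>t w. p * inner_fun x c\<^sub>1 t w + q * inner_fun x c\<^sub>2 t w) =
      double_integral r_s r_l k (outer_fun a' c') (\<lambda>t w. p * inner_fun x c\<^sub>1 t w) +
      double_integral r_s r_l k (outer_fun a' c') (\<lambda>t w. q * inner_fun x c\<^sub>2 t w)"
      by (intro double_integral_add r_s rr continuous_on_mult continuous_on_const cont that)
    also have "\<dots> = p * double x c\<^sub>1 a' c' + q * double x c\<^sub>2 a' c'"
      by (intro arg_cong2[where f = "(+)"] double_integral_cmult r_s rr cont that)
    finally show ?thesis .
  qed
  have "double_integral r_s r_l k (outer_fun a' c') (\<lambda>t w. 1 * inner_fun (a + 1) c t w +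
      (- complex_of_real (\<beta> (c + 1) (a + 1))) * inner_fun (a + 1) (c + 1) t w) =
    double_integral r_s r_l k (outer_fun a' c') (\<lambda>t w. complex_of_real (\<gamma> (c + 1) (a + 1)) * inner_fun a c t w +
      complex_of_real (\<alpha> (c + 1) (a + 1)) * inner_fun a (c + 1) t w)"
  proof (rule double_integral_cong[OF r_s(1)])
    fix t and w :: complex assume "t < k" "norm w = r_l"
    from inner_fun_rec[OF this(1) a this(2), of c]
    show "1 * inner_fun (a + 1) c t w +
        (- complex_of_real (\<beta> (c + 1) (a + 1))) * inner_fun (a + 1) (c + 1) t w =
      complex_of_real (\<gamma> (c + 1) (a + 1)) * inner_fun a c t w +
        complex_of_real (\<alpha> (c + 1) (a + 1)) * inner_fun a (c + 1) t w" by simp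
  qed (use r_l in simp)
  moreover have "0 \<le> a + 1" using a by simp
  ultimately show ?thesis
    unfolding lin[OF a] lin[OF \<open>0 \<le> a + 1\<close>] by simp
qed

lemma single_carrier [simp]: "single a' a z \<in> carrier_mat k k"
  by (simp add: single_def)

text \<open>At \<open>a = a'\<close> the indicator switches on: the product at \<open>a\<close> is
  replaced by zero, while the one at \<open>a + 1\<close> consists of a single \<open>phi_g\<close>,
  which \<open>Bm\<close> inverts. The resulting identity matrix is the source of the delta.\<close>

lemma single_step:
  assumes z: "z \<in> Ann"
  shows "single a' (a + 1) z * Bm (a + 1) z =
    single a' a z * phi_b k (av (a + 1)) (gv (a + 1)) z + (if a = a' then 1\<^sub>m k else 0\<^sub>m k k)"
proof -
  consider "a > a'" | "a = a'" | "a < a'" by linarith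
  then show ?thesis
  proof cases
    case 1
    then have "single a' (a + 1) z * Bm (a + 1) z = single a' a z * phi_b k (av (a + 1)) (gv (a + 1)) z"
      unfolding single_def using mat_prod_step[OF z, of "2 * a' + 1" a] by simp
    then show ?thesis
      using 1 right_add_zero_mat[OF mult_carrier_mat[OF single_carrier phi_b_carrier]] by simp
  next
    case 2
    have "mat_prod k (\<phi> z) (2 * a + 1) (2 * a + 1 + 1) = \<phi> z (2 * a + 1 + 1)"
      by (rule mat_prod_single[OF \<phi>_carrier])
    then have "single a' (a + 1) z = \<phi> z (2 * (a + 1))"
      using 2 by (simp add: single_def algebra_simps)
    then show ?thesis
      using 2 \<phi>_even_Bm(2)[OF z, of "a + 1"] left_mult_zero_mat[OF phi_b_carrier]
      by (simp add: single_def)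
  next
    case 3
    then show ?thesis
      by (simp add: single_def left_mult_zero_mat[OF phi_b_carrier] left_mult_zero_mat[OF Bm_carrier])
  qed
qed

lemma single_integrable:
  assumes "0 \<le> a'"
  shows "(\<lambda>z. periodic_entry k z (single a' a z) (nat (c' mod int k)) c * z powi (c' div int k) / z)
    contour_integrable_on circlepath 0 1"
proof -
  have j: "nat (c' mod int k) < k" using k by (simp add: nat_less_iff)
  have "continuous_mat k (single a' a) (sphere 0 1)"
  proof (cases "a > a'")
    case True
    then show ?thesis
      unfolding single_def using assms
      by (auto intro!: continuous_mat_subset[OF holomorphic_mat_imp_continuous_mat spheres_subset(3)] mat_prod_holomorphic_Ann)
  next
    case False
    then show ?thesis by (simp add: single_def continuous_mat_def)
  qed
  from continuous_on_periodic_entry[OF this _ j, of c] show ?thesis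
    by (intro contour_integrable_continuous_circlepath) (auto intro!: continuous_intros)
qed

text \<open>The extra identity matrix fixes the residue of \<open>c\<close> modulo \<open>k\<close>,
  and the integral of the remaining power of \<open>z\<close> fixes the quotient; together they
  force \<open>c = c'\<close>.\<close>

lemma single_rec:
  assumes a': "0 \<le> a'"
  shows "single_integral (a + 1) c a' c' - complex_of_real (\<beta> (c + 1) (a + 1)) * single_integral (a + 1) (c + 1) a' c' =
    complex_of_real (\<gamma> (c + 1) (a + 1)) * single_integral a c a' c' +
    complex_of_real (\<alpha> (c + 1) (a + 1)) * single_integral a (c + 1) a' c' +
    (if a = a' \<and> c = c' then 2 * of_real pi * \<i> else 0)"
proof -
  define j' y' where "j' = nat (c' mod int k)" and "y' = c' div int k"
  have j': "j' < k" using k by (simp add: nat_less_iff j'_def)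
  let ?f = "\<lambda>a c z. periodic_entry k z (single a' a z) j' c * z powi y' / z"
  let ?D = "\<lambda>z. periodic_entry k z (if a = a' then 1\<^sub>m k else 0\<^sub>m k k) j' c * z powi y' / z"
  note int = single_integrable[OF a', of _ c', folded j'_def y'_def]
  have "contour_integral (circlepath 0 1) ?D = (if a = a' \<and> c = c' then 2 * of_real pi * \<i> else 0)"
  proof -
    have j: "nat (c mod int k) < k" using k by (simp add: nat_less_iff)
    define e :: complex where "e = (if a = a' \<and> nat (c mod int k) = j' then 1 else 0)"
    have "contour_integral (circlepath 0 1) ?D = contour_integral (circlepath 0 1) (\<lambda>z. e * (z powi (y' - c div int k) / z))"
    proof (rule contour_integral_eq)
      fix z :: complex assume "z \<in> path_image (circlepath 0 1)"
      then have "z \<noteq> 0" by auto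
      then show "?D z = e * (z powi (y' - c div int k) / z)"
        using j j' power_int_add[of z "- (c div int k)" y'] by (auto simp: periodic_entry_def e_def)
    qed
    also have "\<dots> = e * contour_integral (circlepath 0 1) (\<lambda>z. z powi (y' - c div int k) / z)"
      by (intro contour_integral_lmul contour_integrable_continuous_circlepath)
         (auto intro!: continuous_intros)
    also have "\<dots> = e * (if y' - c div int k = 0 then 2 * of_real pi * \<i> else 0)"
      by (simp only: contour_integral_powi)
    also have "\<dots> = (if a = a' \<and> c = c' then 2 * of_real pi * \<i> else 0)"
    proof -
      have "c = c' \<longleftrightarrow> nat (c mod int k) = j' \<and> y' = c div int k"
      proof
        assume "nat (c mod int k) = j' \<and> y' = c div int k"
        then have "c mod int k = c' mod int k" "c div int k = c' div int k"
          using k by (auto simp: j'_def y'_def eq_nat_nat_iff)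
        then show "c = c'" using div_mult_mod_eq[of c "int k"] div_mult_mod_eq[of c' "int k"] by metis
      qed (simp add: j'_def y'_def)
      then show ?thesis by (auto simp: e_def)
    qed
    finally show ?thesis .
  qed
  moreover have "contour_integral (circlepath 0 1) (\<lambda>z. ?f (a + 1) c z - complex_of_real (\<beta> (c + 1) (a + 1)) * ?f (a + 1) (c + 1) z) =
    contour_integral (circlepath 0 1) (\<lambda>z. complex_of_real (\<gamma> (c + 1) (a + 1)) * ?f a c z +
      complex_of_real (\<alpha> (c + 1) (a + 1)) * ?f a (c + 1) z + ?D z)"
  proof (rule contour_integral_eq)
    fix z :: complex assume "z \<in> path_image (circlepath 0 1)"
    then have z: "z \<in> Ann" using r_s r_l by simp
    note z0 = Ann_nonzero[OF z]
    have "periodic_entry k z (single a' (a + 1) z) j' c -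
        complex_of_real (\<beta> (c + 1) (a + 1)) * periodic_entry k z (single a' (a + 1) z) j' (c + 1) =
      complex_of_real (\<gamma> (c + 1) (a + 1)) * periodic_entry k z (single a' a z) j' c +
      complex_of_real (\<alpha> (c + 1) (a + 1)) * periodic_entry k z (single a' a z) j' (c + 1) +
      periodic_entry k z (if a = a' then 1\<^sub>m k else 0\<^sub>m k k) j' c"
      unfolding periodic_entry_Bm[OF single_carrier j' z0, symmetric] single_step[OF z]
      by (subst periodic_entry_add[OF mult_carrier_mat[OF single_carrier phi_b_carrier] _ j'])
         (auto simp: periodic_entry_phi_b[OF single_carrier j' z0])
    then have "(periodic_entry k z (single a' (a + 1) z) j' c -
        complex_of_real (\<beta> (c + 1) (a + 1)) * periodic_entry k z (single a' (a + 1) z) j' (c + 1)) * (z powi y' / z) =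
      (complex_of_real (\<gamma> (c + 1) (a + 1)) * periodic_entry k z (single a' a z) j' c +
      complex_of_real (\<alpha> (c + 1) (a + 1)) * periodic_entry k z (single a' a z) j' (c + 1) +
      periodic_entry k z (if a = a' then 1\<^sub>m k else 0\<^sub>m k k) j' c) * (z powi y' / z)" by simp
    then show "?f (a + 1) c z - complex_of_real (\<beta> (c + 1) (a + 1)) * ?f (a + 1) (c + 1) z =
      complex_of_real (\<gamma> (c + 1) (a + 1)) * ?f a c z +
      complex_of_real (\<alpha> (c + 1) (a + 1)) * ?f a (c + 1) z + ?D z"
      by (simp add: left_diff_distrib distrib_right add_divide_distrib diff_divide_distrib mult.assoc)
  qed
  moreover have "contour_integral (circlepath 0 1) (\<lambda>z. ?f (a + 1) c z - complex_of_real (\<beta> (c + 1) (a + 1)) * ?f (a + 1) (c + 1) z) =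
    single_integral (a + 1) c a' c' - complex_of_real (\<beta> (c + 1) (a + 1)) * single_integral (a + 1) (c + 1) a' c'"
    unfolding single_integral_def j'_def[symmetric] y'_def[symmetric]
    by (simp only: contour_integral_diff contour_integral_lmul contour_integrable_lmul int)
  moreover have "?D contour_integrable_on circlepath 0 1"
  proof -
    have "continuous_mat k (\<lambda>_. if a = a' then 1\<^sub>m k else 0\<^sub>m k k) (sphere 0 1)"
      by (simp add: continuous_mat_def)
    from continuous_on_periodic_entry[OF this _ j', of c] show ?thesis
      by (intro contour_integrable_continuous_circlepath) (auto intro!: continuous_intros)
  qed
  then have "contour_integral (circlepath 0 1) (\<lambda>z. complex_of_real (\<gamma> (c + 1) (a + 1)) * ?f a c z +
      complex_of_real (\<alpha> (c + 1) (a + 1)) * ?f a (c + 1) z + ?D z) =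
    complex_of_real (\<gamma> (c + 1) (a + 1)) * single_integral a c a' c' +
    complex_of_real (\<alpha> (c + 1) (a + 1)) * single_integral a (c + 1) a' c' + contour_integral (circlepath 0 1) ?D"
    unfolding single_integral_def j'_def[symmetric] y'_def[symmetric]
    by (simp only: contour_integral_add contour_integral_lmul contour_integrable_add contour_integrable_lmul int)
  ultimately show ?thesis by simp
qed

definition kern :: "int \<Rightarrow> int \<Rightarrow> int \<Rightarrow> int \<Rightarrow> complex" where
  "kern a c a' c' = K_path k l N \<alpha> \<beta> \<gamma> tM tP r_s r_l (2 * a) c (2 * a' + 1) c'"

lemma kern_rec:
  assumes a: "0 \<le> a" "a < int n" and a': "0 \<le> a'"
  shows "complex_of_real (\<gamma> (c + 1) (a + 1)) * kern a c a' c' +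
    complex_of_real (\<alpha> (c + 1) (a + 1)) * kern a (c + 1) a' c' +
    complex_of_real (\<beta> (c + 1) (a + 1)) * kern (a + 1) (c + 1) a' c' - kern (a + 1) c a' c' =
    (if a = a' \<and> c = c' then 1 else 0)"
proof -
  define \<tau> :: complex where "\<tau> = 2 * of_real pi * \<i>"
  have \<tau>: "\<tau> \<noteq> 0" by (simp add: \<tau>_def)
  have K: "kern x d a' c' = - single_integral x d a' c' / \<tau> + double x d a' c' / \<tau>\<^sup>2"
    if "x \<in> {a, a + 1}" for x d
    unfolding kern_def \<tau>_def using that a a' by (intro K_path_eq) auto
  define p q r where "p = complex_of_real (\<gamma> (c + 1) (a + 1))" and "q = complex_of_real (\<alpha> (c + 1) (a + 1))"
    and "r = complex_of_real (\<beta> (c + 1) (a + 1))"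
  note rec = single_rec[OF a', where a = a and c = c and c' = c', folded \<tau>_def p_def q_def r_def]
    double_rec[OF a(1) a', where c = c and c' = c', folded \<tau>_def p_def q_def r_def]
  \<comment> \<open>The single integrals enter with a minus sign and the north edge has weight -1,
    so the source term comes out with coefficient +1. Treating the two inverse powers of
    \<open>\<tau>\<close> as free variables makes the claim a ring identity, with
    \<open>\<tau> \<noteq> 0\<close> used only once.\<close>
  have comb: "p * (- s\<^sub>1 / \<tau> + d\<^sub>1 / \<tau>\<^sup>2) + q * (- s\<^sub>2 / \<tau> + d\<^sub>2 / \<tau>\<^sup>2) + r * (- s\<^sub>3 / \<tau> + d\<^sub>3 / \<tau>\<^sup>2) - (- s\<^sub>4 / \<tau> + d\<^sub>4 / \<tau>\<^sup>2) =
    e" if "s\<^sub>4 - r * s\<^sub>3 = p * s\<^sub>1 + q * s\<^sub>2 + e * \<tau>" "d\<^sub>4 - r * d\<^sub>3 = p * d\<^sub>1 + q * d\<^sub>2"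
    for s\<^sub>1 s\<^sub>2 s\<^sub>3 s\<^sub>4 d\<^sub>1 d\<^sub>2 d\<^sub>3 d\<^sub>4 e :: complex
  proof -
    have 1: "s\<^sub>4 = r * s\<^sub>3 + (p * s\<^sub>1 + q * s\<^sub>2 + e * \<tau>)" "d\<^sub>4 = r * d\<^sub>3 + (p * d\<^sub>1 + q * d\<^sub>2)"
      using that by (simp_all add: algebra_simps)
    have "p * (- s\<^sub>1 * i + d\<^sub>1 * j) + q * (- s\<^sub>2 * i + d\<^sub>2 * j) + r * (- s\<^sub>3 * i + d\<^sub>3 * j) - (- s\<^sub>4 * i + d\<^sub>4 * j) =
      e * (\<tau> * i)" for i j
      unfolding 1 by (simp add: ring_distribs mult_ac)
    from this[of "inverse \<tau>" "inverse (\<tau>\<^sup>2)"] show ?thesis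
      unfolding divide_inverse right_inverse[OF \<tau>] by simp
  qed
  have Ka: "kern a d a' c' = - single_integral a d a' c' / \<tau> + double a d a' c' / \<tau>\<^sup>2"
    and Ka1: "kern (a + 1) d a' c' = - single_integral (a + 1) d a' c' / \<tau> + double (a + 1) d a' c' / \<tau>\<^sup>2" for d
    by (rule K, simp)+
  have "p * kern a c a' c' + q * kern a (c + 1) a' c' + r * kern (a + 1) (c + 1) a' c' - kern (a + 1) c a' c' =
    (if a = a' \<and> c = c' then 1 else 0)"
    unfolding Ka Ka1
  proof (rule comb)
    have delta: "(if a = a' \<and> c = c' then 1 else 0) * \<tau> = (if a = a' \<and> c = c' then \<tau> else 0)" by simp
    show "single_integral (a + 1) c a' c' - r * single_integral (a + 1) (c + 1) a' c' =
      p * single_integral a c a' c' + q * single_integral a (c + 1) a' c' + (if a = a' \<and> c = c' then 1 else 0) * \<tau>"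
      unfolding delta by (rule rec(1))
  qed (rule rec(2))
  then show ?thesis by (simp only: p_def q_def r_def)
qed

section \<open>Vanishing on the boundary rows\<close>

lemma det_scaled_minus: "det (scaled_minus z) \<noteq> 0"
proof (cases "norm z \<ge> 1")
  case True
  then have "z \<noteq> 0" by auto
  then show ?thesis using True tM(2)[OF True] by (simp add: scaled_minus_def)
qed (simp add: scaled_minus_def)

lemma minv_scaled_minus:
  assumes z: "norm z \<ge> 1"
  shows "minv (scaled_minus z) = inverse z ^ (l * N) \<cdot>\<^sub>m minv (tM z)"
proof (rule minv_eqI[OF scaled_minus_carrier])
  note m = minv[OF tM(1,2)[OF z]]
  show "inverse z ^ (l * N) \<cdot>\<^sub>m minv (tM z) \<in> carrier_mat k k" using m by simp
  have "z \<noteq> 0" using z by auto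
  then have "z ^ (l * N) * inverse z ^ (l * N) = 1"
    by (simp flip: power_mult_distrib)
  moreover have "scaled_minus z * (inverse z ^ (l * N) \<cdot>\<^sub>m minv (tM z)) =
      inverse z ^ (l * N) \<cdot>\<^sub>m (z ^ (l * N) \<cdot>\<^sub>m 1\<^sub>m k)"
    using z unfolding scaled_minus_def mult_smult_distrib[OF smult_carrier_mat[OF tM(1)[OF z]] m(1)]
    by (simp add: mult_smult_assoc_mat[OF tM(1)[OF z] m(1)] mult_smult_distrib[OF smult_carrier_mat[OF tM(1)[OF z]] m(1)] m(2))
  ultimately show "scaled_minus z * (inverse z ^ (l * N) \<cdot>\<^sub>m minv (tM z)) = 1\<^sub>m k"
    by (intro eq_matI) (simp_all add: mult.commute)
qed

lemma minv_scaled_minus_convergent: "convergent_mat_at_infinity k (\<lambda>z. minv (scaled_minus z))"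
  unfolding convergent_mat_at_infinity_def
proof (intro conjI allI impI)
  show "minv (scaled_minus z) \<in> carrier_mat k k" for z
    by (rule minv(1)[OF scaled_minus_carrier det_scaled_minus])
  show "\<exists>L. ((\<lambda>z. minv (scaled_minus z) $$ (r, s)) \<longlongrightarrow> L) at_infinity" if "r < k" "s < k" for r s
    by (rule minv_convergent_at_infinity[OF scaled_minus_carrier scaled_minus_tendsto that])
qed

lemma mat_prod_convergent:
  assumes "u' \<le> u"
  shows "convergent_mat_at_infinity k (\<lambda>z. mat_prod k (\<phi> z) u' u)"
proof (rule convergent_mat_at_infinity_prod[OF _ assms])
  fix m
  show "convergent_mat_at_infinity k (\<lambda>z. \<phi> z m)"
  proof (rule \<phi>_cases[of m])
    fix i assume "m = 2 * i - 1"
    then show ?thesis by (simp only: \<phi>_odd phi_b_convergent)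
  next
    fix i assume "m = 2 * i"
    then show ?thesis by (simp only: \<phi>_even phi_g_convergent)
  qed
qed

section \<open>The boundary row at c = n\<close>

lemma n_eq: "int n = int k * int (l * N)"
  by (simp add: n_def)

text \<open>Beyond the unit circle \<open>S\<close> cancels and the integrand continues to the whole
  exterior through \<open>minv tM\<close> and \<open>T\<close>. The power \<open>w^(-l N)\<close>
  from the column \<open>c = n\<close> exactly compensates the growth of \<open>minv tM\<close>, so
  after multiplication by \<open>w\<close> the factor \<open>1/(w - z)\<close> still forces the
  limit 0.\<close>

lemma double_top:
  assumes a: "0 \<le> a"
  shows "double a (int n) a' c' = 0"
proof -
  define Y where "Y = (\<lambda>w. minv (tM w) * T (2 * a) w)"
  define H where "H = (\<lambda>t w. Y w $$ (t, 0) * inverse w ^ (l * N) / w)"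
  have k0: "0 < k" using k by simp
  have "double a (int n) a' c' = double_integral r_s r_l k (outer_fun a' c') H"
  proof (rule double_integral_cong[OF r_s(1)])
    fix t and w :: complex assume t: "t < k" and w: "norm w = r_l"
    have wA: "w \<in> Ann" using w r_s r_l by simp
    have w1: "norm w \<ge> 1" using w r_l by simp
    note cm = minv(1)[OF tM(1,2)[OF w1]]
    have "Ep w = minv (tM w) * S w" using w r_l by (simp add: extend_plus_def)
    then have "Ep w * V (2 * a) w = minv (tM w) * (S w * (minv (S w) * T (2 * a) w))"
      unfolding V_def by (simp only: assoc_mult_mat[OF cm S_carrier mult_carrier_mat[OF minv_S_carrier[OF wA] T_carrier]])
    also have "S w * (minv (S w) * T (2 * a) w) = T (2 * a) w"
      unfolding assoc_mult_mat[OF S_carrier minv_S_carrier[OF wA] T_carrier, symmetric]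
        minv(2)[OF S_carrier det_S_nonzero[OF wA]] by (rule left_mult_one_mat[OF T_carrier])
    finally show "inner_fun a (int n) t w = H t w"
      unfolding inner_fun_def n_eq periodic_entry_multiple[OF k]
      by (simp add: H_def Y_def power_int_minus power_inverse del: of_nat_mult)
  qed (use r_l in simp)
  also have "\<dots> = contour_integral (circlepath 0 r_s) (\<lambda>_. 0)"
    unfolding double_integral_def
  proof (rule contour_integral_eq)
    fix z assume "z \<in> path_image (circlepath 0 r_s)"
    then have z: "norm z = r_s" using r_s by simp
    let ?f = "\<lambda>w. \<Sum>t<k. outer_fun a' c' t z * (H t w / (w - z))"
    show "contour_integral (circlepath 0 r_l) ?f = 0"
    proof (rule contour_integral_circlepath_exterior_eq_0[where \<rho> = 1])
      have "holomorphic_mat k (T (2 * a)) {w. 1 < norm w}"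
        using a r_s by (intro holomorphic_mat_subset[OF mat_prod_holomorphic_exterior]) auto
      from holomorphic_mat_mult[OF tM(5) this] have Y: "holomorphic_mat k Y {w. 1 < norm w}"
        unfolding Y_def .
      show "?f holomorphic_on {w. 1 < norm w}"
      proof (intro holomorphic_on_sum holomorphic_on_mult holomorphic_on_const holomorphic_on_divide)
        fix t assume "t \<in> {..<k}"
        then have "(\<lambda>w. Y w $$ (t, 0)) holomorphic_on {w. 1 < norm w}"
          using Y k0 by (simp add: holomorphic_mat_def)
        then show "H t holomorphic_on {w. 1 < norm w}"
          unfolding H_def by (intro holomorphic_intros) auto
      qed (use z r_s in \<open>auto intro!: holomorphic_intros\<close>)
      have "convergent_mat_at_infinity k (\<lambda>w. minv (scaled_minus w) * T (2 * a) w)"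
        using a by (intro convergent_mat_at_infinity_mult minv_scaled_minus_convergent mat_prod_convergent) simp
      then have ex: "\<forall>t\<in>{..<k}. \<exists>L. ((\<lambda>w. (minv (scaled_minus w) * T (2 * a) w) $$ (t, 0)) \<longlongrightarrow> L) at_infinity"
        using k0 unfolding convergent_mat_at_infinity_def by simp
      obtain L where L: "\<forall>t\<in>{..<k}. ((\<lambda>w. (minv (scaled_minus w) * T (2 * a) w) $$ (t, 0)) \<longlongrightarrow> L t) at_infinity"
        using bchoice[OF ex] by (elim exE)
      have "((\<lambda>w. \<Sum>t<k. outer_fun a' c' t z * ((minv (scaled_minus w) * T (2 * a) w) $$ (t, 0) * inverse (w - z)))
        \<longlongrightarrow> (\<Sum>t<k. outer_fun a' c' t z * (L t * 0))) at_infinity"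
        by (intro tendsto_sum tendsto_mult tendsto_const tendsto_inverse_shift bspec[OF L])
      then have "((\<lambda>w. \<Sum>t<k. outer_fun a' c' t z * ((minv (scaled_minus w) * T (2 * a) w) $$ (t, 0) * inverse (w - z)))
        \<longlongrightarrow> 0) at_infinity" by simp
      then show "((\<lambda>w. w * ?f w) \<longlongrightarrow> 0) at_infinity"
      proof (rule Lim_transform_eventually)
        show "eventually (\<lambda>w. (\<Sum>t<k. outer_fun a' c' t z * ((minv (scaled_minus w) * T (2 * a) w) $$ (t, 0) * inverse (w - z))) = w * ?f w) at_infinity"
          using eventually_exterior
        proof eventually_elim
          case (elim w)
          then have w: "norm w \<ge> 1" "w \<noteq> 0" by auto
          note cm = minv(1)[OF tM(1,2)[OF w(1)]]
          have "Y w \<in> carrier_mat k k"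
            unfolding Y_def by (rule mult_carrier_mat[OF cm T_carrier])
          moreover have Yw: "minv (tM w) * T (2 * a) w = Y w" by (simp add: Y_def)
          ultimately have "(minv (scaled_minus w) * T (2 * a) w) $$ (t, 0) = inverse w ^ (l * N) * Y w $$ (t, 0)" if "t < k" for t
            unfolding minv_scaled_minus[OF w(1)] mult_smult_assoc_mat[OF cm T_carrier] Yw
            using that k0 by (intro index_smult_mat(1)) auto
          then show ?case
            unfolding sum_distrib_left using w(2)
            by (intro sum.cong refl) (simp add: H_def divide_inverse mult_ac)
        qed
      qed
    qed (use r_l in auto)
  qed
  also have "\<dots> = 0" by simp
  finally show ?thesis .
qed

lemma single_integral_eq_0: "a \<le> a' \<Longrightarrow> single_integral a c a' c' = 0"
proof -
  assume "a \<le> a'"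
  then have "single_integral a c a' c' = contour_integral (circlepath 0 1) (\<lambda>_. 0)"
    unfolding single_integral_def using k
    by (intro contour_integral_eq) (simp add: single_def periodic_entry_def nat_less_iff)
  then show ?thesis by simp
qed

text \<open>From \<open>c' \<le> n - 1\<close> the block index \<open>y'\<close> is at most
  \<open>l N - 1\<close>, so the exponent of \<open>z\<close> is strictly negative even before the
  measure \<open>dz/z\<close> contributes.\<close>

lemma single_top:
  assumes a': "0 \<le> a'" and c': "c' \<le> int n - 1"
  shows "single_integral a (int n) a' c' = 0"
proof (cases "a \<le> a'")
  case False
  define j' y' where "j' = nat (c' mod int k)" and "y' = c' div int k"
  have j': "j' < k" using k by (simp add: nat_less_iff j'_def)
  have "int k * y' \<le> c'" using mult_div_mod_eq[of "int k" c'] pos_mod_sign[of "int k" c'] k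
    unfolding y'_def by linarith
  then have "int k * y' < int k * int (l * N)" using c' n_eq by linarith
  then have y': "y' < int (l * N)" using k by (simp only: mult_less_cancel_left_pos of_nat_0_less_iff)
  define q where "q = nat (int (l * N) - y')"
  have q: "0 < q" "y' - int (l * N) = - int q" using y' by (auto simp: q_def)
  let ?M = "\<lambda>z. mat_prod k (\<phi> z) (2 * a' + 1) (2 * a)"
  have "single_integral a (int n) a' c' = contour_integral (circlepath 0 1) (\<lambda>z. ?M z $$ (j', 0) * inverse z ^ q / z)"
    unfolding single_integral_def
  proof (rule contour_integral_eq)
    fix z :: complex assume "z \<in> path_image (circlepath 0 1)"
    then have z: "z \<noteq> 0" by auto
    have "z powi (- int (l * N)) * z powi y' = inverse z ^ q"
      using power_int_add[of z "- int (l * N)" y'] z q by (simp add: power_int_minus power_inverse)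
    then show "periodic_entry k z (single a' a z) (nat (c' mod int k)) (int n) * z powi (c' div int k) / z =
        ?M z $$ (j', 0) * inverse z ^ q / z"
      unfolding n_eq periodic_entry_multiple[OF k] j'_def[symmetric] y'_def[symmetric]
      using False by (simp only: single_def mult.assoc not_le if_True)
  qed
  also have "\<dots> = 0"
  proof (rule contour_integral_circlepath_exterior_eq_0[where \<rho> = r_s])
    have "(\<lambda>z. ?M z $$ (j', 0)) holomorphic_on {z. r_s < norm z}"
      using mat_prod_holomorphic_exterior[of "2 * a' + 1" "2 * a"] a' False j' by (simp add: holomorphic_mat_def)
    then show "(\<lambda>z. ?M z $$ (j', 0) * inverse z ^ q / z) holomorphic_on {z. r_s < norm z}"
      using r_s by (intro holomorphic_intros) auto
    have "\<exists>L. ((\<lambda>z. ?M z $$ (j', 0)) \<longlongrightarrow> L) at_infinity"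
      using mat_prod_convergent[of "2 * a' + 1" "2 * a"] False j' by (simp add: convergent_mat_at_infinity_def)
    then obtain L where L: "((\<lambda>z. ?M z $$ (j', 0)) \<longlongrightarrow> L) at_infinity" by (elim exE)
    have "((\<lambda>z. ?M z $$ (j', 0) * inverse z ^ q) \<longlongrightarrow> L * 0 ^ q) at_infinity"
      by (intro tendsto_mult L tendsto_power tendsto_inverse_0)
    then have "((\<lambda>z. ?M z $$ (j', 0) * inverse z ^ q) \<longlongrightarrow> 0) at_infinity"
      using q(1) by (simp only: zero_power mult_zero_right)
    then show "((\<lambda>z. z * (?M z $$ (j', 0) * inverse z ^ q / z)) \<longlongrightarrow> 0) at_infinity"
    proof (rule Lim_transform_eventually)
      show "eventually (\<lambda>z. ?M z $$ (j', 0) * inverse z ^ q = z * (?M z $$ (j', 0) * inverse z ^ q / z)) at_infinity"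
        using eventually_exterior
      proof eventually_elim
        case (elim z)
        then have "z \<noteq> 0" by auto
        then show ?case by simp
      qed
    qed
  qed (use r_s in auto)
  finally show ?thesis .
qed (rule single_integral_eq_0)

lemma kern_top:
  assumes "0 \<le> a" "a \<le> int n" "0 \<le> a'" "c' \<le> int n - 1"
  shows "kern a (int n) a' c' = 0"
  using assms by (simp add: kern_def K_path_eq double_top single_top)

section \<open>The boundary row at c = -1\<close>

text \<open>On the unit circle the two branches agree by the factorization
  \<open>S = tM * tP\<close>; outside it, \<open>S\<close> is holomorphic because its poles lie
  within \<open>r_s\<close>.\<close>

lemma Ep_continuous: "continuous_mat k Ep (cball 0 r_l)"
  unfolding continuous_mat_def
proof (intro conjI ballI allI impI Ep_carrier)
  fix r s assume rs: "r < k" "s < k"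
  have ext: "continuous_mat k (\<lambda>z. minv (tM z) * S z) {z \<in> cball 0 r_l. 1 \<le> norm z}"
    by (rule continuous_mat_mult[OF continuous_mat_subset[OF tM(6)]
          continuous_mat_subset[OF holomorphic_mat_imp_continuous_mat[OF S_holomorphic(1)]]])
       (use r_s in auto)
  have "continuous_on (cball 0 r_l) (\<lambda>z. if norm z \<le> 1 then tP z $$ (r, s) else (minv (tM z) * S z) $$ (r, s))"
  proof (rule continuous_on_cases_le)
    show "continuous_on {z \<in> cball 0 r_l. norm z \<le> 1} (\<lambda>z. tP z $$ (r, s))"
    proof -
      have "{z \<in> cball 0 r_l. norm z \<le> 1} \<subseteq> cball (0::complex) 1" by auto
      from continuous_mat_subset[OF tP(4) this] rs show ?thesis by (simp add: continuous_mat_def)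
    qed
    show "continuous_on {z \<in> cball 0 r_l. 1 \<le> norm z} (\<lambda>z. (minv (tM z) * S z) $$ (r, s))"
      using ext rs by (simp add: continuous_mat_def)
    show "tP z $$ (r, s) = (minv (tM z) * S z) $$ (r, s)" if "norm z = 1" for z
    proof -
      have z: "norm z \<ge> 1" "norm z \<le> 1" using that by auto
      have "minv (tM z) * S z = (minv (tM z) * tM z) * tP z"
        unfolding factorization[OF that]
        by (rule assoc_mult_mat[symmetric, OF minv(1)[OF tM(1,2)[OF z(1)]] tM(1)[OF z(1)] tP(1)[OF z(2)]])
      then show ?thesis
        unfolding minv(3)[OF tM(1,2)[OF z(1)]] left_mult_one_mat[OF tP(1)[OF z(2)]] by simp
    qed
  qed (intro continuous_on_norm continuous_on_id)
  then show "continuous_on (cball 0 r_l) (\<lambda>z. Ep z $$ (r, s))"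
    by (rule continuous_on_eq) (simp add: extend_plus_def)
qed

text \<open>Each branch is holomorphic only on its own open side, so pasting across the circle is
  needed.\<close>

lemma Ep_holomorphic: "holomorphic_mat k Ep (ball 0 r_l)"
  unfolding holomorphic_mat_def
proof (intro conjI ballI allI impI Ep_carrier)
  fix r s assume rs: "r < k" "s < k"
  show "(\<lambda>z. Ep z $$ (r, s)) holomorphic_on ball 0 r_l"
  proof (rule holomorphic_on_paste_across_circle)
    show "continuous_on (ball 0 r_l) (\<lambda>z. Ep z $$ (r, s))"
      using continuous_mat_subset[OF Ep_continuous ball_subset_cball] rs by (simp add: continuous_mat_def)
    have "(\<lambda>z. tP z $$ (r, s)) holomorphic_on ball 0 r_l \<inter> {z. norm z < 1}"
    proof -
      have "ball 0 r_l \<inter> {z. norm z < 1} \<subseteq> ball (0::complex) 1" by auto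
      from holomorphic_mat_subset[OF tP(3) this] rs show ?thesis by (simp add: holomorphic_mat_def)
    qed
    then show "(\<lambda>z. Ep z $$ (r, s)) holomorphic_on ball 0 r_l \<inter> {z. norm z < 1}"
      by (rule holomorphic_transform) (auto simp: extend_plus_def)
    have "holomorphic_mat k (\<lambda>z. minv (tM z) * S z) (ball 0 r_l \<inter> {z. 1 < norm z})"
      by (rule holomorphic_mat_mult[OF holomorphic_mat_subset[OF tM(5)] holomorphic_mat_subset[OF S_holomorphic(1)]])
         (use r_s in auto)
    then have "(\<lambda>z. (minv (tM z) * S z) $$ (r, s)) holomorphic_on ball 0 r_l \<inter> {z. 1 < norm z}"
      using rs by (simp add: holomorphic_mat_def)
    then show "(\<lambda>z. Ep z $$ (r, s)) holomorphic_on ball 0 r_l \<inter> {z. 1 < norm z}"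
      by (rule holomorphic_transform) (auto simp: extend_plus_def)
  qed auto
qed

text \<open>The inner integral is evaluated by Cauchy's formula: its integrand has no singularity inside
  \<open>|z\<^sub>2| = r_l\<close> other than \<open>z\<^sub>2 = z\<^sub>1\<close>.\<close>
lemma double_bottom:
  assumes a: "0 \<le> a" "a \<le> int n" and a': "0 \<le> a'"
  shows "double a (-1) a' c' = 2 * of_real pi * \<i> * contour_integral (circlepath 0 r_s)
    (\<lambda>z. (minv (T (2 * a' + 1) z) * T (2 * a) z) $$ (nat (c' mod int k), k - 1) * z powi (c' div int k))"
proof -
  define j' y' where "j' = nat (c' mod int k)" and "y' = c' div int k"
  have j': "j' < k" using k by (simp add: nat_less_iff j'_def)
  have k1: "k - 1 < k" using k by simp
  have rr: "0 < r_s" "r_s < r_l" using r_s r_l by auto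
  obtain F where F1: "holomorphic_mat k F (cball 0 r_l)"
    and F2: "\<forall>z\<in>Ann. F z * mat_prod k (\<phi> z) (2 * a) (2 * int n) = 1\<^sub>m k"
    using block_inverse[OF a(2)] by (elim exE conjE)
  note F = F1 bspec[OF F2]
  have cF: "F z \<in> carrier_mat k k" if "z \<in> Ann" for z
    using F(1) that by (auto simp: holomorphic_mat_def)
  \<comment> \<open>Both are inverses of the same product of whole pairs. Replacing \<open>V\<close>
    by \<open>F\<close> is what lets the integrand be continued over the origin.\<close>
  have FV: "V (2 * a) z = F z" if z: "z \<in> Ann" for z
  proof -
    let ?M = "mat_prod k (\<phi> z) (2 * a) (2 * int n)"
    have cM: "?M \<in> carrier_mat k k" by simp
    have "S z = T (2 * a) z * ?M"
      unfolding S_eq using a by (intro mat_prod_append \<phi>_carrier) auto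
    then have "V (2 * a) z * ?M = minv (S z) * S z"
      unfolding V_def assoc_mult_mat[OF minv_S_carrier[OF z] T_carrier cM] by metis
    also have "\<dots> = 1\<^sub>m k" by (rule minv(3)[OF S_carrier det_S_nonzero[OF z]])
    finally have "minv ?M = V (2 * a) z" by (rule minv_eqI_left[OF cM V_carrier[OF z]])
    moreover have "minv ?M = F z" by (rule minv_eqI_left[OF cM cF[OF z] F(2)[OF z]])
    ultimately show ?thesis by simp
  qed
  \<comment> \<open>The factor \<open>1/w\<close> of \<open>inner_fun\<close> is absent: the column
    -1 brings a factor \<open>w\<close> that cancels it.\<close>
  define H where "H = (\<lambda>t w. (Ep w * F w) $$ (t, k - 1))"
  have inner: "contour_integral (circlepath 0 r_l) (\<lambda>w. inner_fun a (-1) t w / (w - z)) = 2 * of_real pi * \<i> * H t z"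
    if t: "t < k" and z: "norm z = r_s" for t z
  proof -
    have "continuous_mat k (\<lambda>w. Ep w * F w) (cball 0 r_l)"
      by (rule continuous_mat_mult[OF Ep_continuous holomorphic_mat_imp_continuous_mat[OF F(1)]])
    moreover have "holomorphic_mat k (\<lambda>w. Ep w * F w) (ball 0 r_l)"
      by (rule holomorphic_mat_mult[OF Ep_holomorphic holomorphic_mat_subset[OF F(1) ball_subset_cball]])
    ultimately have "((\<lambda>w. H t w / (w - z)) has_contour_integral (2 * of_real pi * \<i> * H t z)) (circlepath 0 r_l)"
      unfolding H_def using t k1 z rr
      by (intro Cauchy_integral_circlepath) (auto simp: continuous_mat_def holomorphic_mat_def)
    then have "contour_integral (circlepath 0 r_l) (\<lambda>w. H t w / (w - z)) = 2 * of_real pi * \<i> * H t z"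
      by (rule contour_integral_unique)
    moreover have "contour_integral (circlepath 0 r_l) (\<lambda>w. inner_fun a (-1) t w / (w - z)) =
      contour_integral (circlepath 0 r_l) (\<lambda>w. H t w / (w - z))"
    proof (rule contour_integral_eq)
      fix w assume "w \<in> path_image (circlepath 0 r_l)"
      then have w: "w \<in> Ann" using rr r_l by auto
      show "inner_fun a (-1) t w / (w - z) = H t w / (w - z)"
        unfolding inner_fun_def periodic_entry_minus_1[OF k] FV[OF w] H_def
        using Ann_nonzero[OF w] by simp
    qed
    ultimately show ?thesis by simp
  qed
  let ?G = "\<lambda>z. minv (T (2 * a' + 1) z) * T (2 * a) z"
  have "double a (-1) a' c' = contour_integral (circlepath 0 r_s)
    (\<lambda>z. \<Sum>t<k. outer_fun a' c' t z * contour_integral (circlepath 0 r_l) (\<lambda>w. inner_fun a (-1) t w / (w - z)))"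
    by (rule double_integral_eq[OF rr]) (rule inner_fun_continuous[OF _ a(1)])
  also have "\<dots> = contour_integral (circlepath 0 r_s) (\<lambda>z. 2 * of_real pi * \<i> * (?G z $$ (j', k - 1) * z powi y'))"
  proof (rule contour_integral_eq)
    fix z assume "z \<in> path_image (circlepath 0 r_s)"
    then have z: "norm z = r_s" using r_s by simp
    then have zA: "z \<in> Ann" using rr by simp
    have z1: "norm z \<le> 1" using z r_s by simp
    note mP = minv[OF tP(1,2)[OF z1]]
    note mT = minv(1)[OF T_carrier[of z "2 * a' + 1"] det_mat_prod_nonzero[OF zA]]
    have u: "0 \<le> 2 * a' + 1" using a' by simp
    have cA: "A (2 * a' + 1) z \<in> carrier_mat k k" by (rule A_carrier[OF zA u])
    have cEF: "Ep z * F z \<in> carrier_mat k k" by (rule mult_carrier_mat[OF Ep_carrier cF[OF zA]])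
    have E: "Em z = S z * minv (tP z)" "Ep z = tP z"
      using z r_s by (simp_all add: extend_minus_def extend_plus_def)
    \<comment> \<open>At the residue both extensions are evaluated at the same point, where
      \<open>Em * Ep = S\<close>; the Wiener-Hopf factors disappear from the result.\<close>
    have "Em z * (Ep z * F z) = S z * (minv (tP z) * (tP z * F z))"
      unfolding E by (rule assoc_mult_mat[OF S_carrier mP(1) mult_carrier_mat[OF tP(1)[OF z1] cF[OF zA]]])
    also have "minv (tP z) * (tP z * F z) = F z"
      unfolding assoc_mult_mat[OF mP(1) tP(1)[OF z1] cF[OF zA], symmetric] mP(3) by (rule left_mult_one_mat[OF cF[OF zA]])
    also have "S z * F z = T (2 * a) z"
      unfolding FV[OF zA, symmetric] V_def assoc_mult_mat[OF S_carrier minv_S_carrier[OF zA] T_carrier, symmetric]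
        minv(2)[OF S_carrier det_S_nonzero[OF zA]] by (rule left_mult_one_mat[OF T_carrier])
    finally have "A (2 * a' + 1) z * (Ep z * F z) = ?G z"
      unfolding A_def by (simp only: assoc_mult_mat[OF mT[OF u] Em_carrier cEF])
    then have "?G z $$ (j', k - 1) = (\<Sum>t<k. A (2 * a' + 1) z $$ (j', t) * H t z)"
      using index_mult_mat_sum[OF cA cEF j' k1] by (simp only: H_def)
    then show "(\<Sum>t<k. outer_fun a' c' t z * contour_integral (circlepath 0 r_l) (\<lambda>w. inner_fun a (-1) t w / (w - z))) =
      2 * of_real pi * \<i> * (?G z $$ (j', k - 1) * z powi y')"
      by (simp add: inner[OF _ z] outer_fun_def j'_def y'_def sum_distrib_left sum_distrib_right mult_ac)
  qed
  also have "\<dots> = 2 * of_real pi * \<i> * contour_integral (circlepath 0 r_s) (\<lambda>z. ?G z $$ (j', k - 1) * z powi y')"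
  proof (rule contour_integral_lmul, rule contour_integrable_continuous_circlepath)
    have "holomorphic_mat k ?G Ann"
      using a a' by (intro holomorphic_mat_mult minv_T_holomorphic mat_prod_holomorphic_Ann) auto
    from continuous_mat_subset[OF holomorphic_mat_imp_continuous_mat[OF this] spheres_subset(1)]
    show "continuous_on (path_image (circlepath 0 r_s)) (\<lambda>z. ?G z $$ (j', k - 1) * z powi y')"
      using r_s j' k1 by (auto simp: continuous_mat_def intro!: continuous_on_mult continuous_on_power_int continuous_on_id)
  qed
  finally show ?thesis by (simp only: j'_def y'_def)
qed

text \<open>By \<open>double_bottom\<close> it suffices that the remaining integral \<open>J\<close>
  equals the single integral. For \<open>a > a'\<close> the partial inverse cancels and the contour
  moves from \<open>r_s\<close> to 1; for \<open>a \<le> a'\<close> both integrals are 0.\<close>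

lemma kern_bottom:
  assumes a: "0 \<le> a" "a \<le> int n" and a': "0 \<le> a'" and c': "-1 \<le> c'"
  shows "kern a (-1) a' c' = 0"
proof -
  define j' y' where "j' = nat (c' mod int k)" and "y' = c' div int k"
  have j': "j' < k" using k by (simp add: nat_less_iff j'_def)
  have k1: "k - 1 < k" using k by simp
  let ?G = "\<lambda>z. minv (T (2 * a' + 1) z) * T (2 * a) z"
  let ?J = "contour_integral (circlepath 0 r_s) (\<lambda>z. ?G z $$ (j', k - 1) * z powi y')"
  have J: "?J = single_integral a (-1) a' c'"
  proof (cases "a > a'")
    case True
    let ?M = "\<lambda>z. mat_prod k (\<phi> z) (2 * a' + 1) (2 * a)"
    \<comment> \<open>An open set, being cofinite, that contains the closed annulus between
      \<open>r_s\<close> and 1, since every \<open>pole_g\<close> has modulus below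
      \<open>r_s\<close>.\<close>
    let ?X = "- insert 0 (pole_g ` {0..2 * a})"
    have G: "?G z = ?M z" if z: "z \<in> Ann" for z
    proof -
      have u: "0 \<le> 2 * a' + 1" using a' by simp
      have cM: "?M z \<in> carrier_mat k k" by simp
      note m = minv[OF T_carrier[of z "2 * a' + 1"] det_mat_prod_nonzero[OF z u]]
      have "T (2 * a) z = T (2 * a' + 1) z * ?M z"
        using a' True by (intro mat_prod_append \<phi>_carrier) auto
      then have "?G z = (minv (T (2 * a' + 1) z) * T (2 * a' + 1) z) * ?M z"
        by (simp only: assoc_mult_mat[OF m(1) T_carrier cM])
      then show ?thesis unfolding m(3) left_mult_one_mat[OF cM] .
    qed
    have "holomorphic_mat k ?M ?X"
      using a' True by (intro mat_prod_holomorphic) auto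
    then have hol: "(\<lambda>z. ?M z $$ (j', k - 1) * z powi y') holomorphic_on ?X"
      using j' k1 by (auto simp: holomorphic_mat_def intro!: holomorphic_intros)
    have "?J = contour_integral (circlepath 0 r_s) (\<lambda>z. ?M z $$ (j', k - 1) * z powi y')"
    proof (rule contour_integral_eq)
      fix z assume "z \<in> path_image (circlepath 0 r_s)"
      then have "z \<in> Ann" using r_s r_l by auto
      from G[OF this] show "?G z $$ (j', k - 1) * z powi y' = ?M z $$ (j', k - 1) * z powi y'" by (simp only:)
    qed
    also have "\<dots> = contour_integral (circlepath 0 1) (\<lambda>z. ?M z $$ (j', k - 1) * z powi y')"
    proof (rule contour_integral_circlepath_annulus_eq[OF _ hol])
      show "open ?X" by (intro open_Compl finite_imp_closed) simp
      show "{z. r_s \<le> norm z \<and> norm z \<le> 1} \<subseteq> ?X"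
      proof
        fix z :: complex assume "z \<in> {z. r_s \<le> norm z \<and> norm z \<le> 1}"
        then have z: "r_s \<le> norm z" by simp
        then have "z \<noteq> pole_g i" for i using poles(1)[of i] by auto
        moreover have "z \<noteq> 0" using z r_s by auto
        ultimately show "z \<in> ?X" by auto
      qed
    qed (use r_s in auto)
    also have "\<dots> = single_integral a (-1) a' c'"
      unfolding single_integral_def
    proof (rule contour_integral_eq)
      fix z :: complex assume "z \<in> path_image (circlepath 0 1)"
      then have "z \<noteq> 0" by auto
      then show "?M z $$ (j', k - 1) * z powi y' =
        periodic_entry k z (single a' a z) (nat (c' mod int k)) (-1) * z powi (c' div int k) / z"
        unfolding periodic_entry_minus_1[OF k] using True by (simp add: single_def j'_def y'_def)
    qed
    finally show ?thesis .
  next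
    case False
    then have le: "a \<le> a'" by simp
    obtain F where F1: "holomorphic_mat k F (cball 0 r_l)"
      and F2: "\<forall>z\<in>Ann. F z * mat_prod k (\<phi> z) (2 * a) (2 * a') = 1\<^sub>m k"
      using block_inverse[OF le] by (elim exE conjE)
    note F = F1 bspec[OF F2]
    have cF: "F z \<in> carrier_mat k k" if "z \<in> cball 0 r_l" for z
      using F(1) that by (auto simp: holomorphic_mat_def)
    \<comment> \<open>What is left is the inverse of the factors \<open>2 a + 1\<close> to
      \<open>2 a' + 1\<close>: the whole pairs are handled by \<open>F\<close>, and the unpaired
      last \<open>phi_b\<close> has the inverse \<open>\<phi>_inv\<close>, which is regular at the
      origin by itself.\<close>
    have pre: "\<phi>_inv (a' + 1) z * F z = ?G z" if z: "z \<in> Ann" for z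
    proof -
      let ?M = "mat_prod k (\<phi> z) (2 * a) (2 * a')" and ?o = "\<phi> z (2 * a' + 1)"
      let ?Q = "mat_prod k (\<phi> z) (2 * a) (2 * a' + 1)"
      have cM: "?M \<in> carrier_mat k k" and cQ: "?Q \<in> carrier_mat k k" by simp_all
      have cFz: "F z \<in> carrier_mat k k" using cF z by simp
      have Q: "?Q = ?M * ?o" using le by (intro mat_prod_snoc \<phi>_carrier) simp
      have "(\<phi>_inv (a' + 1) z * F z) * ?Q = \<phi>_inv (a' + 1) z * ((F z * ?M) * ?o)"
        unfolding Q assoc_mult_mat[OF \<phi>_inv_carrier cFz mult_carrier_mat[OF cM \<phi>_carrier]]
          assoc_mult_mat[OF cFz cM \<phi>_carrier] ..
      also have "\<dots> = \<phi>_inv (a' + 1) z * \<phi> z (2 * (a' + 1) - 1)"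
        unfolding F(2)[OF z] left_mult_one_mat[OF \<phi>_carrier] by (simp add: add.commute)
      also have "\<dots> = 1\<^sub>m k" by (rule \<phi>_odd_inv[OF z])
      finally have 1: "minv ?Q = \<phi>_inv (a' + 1) z * F z"
        by (rule minv_eqI_left[OF cQ mult_carrier_mat[OF \<phi>_inv_carrier cFz]])
      have "0 \<le> 2 * a" using a by simp
      note dT = det_mat_prod_nonzero[OF z this]
      have "2 * a \<le> 2 * a' + 1" using le by simp
      note dQ = det_mat_prod_nonzero[OF z this]
      have "T (2 * a' + 1) z = T (2 * a) z * ?Q"
        using a le by (intro mat_prod_append \<phi>_carrier) auto
      then have "?G z = minv ?Q * (minv (T (2 * a) z) * T (2 * a) z)"
        by (simp only: minv_mult[OF T_carrier dT cQ dQ] assoc_mult_mat[OF minv(1)[OF cQ dQ] minv(1)[OF T_carrier dT] T_carrier])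
      then show ?thesis
        unfolding minv(3)[OF T_carrier dT] right_mult_one_mat[OF minv(1)[OF cQ dQ]] by (simp only: 1)
    qed
    \<comment> \<open>The continuation of the integrand to the full disc. A negative
      \<open>y'\<close> occurs only for \<open>c' = -1\<close>, where \<open>y' = -1\<close> and
      \<open>j' = k - 1\<close>; then \<open>1/z\<close> is cancelled by the factor \<open>z\<close>
      in the last row of \<open>\<phi>_inv\<close>, which the second branch leaves out.\<close>
    define h where "h = (\<lambda>z. if 0 \<le> y' then (\<phi>_inv (a' + 1) z * F z) $$ (j', k - 1) * z ^ nat y'
      else (\<Sum>t<k. ((\<Prod>m=t+1..k-1. ratio (av (a' + 1)) (gv (a' + 1)) m) / (z - zero_b (a' + 1)) / gv (a' + 1) k) * F z $$ (t, k - 1)))"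
    have Fb: "holomorphic_mat k F (ball 0 r_l)" by (rule holomorphic_mat_subset[OF F(1) ball_subset_cball])
    have zb: "zero_b (a' + 1) \<notin> ball 0 r_l" using poles(2)[of "a' + 1"] by simp
    have inv_hol: "holomorphic_mat k (\<phi>_inv (a' + 1)) (ball 0 r_l)"
      unfolding \<phi>_inv_def using zb unfolding zero_b_def by (rule phi_b_inv_holomorphic)
    have "h holomorphic_on ball 0 r_l"
    proof (cases "0 \<le> y'")
      case True
      then show ?thesis
        using holomorphic_mat_mult[OF inv_hol Fb] j' k1
        by (auto simp: h_def holomorphic_mat_def intro!: holomorphic_on_mult holomorphic_on_power holomorphic_on_ident)
    next
      case False
      have "(\<lambda>z. F z $$ (t, k - 1)) holomorphic_on ball 0 r_l" if "t < k" for t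
        using Fb that k1 by (simp add: holomorphic_mat_def)
      then have "(\<lambda>z. \<Sum>t<k. ((\<Prod>m=t+1..k-1. ratio (av (a' + 1)) (gv (a' + 1)) m) / (z - zero_b (a' + 1)) / gv (a' + 1) k) * F z $$ (t, k - 1)) holomorphic_on ball 0 r_l"
        using zb gv_nonzero
        by (intro holomorphic_on_sum holomorphic_on_mult holomorphic_on_divide holomorphic_on_const
            holomorphic_on_diff holomorphic_on_ident) auto
      then show ?thesis using False by (simp add: h_def)
    qed
    then have "contour_integral (circlepath 0 r_s) h = 0"
      using r_s r_l by (intro contour_integral_unique Cauchy_theorem_convex_simple[of _ "ball 0 r_l"]) auto
    moreover have "?J = contour_integral (circlepath 0 r_s) h"
    proof (rule contour_integral_eq)
      fix z assume "z \<in> path_image (circlepath 0 r_s)"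
      then have z: "z \<in> Ann" "z \<in> cball 0 r_l" using r_s r_l by auto
      show "?G z $$ (j', k - 1) * z powi y' = h z"
      proof (cases "0 \<le> y'")
        case True
        then have "z powi y' = z ^ nat y'" by (simp add: power_int_def)
        then show ?thesis unfolding pre[OF z(1), symmetric] using True by (simp add: h_def)
      next
        case False
        have "y' \<ge> -1" using zdiv_mono1[OF c', of "int k"] k int_div_pos_eq[of "-1" "int k" "-1" "int k - 1"]
          by (simp add: y'_def)
        then have y: "y' = -1" using False by simp
        have "c' < 0" using False k by (simp add: y'_def pos_imp_zdiv_nonneg_iff)
        then have "c' = -1" using c' by simp
        then have j: "j' = k - 1"
          using k int_mod_pos_eq[of "-1" "int k" "-1" "int k - 1"] by (simp add: j'_def)
        have "(\<phi>_inv (a' + 1) z * F z) $$ (k - 1, k - 1) * z powi y' = h z"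
          unfolding index_mult_mat_sum[OF \<phi>_inv_carrier cF[OF z(2)] k1 k1] sum_distrib_right h_def
          using False Ann_nonzero[OF z(1)]
          by (auto simp: \<phi>_inv_def index_phi_b_inv_last_row[OF k] y zero_b_def simp del: One_nat_def intro!: sum.cong)
        then show ?thesis unfolding pre[OF z(1)] j .
      qed
    qed
    ultimately show ?thesis using single_integral_eq_0[OF le] by simp
  qed
  \<comment> \<open>The factor \<open>2 pi i\<close> from Cauchy's formula turns the square in the
    prefactor of the double integral into a first power, so the two terms of the kernel
    cancel.\<close>
  have "double a (-1) a' c' = 2 * of_real pi * \<i> * single_integral a (-1) a' c'"
    unfolding double_bottom[OF a a'] j'_def[symmetric] y'_def[symmetric] J ..
  then show ?thesis
    unfolding kern_def K_path_eq[OF a a'] by (simp add: power2_eq_square)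
qed

section \<open>From the kernel to the inverse matrix\<close>

text \<open>The first coordinates \<open>2 a\<close> and \<open>2 a' + 1\<close> of the vertices are
  already the times of the path kernel; only the second coordinates have to be decoded.\<close>

definition L :: "int \<times> int \<Rightarrow> int \<times> int \<Rightarrow> complex" where
  "L b w = K_path k l N \<alpha> \<beta> \<gamma> tM tP r_s r_l (fst b) (snd b div 2) (fst w) ((snd w - 2) div 2)"

lemma L_eq_kern: "L (black a c) (white a' c') = kern a c a' c'"
  by (simp add: L_def kern_def black_def white_def)

lemma kasteleyn_L:
  assumes w: "w \<in> aztec_white n" and w': "w' \<in> aztec_white n"
  shows "(\<Sum>b\<in>aztec_black n. kasteleyn \<alpha> \<beta> \<gamma> w b * L b w') = (if w = w' then 1 else 0)"
proof -
  obtain a c where w_eq: "w = white a c" and a: "0 \<le> a" "a \<le> int n - 1" and c: "-1 \<le> c" "c \<le> int n - 1"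
    using w by (auto simp: aztec_white_def)
  obtain a' c' where w'_eq: "w' = white a' c'" and a': "0 \<le> a'" and c': "-1 \<le> c'" "c' \<le> int n - 1"
    using w' by (auto simp: aztec_white_def)
  \<comment> \<open>The diamond enlarged by the rows -1 and \<open>n\<close>, where the kernel
    vanishes. As \<open>c\<close> runs from -1 to \<open>n - 1\<close>, all four neighbours of a
    white vertex lie in \<open>B\<close>, so the lattice recursion applies to boundary vertices
    too.\<close>
  define B where "B = (\<lambda>(a, c). black a c) ` ({0..int n} \<times> {-1..int n})"
  define Q where "Q = {black a c, black a (c + 1), black (a + 1) (c + 1), black (a + 1) c}"
  have "(\<Sum>b\<in>aztec_black n. kasteleyn \<alpha> \<beta> \<gamma> w b * L b w') = (\<Sum>b\<in>B. kasteleyn \<alpha> \<beta> \<gamma> w b * L b w')"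
  proof (rule sum.mono_neutral_left)
    show "finite B" by (simp add: B_def)
    show "aztec_black n \<subseteq> B" unfolding B_def aztec_black_eq by (rule image_mono) auto
    show "\<forall>b\<in>B - aztec_black n. kasteleyn \<alpha> \<beta> \<gamma> w b * L b w' = 0"
    proof
      fix b assume b: "b \<in> B - aztec_black n"
      then obtain x d where xd: "b = black x d" "0 \<le> x" "x \<le> int n" "-1 \<le> d" "d \<le> int n"
        by (auto simp: B_def)
      moreover have "\<not> (0 \<le> d \<and> d \<le> int n - 1)" using b xd by (auto simp: aztec_black_def)
      ultimately have "d = -1 \<or> d = int n" by linarith
      then have "L b w' = 0"
        using kern_top[OF xd(2,3) a' c'(2)] kern_bottom[OF xd(2,3) a' c'(1)]
        by (auto simp: xd(1) w'_eq L_eq_kern)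
      then show "kasteleyn \<alpha> \<beta> \<gamma> w b * L b w' = 0" by simp
    qed
  qed
  also have "\<dots> = (\<Sum>b\<in>Q. kasteleyn \<alpha> \<beta> \<gamma> w b * L b w')"
  proof (rule sum.mono_neutral_right)
    show "finite B" by (simp add: B_def)
    show "Q \<subseteq> B" using a c by (auto simp: Q_def B_def image_iff)
    show "\<forall>b\<in>B - Q. kasteleyn \<alpha> \<beta> \<gamma> w b * L b w' = 0"
      by (simp add: w_eq kasteleyn_white Q_def)
  qed
  also have "\<dots> = complex_of_real (\<gamma> (c + 1) (a + 1)) * kern a c a' c' +
    complex_of_real (\<alpha> (c + 1) (a + 1)) * kern a (c + 1) a' c' +
    complex_of_real (\<beta> (c + 1) (a + 1)) * kern (a + 1) (c + 1) a' c' - kern (a + 1) c a' c'"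
    by (simp add: Q_def w_eq w'_eq kasteleyn_white L_eq_kern)
  also have "\<dots> = (if a = a' \<and> c = c' then 1 else 0)"
    using a a' by (intro kern_rec) auto
  finally show ?thesis by (simp add: w_eq w'_eq)
qed

lemma L_is_inverse: "is_inverse_on (aztec_white n) (aztec_black n) (kasteleyn \<alpha> \<beta> \<gamma>) L"
  by (rule is_inverse_onI_right[OF finite_aztec(2,1) card_aztec kasteleyn_L])

end

theorem theorem1p1:
  fixes k l N :: nat
    and \<alpha> \<beta> \<gamma> :: "int \<Rightarrow> int \<Rightarrow> real"
    and P M tM tP :: "complex \<Rightarrow> complex mat"
    and r_s r_l :: real
  assumes "k \<ge> 1" and "l \<ge> 1" and "N \<ge> 1"
    and "periodic_weights k l \<alpha>" and "periodic_weights k l \<beta>" and "periodic_weights k l \<gamma>"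
    and "analytic_invertible_on k (path_symbol k l N \<alpha> \<beta> \<gamma>) (sphere 0 1)"
    and "wiener_hopf k (l * N) (path_symbol k l N \<alpha> \<beta> \<gamma>) P M tM tP"
    and "0 < r_s" and "r_s < 1" and "1 < r_l"
    and "analytic_invertible_on k (path_symbol k l N \<alpha> \<beta> \<gamma>) {z. r_s \<le> norm z \<and> norm z \<le> r_l}"
  shows "invertible_on (aztec_white (k * l * N)) (aztec_black (k * l * N)) (kasteleyn \<alpha> \<beta> \<gamma>) \<and>
    (\<forall>x i y j x' i' y' j' :: int.
       i \<in> {0..<int l} \<longrightarrow> i' \<in> {0..<int l} \<longrightarrow> j \<in> {0..<int k} \<longrightarrow> j' \<in> {0..<int k} \<longrightarrow>
       black (int l * x + i) (int k * y + j) \<in> aztec_black (k * l * N) \<longrightarrow>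
       white (int l * x' + i') (int k * y' + j') \<in> aztec_white (k * l * N) \<longrightarrow>
       inverse_on (aztec_white (k * l * N)) (aztec_black (k * l * N)) (kasteleyn \<alpha> \<beta> \<gamma>)
           (black (int l * x + i) (int k * y + j)) (white (int l * x' + i') (int k * y' + j')) =
       K_path k l N \<alpha> \<beta> \<gamma> tM tP r_s r_l
           (2 * int l * x + 2 * i) (int k * y + j) (2 * int l * x' + 2 * i' + 1) (int k * y' + j'))"
proof -
  interpret aztec_wiener_hopf k l N \<alpha> \<beta> \<gamma> P M tM tP r_s r_l
    by unfold_locales (fact assms)+
  note inv = L_is_inverse[unfolded n_def]
  show ?thesis
  proof (intro conjI allI impI)
    show "invertible_on (aztec_white (k * l * N)) (aztec_black (k * l * N)) (kasteleyn \<alpha> \<beta> \<gamma>)"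
      unfolding invertible_on_def by (rule exI[of _ L]) (rule inv)
  next
    fix x i y j x' i' y' j' :: int
    assume mem: "black (int l * x + i) (int k * y + j) \<in> aztec_black (k * l * N)"
      "white (int l * x' + i') (int k * y' + j') \<in> aztec_white (k * l * N)"
    have "2 * (int l * x + i) = 2 * int l * x + 2 * i" "2 * (int l * x' + i') + 1 = 2 * int l * x' + 2 * i' + 1"
      by (simp_all add: algebra_simps)
    then show "inverse_on (aztec_white (k * l * N)) (aztec_black (k * l * N)) (kasteleyn \<alpha> \<beta> \<gamma>)
           (black (int l * x + i) (int k * y + j)) (white (int l * x' + i') (int k * y' + j')) =
       K_path k l N \<alpha> \<beta> \<gamma> tM tP r_s r_l
           (2 * int l * x + 2 * i) (int k * y + j) (2 * int l * x' + 2 * i' + 1) (int k * y' + j')"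
      unfolding inverse_on_eq[OF finite_aztec(2,1) inv mem] L_eq_kern kern_def by (simp only:)
  qed
qed

end
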